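(* Let $S$ be Jakubowski's $S$-topology and $S^*$ the weak $S$-topology on the Skorokhod space $\mathbb{D}(I;\mathbb{R}^d)$. The $S$-topology has the following properties: (a) $S$ is Hausdorff; (b) each $S$-compact set $K\in\mathcal{K}(S)$ is metrizable; (c) a set is compact if and only if it is sequentially compact; (d) the Borel $\sigma$-algebra $\mathcal{B}(S)$ and the canonical $\sigma$-algebra coincide; (e) the Skorokhod space endowed with $S$ is a Lusin space. The $S^*$-topology has the properties (a)-(e) (with $S$ replaced by $S^*$) and additionally: (f) the Skorokhod space endowed with $S^*$ is perfectly normal and paracompact; (g) the Borel $\sigma$-algebra $\mathcal{B}(S^* )$ and the Baire $\sigma$-algebra $\mathcal{B}a(S^* )$ coincide; (h) $\mathbb{C}(S)=\mathbb{C}(S^* )$; (i) $\mathcal{K}(S)=\mathcal{K}(S^* )$.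
   Context: $I$ is $[0,T]$ with $0<T\le\infty$, or $I=[0,\infty)$; $d\in\mathbb{N}$. $\mathbb{D}(I;\mathbb{R}^d)$ is the set of c\`adl\`ag functions $\omega=(\omega^1,\dots,\omega^d):I\to\mathbb{R}^d$; $\mathbb{D}([0,\infty];\mathbb{R}^d)$ is regarded as the product $\mathbb{D}([0,\infty);\mathbb{R}^d)\times\mathbb{R}^d$ with the Euclidean topology on $\mathbb{R}^d$. The canonical $\sigma$-algebra is $\sigma(X_u:u\in I)$, $X_u(\omega)=\omega(u)$. $S$-topology: on $\mathbb{D}([0,T];\mathbb{R}^d)$, $T<\infty$, write $\omega_n\to_S\omega_0$ if for every $i\le d$ and $\varepsilon>0$ there are functions $(\nu_n^{i,\varepsilon})_{n\ge 0}$ of finite variation on $[0,T]$ with $\|\omega_n^i-\nu_n^{i,\varepsilon}\|_\infty\le\varepsilon$ for all $n\ge0$ and $\nu_n^{i,\varepsilon}\to\nu_0^{i,\varepsilon}$ in the weak${}^*$ topology obtained by identifying finite-variation functions on $[0,T]$ with the Banach dual of $C([0,T])$. On $\mathbb{D}([0,\infty);\mathbb{R}^d)$, write $\omega_n\to_S\omega_0$ if for every $i\le d$ there are positive reals $T^r\uparrow\infty$ such that the restrictions of $\omega^i_n$ to $[0,T^r]$ $S$-converge to the restriction of $\omega_0^i$ for every $r$. The $S$-topology is the sequential topology generated by subsequential $S$-convergence: a set is closed iff it contains the limit $\omega_0$ of every sequence of its elements such that each subsequence has a further subsequence $S$-converging to $\omega_0$. Weak $S$-topology $S^*$: the topology with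 subbase $\{f^{-1}(V): f \text{ bounded real-valued } S\text{-continuous},\ V\subset\mathbb{R}\text{ open}\}$. For a topology $\tau$ on the Skorokhod space: $\mathcal{K}(\tau)$ is the family of compact sets, $\mathbb{C}(\tau)$ the family of continuous real-valued functions, $\mathcal{B}(\tau)$ the Borel $\sigma$-algebra, $\mathcal{B}a(\tau)$ the Baire $\sigma$-algebra (generated by $\mathbb{C}(\tau)$). Sequentially compact: every infinite sequence of elements of the set has a subsequence converging to an element of the set. Lusin space: the image of a complete separable metric space under a continuous one-to-one mapping. Perfectly normal ($T_6$): Hausdorff and every closed set is of the form $f^{-1}(0)$ for some continuous real function $f$. Paracompact: every open cover has a locally finite open refinement. *)

theory Defs
  imports "HOL-Analysis.Analysis"
begin

section \<open>General topology\<close>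

definition sequentially_compactin :: "'a topology \<Rightarrow> 'a set \<Rightarrow> bool" where
  "sequentially_compactin X K \<longleftrightarrow>
     K \<subseteq> topspace X \<and>
     (\<forall>x::nat \<Rightarrow> 'a. range x \<subseteq> K \<longrightarrow>
        (\<exists>l\<in>K. \<exists>r::nat \<Rightarrow> nat. strict_mono r \<and> limitin X (x \<circ> r) l sequentially))"

text \<open>The metric space is taken on the type of the points of \<^term>\<open>X\<close>. This is no loss of
  generality: the mapping is one-to-one and onto, so any metric can be transported along it.\<close>
definition Lusin_space :: "'a topology \<Rightarrow> bool" where
  "Lusin_space X \<longleftrightarrow>
     (\<exists>(M :: 'a set) d f.
        Metric_space M d \<and> Metric_space.mcomplete M d \<and>
        separable_space (Metric_space.mtopology M d) \<and>
        continuous_map (Metric_space.mtopology M d) X f \<and>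
        inj_on f M \<and> f ` M = topspace X)"

definition perfectly_normal_space :: "'a topology \<Rightarrow> bool" where
  "perfectly_normal_space X \<longleftrightarrow>
     Hausdorff_space X \<and>
     (\<forall>C. closedin X C \<longrightarrow>
        (\<exists>f. continuous_map X euclideanreal f \<and> C = {x \<in> topspace X. f x = 0}))"

definition paracompact_space :: "'a topology \<Rightarrow> bool" where
  "paracompact_space X \<longleftrightarrow>
     (\<forall>\<U>. (\<forall>U\<in>\<U>. openin X U) \<and> \<Union>\<U> = topspace X \<longrightarrow>
        (\<exists>\<V>. (\<forall>V\<in>\<V>. openin X V) \<and> \<Union>\<V> = topspace X \<and>
             (\<forall>V\<in>\<V>. \<exists>U\<in>\<U>. V \<subseteq> U) \<and> locally_finite_in X \<V>))"

definition Borel_sets :: "'a topology \<Rightarrow> 'a set set" where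
  "Borel_sets X = sigma_sets (topspace X) {U. openin X U}"

definition Baire_sets :: "'a topology \<Rightarrow> 'a set set" where
  "Baire_sets X = sigma_sets (topspace X)
     {{x \<in> topspace X. f x \<in> B} | f B. continuous_map X euclideanreal f \<and> B \<in> sets borel}"

definition weak_topology :: "'a topology \<Rightarrow> 'a topology" where
  "weak_topology X = topology_generated_by
     {{x \<in> topspace X. f x \<in> V} | f V.
        continuous_map X euclideanreal f \<and> bounded (f ` topspace X) \<and> open V}"


section \<open>Sequential topology generated by a notion of convergence\<close>

definition subseq_converges ::
    "((nat \<Rightarrow> 'a) \<Rightarrow> 'a \<Rightarrow> bool) \<Rightarrow> (nat \<Rightarrow> 'a) \<Rightarrow> 'a \<Rightarrow> bool" where
  "subseq_converges conv x l \<longleftrightarrow>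
     (\<forall>r::nat \<Rightarrow> nat. strict_mono r \<longrightarrow>
        (\<exists>q::nat \<Rightarrow> nat. strict_mono q \<and> conv (x \<circ> r \<circ> q) l))"

definition seq_closed ::
    "'a set \<Rightarrow> ((nat \<Rightarrow> 'a) \<Rightarrow> 'a \<Rightarrow> bool) \<Rightarrow> 'a set \<Rightarrow> bool" where
  "seq_closed D conv C \<longleftrightarrow>
     C \<subseteq> D \<and>
     (\<forall>x l. range x \<subseteq> C \<and> l \<in> D \<and> subseq_converges conv x l \<longrightarrow> l \<in> C)"

definition sequential_topology ::
    "'a set \<Rightarrow> ((nat \<Rightarrow> 'a) \<Rightarrow> 'a \<Rightarrow> bool) \<Rightarrow> 'a topology" where
  "sequential_topology D conv = topology (\<lambda>U. U \<subseteq> D \<and> seq_closed D conv (D - U))"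

lemma subseq_converges_subseq:
  assumes "subseq_converges conv x l" "strict_mono r"
  shows "subseq_converges conv (x \<circ> r) l"
  unfolding subseq_converges_def
proof (intro allI impI)
  fix s :: "nat \<Rightarrow> nat" assume "strict_mono s"
  then have "strict_mono (r \<circ> s)"
    using assms(2) by (simp add: strict_mono_o)
  then obtain q where "strict_mono q" "conv (x \<circ> (r \<circ> s) \<circ> q) l"
    using assms(1) unfolding subseq_converges_def by blast
  then show "\<exists>q. strict_mono q \<and> conv (x \<circ> r \<circ> s \<circ> q) l"
    by (metis comp_assoc)
qed

lemma seq_closed_Un:
  assumes A: "seq_closed D conv A" and B: "seq_closed D conv B"
  shows "seq_closed D conv (A \<union> B)"
  unfolding seq_closed_def
proof (intro conjI allI impI)
  show "A \<union> B \<subseteq> D" using A B unfolding seq_closed_def by blast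
  fix x l assume x: "range x \<subseteq> A \<union> B \<and> l \<in> D \<and> subseq_converges conv x l"
  have *: "l \<in> C" if C: "seq_closed D conv C" and inf: "infinite {n. x n \<in> C}" for C
  proof -
    define r where "r = enumerate {n. x n \<in> C}"
    have r: "strict_mono r" using strict_mono_enumerate[OF inf] by (simp add: r_def)
    have "x (r n) \<in> C" for n using enumerate_in_set[OF inf, of n] by (simp add: r_def)
    then have "range (x \<circ> r) \<subseteq> C" by auto
    moreover have "subseq_converges conv (x \<circ> r) l"
      using x r by (intro subseq_converges_subseq) auto
    ultimately show ?thesis using C x unfolding seq_closed_def by blast
  qed
  have "{n. x n \<in> A} \<union> {n. x n \<in> B} = UNIV" using x by auto
  then have "infinite {n. x n \<in> A} \<or> infinite {n. x n \<in> B}"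
    using finite_UnI[of "{n. x n \<in> A}" "{n. x n \<in> B}"] infinite_UNIV_nat by auto
  then show "l \<in> A \<union> B" using * A B by blast
qed

lemma istopology_seq_closed:
  "istopology (\<lambda>U. U \<subseteq> D \<and> seq_closed D conv (D - U))"
  unfolding istopology_def
proof (intro conjI allI impI)
  fix U V assume UV: "U \<subseteq> D \<and> seq_closed D conv (D - U)" "V \<subseteq> D \<and> seq_closed D conv (D - V)"
  then show "U \<inter> V \<subseteq> D" by blast
  have "D - U \<inter> V = (D - U) \<union> (D - V)" by blast
  then show "seq_closed D conv (D - U \<inter> V)" using UV seq_closed_Un[of D conv "D - U" "D - V"] by simp
next
  fix \<K> assume K: "\<forall>U\<in>\<K>. U \<subseteq> D \<and> seq_closed D conv (D - U)"
  then show "\<Union>\<K> \<subseteq> D" by blast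
  show "seq_closed D conv (D - \<Union>\<K>)"
    unfolding seq_closed_def
  proof (intro conjI allI impI)
    fix x l assume x: "range x \<subseteq> D - \<Union>\<K> \<and> l \<in> D \<and> subseq_converges conv x l"
    have "l \<notin> U" if "U \<in> \<K>" for U
    proof -
      have "range x \<subseteq> D - U" using x that by blast
      then show ?thesis using K that x unfolding seq_closed_def by blast
    qed
    then show "l \<in> D - \<Union>\<K>" using x by blast
  qed blast
qed

lemma openin_sequential_topology:
  "openin (sequential_topology D conv) U \<longleftrightarrow> U \<subseteq> D \<and> seq_closed D conv (D - U)"
  unfolding sequential_topology_def by (simp add: istopology_seq_closed)

lemma topspace_sequential_topology: "topspace (sequential_topology D conv) = D"
proof
  show "topspace (sequential_topology D conv) \<subseteq> D"
    using openin_topspace[of "sequential_topology D conv"]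
    unfolding openin_sequential_topology by blast
  have "openin (sequential_topology D conv) D"
    unfolding openin_sequential_topology seq_closed_def by auto
  then show "D \<subseteq> topspace (sequential_topology D conv)"
    by (rule openin_subset)
qed


section \<open>Functions of finite variation as the dual of \<open>C([0,T])\<close>\<close>

definition variation_sums :: "real \<Rightarrow> (real \<Rightarrow> real) \<Rightarrow> real set" where
  "variation_sums T g =
     (\<lambda>\<D>. \<Sum>K\<in>\<D>. \<bar>g (Sup K) - g (Inf K)\<bar>) ` {\<D>. \<D> division_of {0..T}}"

text \<open>Right-continuity on \<open>[0,T)\<close> is the normalisation under which \<open>g\<close> corresponds to exactly
  one signed measure \<open>\<mu>\<close> on \<open>[0,T]\<close>, by \<open>\<mu>([0,t]) = g(t)\<close>; in particular \<open>\<mu>\<close> has an atom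
  of mass \<open>g(0)\<close> at \<open>0\<close>, i.e. \<open>g(0-) = 0\<close>.\<close>
definition finite_variation :: "real \<Rightarrow> (real \<Rightarrow> real) \<Rightarrow> bool" where
  "finite_variation T g \<longleftrightarrow>
     (\<forall>t\<in>{0..<T}. continuous (at_right t) g) \<and> bdd_above (variation_sums T g)"

text \<open>\<open>total_variation T g t = |\<mu>|([0,t])\<close> and \<open>zero_extension T g t = \<mu>([0,t])\<close>, both
  continued by \<open>0\<close> to the left of \<open>0\<close> and constantly to the right of \<open>T\<close>.\<close>
definition total_variation :: "real \<Rightarrow> (real \<Rightarrow> real) \<Rightarrow> real \<Rightarrow> real" where
  "total_variation T g t = (if t < 0 then 0 else \<bar>g 0\<bar> + Sup (variation_sums (min t T) g))"

definition zero_extension :: "real \<Rightarrow> (real \<Rightarrow> real) \<Rightarrow> real \<Rightarrow> real" where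
  "zero_extension T g t = (if t < 0 then 0 else g (min t T))"

text \<open>The functional \<open>f \<mapsto> \<integral>\<^bsub>[0,T]\<^esub> f d\<mu>\<close>, with \<open>\<mu> = |\<mu>| - (|\<mu>| - \<mu>)\<close> written as a difference of
  two Lebesgue--Stieltjes measures.\<close>
definition Stieltjes_functional :: "real \<Rightarrow> (real \<Rightarrow> real) \<Rightarrow> (real \<Rightarrow> real) \<Rightarrow> real" where
  "Stieltjes_functional T g f =
     (LINT t:{0..T}|interval_measure (total_variation T g). f t) -
     (LINT t:{0..T}|interval_measure (\<lambda>s. total_variation T g s - zero_extension T g s). f t)"

definition weak_star_converges :: "real \<Rightarrow> (nat \<Rightarrow> real \<Rightarrow> real) \<Rightarrow> (real \<Rightarrow> real) \<Rightarrow> bool" where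
  "weak_star_converges T \<nu> \<nu>0 \<longleftrightarrow>
     (\<forall>f. continuous_on {0..T} f \<longrightarrow>
        (\<lambda>n. Stieltjes_functional T (\<nu> n) f) \<longlonglongrightarrow> Stieltjes_functional T \<nu>0 f)"


section \<open>Skorokhod space\<close>

text \<open>The time set \<open>I\<close> is \<open>{0..T}\<close> with \<open>0 < T \<le> \<infinity>\<close> or \<open>{0..<\<infinity>}\<close>. Paths are functions on \<open>I\<close>,
  hence extensional. There is no condition at time \<open>\<infinity>\<close>, as
  \<open>\<D>([0,\<infinity>]) = \<D>([0,\<infinity>)) \<times> \<real>\<^sup>d\<close>.\<close>
definition skorokhod :: "ereal set \<Rightarrow> (ereal \<Rightarrow> real^'d::finite) set" where
  "skorokhod I =
     {\<omega> \<in> extensional I. \<forall>t\<in>I. t \<noteq> \<infinity> \<longrightarrow>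
        (\<omega> \<longlongrightarrow> \<omega> t) (at t within I \<inter> {t<..}) \<and>
        (\<exists>l. (\<omega> \<longlongrightarrow> l) (at t within I \<inter> {..<t}))}"

definition canonical_sets :: "ereal set \<Rightarrow> (ereal \<Rightarrow> real^'d::finite) set set" where
  "canonical_sets I = sigma_sets (skorokhod I)
     {{\<omega> \<in> skorokhod I. \<omega> u \<in> B} | u B. u \<in> I \<and> B \<in> sets borel}"


section \<open>The \<open>S\<close>-topology\<close>

text \<open>This depends only on the values of the functions on \<open>[0,T]\<close>.\<close>
definition S_converges_real ::
    "real \<Rightarrow> (nat \<Rightarrow> real \<Rightarrow> real) \<Rightarrow> (real \<Rightarrow> real) \<Rightarrow> bool" where
  "S_converges_real T x x0 \<longleftrightarrow>
     (\<forall>\<epsilon>>0. \<exists>\<nu> \<nu>0.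
        (\<forall>n. finite_variation T (\<nu> n)) \<and> finite_variation T \<nu>0 \<and>
        (\<forall>n. \<forall>t\<in>{0..T}. \<bar>x n t - \<nu> n t\<bar> \<le> \<epsilon>) \<and> (\<forall>t\<in>{0..T}. \<bar>x0 t - \<nu>0 t\<bar> \<le> \<epsilon>) \<and>
        weak_star_converges T \<nu> \<nu>0)"

definition S_converges_compact ::
    "real \<Rightarrow> (nat \<Rightarrow> ereal \<Rightarrow> real^'d::finite) \<Rightarrow> (ereal \<Rightarrow> real^'d) \<Rightarrow> bool" where
  "S_converges_compact T \<omega> \<omega>0 \<longleftrightarrow>
     (\<forall>i. S_converges_real T (\<lambda>n t. \<omega> n (ereal t) $ i) (\<lambda>t. \<omega>0 (ereal t) $ i))"

definition S_converges_infinite ::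
    "(nat \<Rightarrow> ereal \<Rightarrow> real^'d::finite) \<Rightarrow> (ereal \<Rightarrow> real^'d) \<Rightarrow> bool" where
  "S_converges_infinite \<omega> \<omega>0 \<longleftrightarrow>
     (\<forall>i. \<exists>T::nat \<Rightarrow> real. (\<forall>r. 0 < T r) \<and> incseq T \<and> filterlim T at_top sequentially \<and>
        (\<forall>r. S_converges_real (T r) (\<lambda>n t. \<omega> n (ereal t) $ i) (\<lambda>t. \<omega>0 (ereal t) $ i)))"

text \<open>For \<open>I = [0,\<infinity>]\<close> this is the product topology, carried over to functions on \<open>[0,\<infinity>]\<close>.\<close>
definition S_topology :: "ereal set \<Rightarrow> (ereal \<Rightarrow> real^'d::finite) topology" where
  "S_topology I =
     (if I = {0..\<infinity>} then
        pullback_topology (skorokhod I) (\<lambda>\<omega>. (restrict \<omega> {0..<\<infinity>}, \<omega> \<infinity>))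
          (prod_topology (sequential_topology (skorokhod {0..<\<infinity>}) S_converges_infinite) euclidean)
      else if I = {0..<\<infinity>} then
        sequential_topology (skorokhod I) S_converges_infinite
      else
        sequential_topology (skorokhod I) (S_converges_compact (real_of_ereal (Sup I))))"

lemma restrict_skorokhod_infinite:
  assumes "\<omega> \<in> skorokhod {0..\<infinity>}"
  shows "restrict \<omega> {0..<\<infinity>} \<in> skorokhod {0..<\<infinity>}"
proof -
  have tr: "(restrict \<omega> {0..<\<infinity>} \<longlongrightarrow> l) (at t within {0..<\<infinity>} \<inter> A)"
    if "(\<omega> \<longlongrightarrow> l) (at t within {0..\<infinity>} \<inter> A)" for l t A
  proof -
    have "(\<omega> \<longlongrightarrow> l) (at t within {0..<\<infinity>} \<inter> A)"
      by (rule tendsto_within_subset[OF that]) auto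
    moreover have "\<forall>\<^sub>F s in at t within {0..<\<infinity>} \<inter> A. \<omega> s = restrict \<omega> {0..<\<infinity>} s"
      unfolding eventually_at_filter by (rule always_eventually) simp
    ultimately show ?thesis by (rule Lim_transform_eventually)
  qed
  have lim: "(\<omega> \<longlongrightarrow> \<omega> t) (at t within {0..\<infinity>} \<inter> {t<..})"
      "\<exists>l. (\<omega> \<longlongrightarrow> l) (at t within {0..\<infinity>} \<inter> {..<t})"
    if "t \<in> {0..<\<infinity>}" for t
  proof -
    have "t \<in> {0..\<infinity>}" "t \<noteq> \<infinity>" using that by auto
    then show "(\<omega> \<longlongrightarrow> \<omega> t) (at t within {0..\<infinity>} \<inter> {t<..})"
      "\<exists>l. (\<omega> \<longlongrightarrow> l) (at t within {0..\<infinity>} \<inter> {..<t})"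
      using assms unfolding skorokhod_def by blast+
  qed
  show ?thesis
    unfolding skorokhod_def
  proof (intro CollectI conjI ballI impI)
    show "restrict \<omega> {0..<\<infinity>} \<in> extensional {0..<\<infinity>}" by (rule restrict_extensional)
    fix t :: ereal assume t: "t \<in> {0..<\<infinity>}"
    show "(restrict \<omega> {0..<\<infinity>} \<longlongrightarrow> restrict \<omega> {0..<\<infinity>} t) (at t within {0..<\<infinity>} \<inter> {t<..})"
      using tr[OF lim(1)[OF t]] by (simp only: restrict_apply t if_True)
    show "\<exists>l. (restrict \<omega> {0..<\<infinity>} \<longlongrightarrow> l) (at t within {0..<\<infinity>} \<inter> {..<t})"
      using tr lim(2)[OF t] by blast
  qed
qed

lemma topspace_S_topology: "topspace (S_topology I) = skorokhod I"
  by (auto simp: S_topology_def topspace_pullback_topology topspace_sequential_topology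
      restrict_skorokhod_infinite)

lemma topspace_weak_topology: "topspace (weak_topology X) = topspace X"
proof -
  have "topspace X \<in> {{x \<in> topspace X. f x \<in> V} | f V.
        continuous_map X euclideanreal f \<and> bounded (f ` topspace X) \<and> open V}"
    by (rule CollectI, rule exI[of _ "\<lambda>_. 0"], rule exI[of _ UNIV]) (auto simp: bounded_def)
  then show ?thesis
    unfolding weak_topology_def topology_generated_by_topspace by blast
qed

end

theory Submission
  imports Defs
begin

text \<open>
  Integrals \<open>\<integral>\<^sub>0\<^sup>q \<omega>\<^sup>i(s) ds\<close> over rational \<open>q\<close> (and the terminal value) are \<open>S\<close>-continuous and separate
  the paths, so \<open>S\<close> and \<open>S*\<close> refine a common separable metrizable topology; this settles the
  Hausdorff property, metrizability of compact sets and the equivalence of compactness with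
  sequential compactness.

  Let a stratum consist of the paths with a prescribed bound on the supremum norm and on the number of
  oscillations of each size \<open>1/p\<close>. Strata are closed already in the coarse metrizable topology. By
  uniform boundedness an \<open>S\<close>-convergent sequence lies in one stratum. Conversely a sequence in one
  stratum is uniformly approximated by step functions with boundedly many jumps, and choosing
  a subsequence along which all jump times and jump sizes converge gives an \<open>S\<close>-limit.
  Hence the coarse topology, refined by the least admissible bounds as further integer coordinates, is
  Polish and finer than \<open>S\<close>, which gives the Lusin property, the Borel sets and the hereditary Lindelof
  property; the latter makes the completely regular topology \<open>S*\<close> perfectly normal and paracompact.
  Finally, if an \<open>S*\<close>-compact set met the complements of the strata \<open>C\<^sub>m\<close> for all \<open>m\<close> in points \<open>x\<^sub>m\<close>, then
  \<open>\<Sum>\<^sub>m c\<^sub>m dist(\<cdot>, C\<^sub>m)\<close>, a locally finite sum along \<open>S\<close>-convergent sequences, would be an \<open>S\<close>-continuous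
  function that is unbounded on it for suitable \<open>c\<^sub>m\<close>.
\<close>

section \<open>Topologies with a coarser metrizable topology\<close>

text \<open>The definition of \<open>S\<close> yields neither neighbourhood bases nor regularity, so
  hardly any assertion is attacked in \<open>S\<close> itself. They are read off from a sandwich
  \<open>coarse\<close> \<le> \<open>S*\<close> \<le> \<open>S\<close> \<le> \<open>refined\<close>
  of topologies on one set whose ends are separable and metrizable. Both ends have the same Borel
  sets, because a least admissible bound is a Borel function of the coarse coordinates, and this
  settles the Borel sets of everything in between. The sandwich is set up for an arbitrary
  convergence with compact strata, so the analysis has to verify the axioms of
  \<open>compactly_stratified\<close> once for all time sets. The integrals see a path only through
  averages to the right of a point. This shapes two definitions: bounds are imposed on half-open
  intervals [0, N), which keeps strata closed in the coarse topology, and on [0, T] paths are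
  continued constantly past T, so that the value at T is seen. For [0, \<infinity>] there is a
  further obstacle: a product of sequential topologies need not be sequential, and it is local
  compactness of the second factor that helps.\<close>

lemma continuous_map_into_product:
  fixes F :: "'a \<Rightarrow> 'b \<Rightarrow> 'c::topological_space"
  assumes "\<And>i. continuous_map X euclidean (\<lambda>x. F x i)"
  shows "continuous_map X euclidean F"
  using assms continuous_map_componentwise_UNIV[of X "\<lambda>_. euclidean" F]
  by (simp add: euclidean_product_topology)

lemma homeomorphic_map_pullback_topology:
  assumes "inj_on f A" "f ` A \<subseteq> topspace T"
  shows "homeomorphic_map (pullback_topology A f T) (subtopology T (f ` A)) f"
proof (rule bijective_open_imp_homeomorphic_map)
  have ts: "topspace (pullback_topology A f T) = A"
    using assms(2) by (auto simp: topspace_pullback_topology)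
  show "continuous_map (pullback_topology A f T) (subtopology T (f ` A)) f"
    unfolding continuous_map_in_subtopology ts
  proof
    have "{x \<in> A. f x \<in> U} = f -` U \<inter> A" for U by blast
    then show "continuous_map (pullback_topology A f T) T f"
      unfolding continuous_map_def openin_pullback_topology ts using assms(2) by auto
  qed auto
  show "open_map (pullback_topology A f T) (subtopology T (f ` A)) f"
    unfolding open_map_def openin_pullback_topology openin_subtopology by blast
  show "f ` topspace (pullback_topology A f T) = topspace (subtopology T (f ` A))"
    using assms(2) by (auto simp: ts)
  show "inj_on f (topspace (pullback_topology A f T))" by (simp add: ts assms)
qed

lemma pullback_topology_homeomorphic_space:
  assumes "inj_on f A" "f ` A \<subseteq> topspace T"
  shows "pullback_topology A f T homeomorphic_space subtopology T (f ` A)"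
  using homeomorphic_map_pullback_topology[OF assms] homeomorphic_space by blast

lemma sequentially_compactin_coarser:
  assumes "sequentially_compactin X K" "topspace Y = topspace X" "\<And>U. openin Y U \<Longrightarrow> openin X U"
  shows "sequentially_compactin Y K"
proof -
  have "limitin Y x l sequentially" if "limitin X x l sequentially" for x l
    using that assms(2,3) unfolding limitin_def by auto
  then show ?thesis using assms(1,2) unfolding sequentially_compactin_def by metis
qed

lemma sequentially_compactin_closedin:
  assumes "sequentially_compactin X K" "closedin X C"
  shows "sequentially_compactin X (K \<inter> C)"
  unfolding sequentially_compactin_def
proof (intro conjI allI impI)
  show "K \<inter> C \<subseteq> topspace X" using assms unfolding sequentially_compactin_def by blast
  fix x :: "nat \<Rightarrow> 'a" assume x: "range x \<subseteq> K \<inter> C"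
  then obtain l r where l: "l \<in> K" "strict_mono r" "limitin X (x \<circ> r) l sequentially"
    using assms(1) unfolding sequentially_compactin_def by (meson le_inf_iff)
  have "l \<in> C"
    by (rule limitin_closedin[OF l(3) assms(2)]) (use x in \<open>auto simp: image_subset_iff intro!: always_eventually\<close>)
  then show "\<exists>l\<in>K \<inter> C. \<exists>r. strict_mono r \<and> limitin X (x \<circ> r) l sequentially"
    using l by blast
qed

lemma metrizable_compactin_iff_sequentially_compactin:
  assumes "metrizable_space Y"
  shows "compactin Y K \<longleftrightarrow> sequentially_compactin Y K"
proof -
  obtain M d where "Metric_space M d" and Y: "Y = Metric_space.mtopology M d"
    using assms unfolding metrizable_space_def by blast
  then interpret Metric_space M d by simp
  show ?thesis unfolding Y compactin_sequentially sequentially_compactin_def by (auto; metis)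
qed

section \<open>Topologies finer than a metrizable one\<close>

context
  fixes X Y :: "'a topology"
  assumes top: "topspace Y = topspace X" and coarser: "\<And>U. openin Y U \<Longrightarrow> openin X U"
    and metr: "metrizable_space Y"
begin

lemma submetrizable_Hausdorff: "Hausdorff_space X"
  using metrizable_imp_Hausdorff_space[OF metr] top coarser unfolding Hausdorff_space_def by metis

lemma compactin_coarser: "compactin X K \<Longrightarrow> compactin Y K"
  using top coarser unfolding compactin_def by metis

text \<open>A relatively open subset of \<open>K\<close> is the complement within \<open>K\<close>
  of some \<open>K \<inter> C\<close>, so it is enough that these traces be closed in
  \<open>Y\<close>. Compactness and sequential compactness each supply this.\<close>

lemma subtopology_eq_if_closed:
  assumes "\<And>C. closedin X C \<Longrightarrow> closedin Y (K \<inter> C)"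
  shows "subtopology X K = subtopology Y K"
proof -
  have "openin (subtopology Y K) U" if U: "openin (subtopology X K) U" for U
  proof -
    obtain V where V: "openin X V" "U = V \<inter> K" using U by (auto simp: openin_subtopology)
    then have "closedin Y (K \<inter> (topspace X - V))" using assms by blast
    then have "openin Y (topspace Y - (K \<inter> (topspace X - V)))" by blast
    moreover have "U = (topspace Y - (K \<inter> (topspace X - V))) \<inter> K"
      using V openin_subset[OF V(1)] top by auto
    ultimately show ?thesis by (auto simp: openin_subtopology)
  qed
  moreover have "openin (subtopology X K) U" if "openin (subtopology Y K) U" for U
    using that coarser by (auto simp: openin_subtopology)
  ultimately show ?thesis unfolding topology_eq by blast
qed

lemma compactin_submetrizable:
  assumes "compactin X K"
  shows "subtopology X K = subtopology Y K"
proof (rule subtopology_eq_if_closed)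
  fix C assume "closedin X C"
  then have "compactin X (K \<inter> C)" using assms by (metis closed_Int_compactin inf_commute)
  then have "compactin Y (K \<inter> C)" by (rule compactin_coarser)
  then show "closedin Y (K \<inter> C)"
    using compactin_imp_closedin metrizable_imp_Hausdorff_space[OF metr] by blast
qed

lemma submetrizable_compact_metrizable:
  assumes "compactin X K"
  shows "metrizable_space (subtopology X K)"
  unfolding compactin_submetrizable[OF assms] by (rule metrizable_space_subtopology[OF metr])

text \<open>Either form of compactness passes to the pieces \<open>K \<inter> C\<close> and on to
  the coarser metrizable \<open>Y\<close>, where the two forms agree and make the pieces closed.
  Hence \<open>X\<close> and \<open>Y\<close> coincide on \<open>K\<close>, and the equivalence
  becomes that of metric spaces.\<close>

lemma submetrizable_compactin_iff_sequentially_compactin: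
  "compactin X K \<longleftrightarrow> sequentially_compactin X K"
proof
  assume K: "compactin X K"
  have eq: "subtopology X K = subtopology Y K" using K by (rule compactin_submetrizable)
  have seq: "sequentially_compactin Y K"
    using compactin_coarser[OF K] metrizable_compactin_iff_sequentially_compactin[OF metr] by blast
  show "sequentially_compactin X K"
    unfolding sequentially_compactin_def
  proof (intro conjI allI impI)
    show "K \<subseteq> topspace X" using K compactin_subset_topspace by blast
    fix x :: "nat \<Rightarrow> 'a" assume x: "range x \<subseteq> K"
    then obtain l r where l: "l \<in> K" "strict_mono r" "limitin Y (x \<circ> r) l sequentially"
      using seq unfolding sequentially_compactin_def by meson
    then have "limitin (subtopology X K) (x \<circ> r) l sequentially"
      using x unfolding eq limitin_subtopology by (auto intro: always_eventually)
    then show "\<exists>l\<in>K. \<exists>r. strict_mono r \<and> limitin X (x \<circ> r) l sequentially"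
      using l unfolding limitin_subtopology by blast
  qed
next
  assume K: "sequentially_compactin X K"
  have "closedin Y (K \<inter> C)" if C: "closedin X C" for C
  proof -
    have "sequentially_compactin Y (K \<inter> C)"
      using sequentially_compactin_coarser[OF sequentially_compactin_closedin[OF K C] top coarser] .
    then have "compactin Y (K \<inter> C)"
      using metrizable_compactin_iff_sequentially_compactin[OF metr] by blast
    then show ?thesis using compactin_imp_closedin metrizable_imp_Hausdorff_space[OF metr] by blast
  qed
  then have eq: "subtopology X K = subtopology Y K" by (rule subtopology_eq_if_closed)
  have "compactin Y K"
    using sequentially_compactin_coarser[OF K top coarser]
      metrizable_compactin_iff_sequentially_compactin[OF metr] by blast
  then show "compactin X K" unfolding compactin_subspace eq top .
qed

end


section \<open>The weak topology of the bounded continuous functions\<close>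

lemma openin_weak_topology_basic:
  assumes "continuous_map X euclideanreal f" "bounded (f ` topspace X)" "open V"
  shows "openin (weak_topology X) {x \<in> topspace X. f x \<in> V}"
  unfolding weak_topology_def by (rule topology_generated_by_Basis) (use assms in blast)

lemma continuous_map_weak_bounded:
  assumes "continuous_map X euclideanreal f" "bounded (f ` topspace X)"
  shows "continuous_map (weak_topology X) euclideanreal f"
  unfolding continuous_map_def
  using openin_weak_topology_basic[OF assms] by (simp add: topspace_weak_topology)

lemma openin_weak_topology_imp:
  assumes "openin (weak_topology X) U"
  shows "openin X U"
proof -
  have "generate_topology_on {{x \<in> topspace X. f x \<in> V} | f V.
        continuous_map X euclideanreal f \<and> bounded (f ` topspace X) \<and> open V} U"
    using assms unfolding weak_topology_def openin_topology_generated_by_iff .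
  then show ?thesis
  proof induction
    case (Basis s)
    then obtain f V where "s = {x \<in> topspace X. f x \<in> V}" "continuous_map X euclideanreal f" "open V"
      by blast
    then show ?case unfolding continuous_map_def by simp
  qed auto
qed

lemma bounded_arctan_image: "bounded ((\<lambda>x. arctan (f x)) ` A)"
  unfolding bounded_iff
proof (intro exI ballI)
  fix y assume "y \<in> (\<lambda>x. arctan (f x)) ` A"
  then obtain x where "y = arctan (f x)" by blast
  then show "norm y \<le> pi / 2" using arctan_bounded[of "f x"] by (auto simp: abs_if)
qed

text \<open>Bounded functions generate the topology by definition; an unbounded \<open>f\<close> is
  recovered as \<open>tan\<close> of the bounded function \<open>arctan \<circ> f\<close>.\<close>

lemma continuous_map_weak_topology:
  "continuous_map (weak_topology X) euclideanreal f \<longleftrightarrow> continuous_map X euclideanreal f"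
proof
  assume "continuous_map (weak_topology X) euclideanreal f"
  then show "continuous_map X euclideanreal f"
    unfolding continuous_map_def by (simp add: topspace_weak_topology openin_weak_topology_imp)
next
  assume f: "continuous_map X euclideanreal f"
  have "continuous_map X euclideanreal (arctan \<circ> f)"
    by (rule continuous_map_compose[OF f]) (auto intro: continuous_intros)
  then have "continuous_map (weak_topology X) euclideanreal (arctan \<circ> f)"
    by (rule continuous_map_weak_bounded) (simp add: comp_def bounded_arctan_image)
  then have 1: "continuous_map (weak_topology X) (top_of_set {-pi/2<..<pi/2}) (arctan \<circ> f)"
    unfolding continuous_map_in_subtopology using arctan_bounded by (auto simp: image_subset_iff)
  have "continuous_on {-pi/2<..<pi/2} tan"
    by (intro continuous_on_tan continuous_on_id) (use cos_gt_zero_pi in fastforce)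
  then have "continuous_map (top_of_set {-pi/2<..<pi/2}) euclideanreal tan" by simp
  from continuous_map_compose[OF 1 this] show "continuous_map (weak_topology X) euclideanreal f"
    by (simp add: comp_def tan_arctan)
qed

text \<open>Complete regularity, by induction over the generation of open sets from the subbase:
  intersections are handled by the minimum of two functions.\<close>

lemma weak_topology_cozero:
  assumes "openin (weak_topology X) U" "x \<in> U"
  shows "\<exists>f. continuous_map X euclideanreal f \<and> (\<forall>y. 0 \<le> f y \<and> f y \<le> 1) \<and> f x > 0 \<and>
             (\<forall>y\<in>topspace X - U. f y = 0)"
proof -
  have "generate_topology_on {{x \<in> topspace X. f x \<in> V} | f V.
        continuous_map X euclideanreal f \<and> bounded (f ` topspace X) \<and> open V} U"
    using assms(1) unfolding weak_topology_def openin_topology_generated_by_iff .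
  then show ?thesis using assms(2)
  proof induction
    case (Int a b)
    then obtain f g where fg: "continuous_map X euclideanreal f" "\<forall>y. 0 \<le> f y \<and> f y \<le> 1" "f x > 0"
        "\<forall>y\<in>topspace X - a. f y = 0"
        "continuous_map X euclideanreal g" "\<forall>y. 0 \<le> g y \<and> g y \<le> 1" "g x > 0"
        "\<forall>y\<in>topspace X - b. g y = 0" by blast
    show ?case
    proof (intro exI conjI)
      show "continuous_map X euclideanreal (\<lambda>y. min (f y) (g y))"
        by (intro continuous_map_real_min fg)
      show "\<forall>y\<in>topspace X - a \<inter> b. min (f y) (g y) = 0"
        using fg(2,4,6,8) by (auto simp: min_def intro: antisym)
    qed (use fg in \<open>auto simp: min_def\<close>)
  next
    case (UN K)
    then obtain k where k: "k \<in> K" "x \<in> k" by blast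
    then obtain f where "continuous_map X euclideanreal f" "\<forall>y. 0 \<le> f y \<and> f y \<le> 1" "f x > 0"
        "\<forall>y\<in>topspace X - k. f y = 0" using UN.IH by blast
    then show ?case using k by blast
  next
    case (Basis s)
    then obtain f V where s: "s = {x \<in> topspace X. f x \<in> V}" "continuous_map X euclideanreal f" "open V"
      by blast
    then obtain e where e: "e > 0" "ball (f x) e \<subseteq> V" using Basis openE by (metis (mono_tags, lifting) mem_Collect_eq)
    show ?case
    proof (intro exI conjI allI ballI)
      \<comment> \<open>A tent of height 1 centred at the value \<open>f x\<close>; it vanishes as
        soon as \<open>f y\<close> leaves the ball of radius \<open>e\<close>, which is contained in
        \<open>V\<close>.\<close>
      show "continuous_map X euclideanreal (\<lambda>y. max 0 (1 - \<bar>f y - f x\<bar> / e))"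
        by (intro continuous_intros s) (use e in auto)
      show "0 < max 0 (1 - \<bar>f x - f x\<bar> / e)" by simp
      fix y show "0 \<le> max 0 (1 - \<bar>f y - f x\<bar> / e)" by simp
      show "max 0 (1 - \<bar>f y - f x\<bar> / e) \<le> 1" using e by simp
    next
      fix y assume "y \<in> topspace X - s"
      then have "f y \<notin> ball (f x) e" using s(1) e(2) by blast
      then have "\<bar>f y - f x\<bar> \<ge> e" by (simp add: dist_real_def abs_minus_commute)
      then show "max 0 (1 - \<bar>f y - f x\<bar> / e) = 0" using e(1) by (simp add: max_def field_simps)
    qed
  qed simp
qed

text \<open>Second countability is hereditary, so the union of the family is a Lindelof
  subspace.\<close>

lemma second_countable_countable_subcover:
  assumes "second_countable Z" "\<And>U. U \<in> \<U> \<Longrightarrow> openin Z U"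
  obtains \<V> where "countable \<V>" "\<V> \<subseteq> \<U>" "\<Union>\<V> = \<Union>\<U>"
proof -
  have "Lindelof_space (subtopology Z (\<Union>\<U>))"
    by (intro second_countable_imp_Lindelof_space second_countable_subtopology assms)
  moreover have "\<Union>\<U> \<subseteq> topspace Z" using assms(2) openin_subset by blast
  ultimately obtain \<V> where "countable \<V>" "\<V> \<subseteq> \<U>" "\<Union>\<U> \<subseteq> \<Union>\<V>"
    using assms(2) by (metis Lindelof_space_subtopology_subset order_refl)
  then show ?thesis using that[of \<V>] by (simp add: Sup_subset_mono subset_antisym)
qed

section \<open>Consequences of a finer second countable topology\<close>

context
  fixes X Z :: "'a topology"
  assumes topZ: "topspace Z = topspace X" and finer: "\<And>U. openin X U \<Longrightarrow> openin Z U"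
    and sc: "second_countable Z"
begin

text \<open>Complete regularity covers the union by cozero sets, each inside a member of the family.
  These are open in the second countable \<open>Z\<close>, hence countably many of them
  suffice.\<close>

lemma weak_topology_countable_cozero_cover:
  assumes "\<And>U. U \<in> \<U> \<Longrightarrow> openin (weak_topology X) U"
  obtains F :: "nat \<Rightarrow> 'a \<Rightarrow> real" where
    "\<And>n. continuous_map X euclideanreal (F n)" "\<And>n y. 0 \<le> F n y" "\<And>n y. F n y \<le> 1"
    "\<And>n. (\<exists>y\<in>topspace X. F n y > 0) \<Longrightarrow> \<exists>U\<in>\<U>. {y \<in> topspace X. F n y > 0} \<subseteq> U"
    "\<Union>\<U> = {y \<in> topspace X. \<exists>n. F n y > 0}"
proof -
  define G where "G = {f. continuous_map X euclideanreal f \<and> (\<forall>y. 0 \<le> f y \<and> f y \<le> (1::real)) \<and>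
     (\<exists>U\<in>\<U>. {y \<in> topspace X. f y > 0} \<subseteq> U)}"
  define \<W> where "\<W> = (\<lambda>f. {y \<in> topspace X. f y > 0}) ` G"
  have sub: "U \<subseteq> topspace X" if "U \<in> \<U>" for U
    using assms[OF that] openin_subset by (fastforce simp: topspace_weak_topology)
  have "\<exists>f\<in>G. x \<in> {y \<in> topspace X. f y > 0}" if xU: "x \<in> \<Union>\<U>" for x
  proof -
    obtain U where U: "U \<in> \<U>" "x \<in> U" using xU by blast
    then obtain f where f: "continuous_map X euclideanreal f" "\<forall>y. 0 \<le> f y \<and> f y \<le> 1" "f x > 0"
             "\<forall>y\<in>topspace X - U. f y = 0"
      using weak_topology_cozero[OF assms] by blast
    have "{y \<in> topspace X. f y > 0} \<subseteq> U" using f(4) by force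
    then show ?thesis using f U sub unfolding G_def by blast
  qed
  then have "\<Union>\<U> \<subseteq> \<Union>\<W>" unfolding \<W>_def by blast
  moreover have "\<Union>\<W> \<subseteq> \<Union>\<U>"
  proof
    fix y assume "y \<in> \<Union>\<W>"
    then obtain f where f: "f \<in> G" "y \<in> {y \<in> topspace X. f y > 0}" unfolding \<W>_def by auto
    then obtain U where "U \<in> \<U>" "{y \<in> topspace X. f y > 0} \<subseteq> U" unfolding G_def by auto
    then show "y \<in> \<Union>\<U>" using f(2) by auto
  qed
  ultimately have cov: "\<Union>\<W> = \<Union>\<U>" by (rule subset_antisym[rotated])
  have "openin Z W" if WW: "W \<in> \<W>" for W
  proof -
    obtain f where f: "continuous_map X euclideanreal f" "W = {y \<in> topspace X. f y > 0}"
      using WW unfolding \<W>_def G_def by blast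
    have "openin X {y \<in> topspace X. f y \<in> {0<..}}"
      using f(1) open_greaterThan open_openin unfolding continuous_map_def by blast
    then show ?thesis using finer by (simp add: f(2))
  qed
  then obtain \<V> where V: "countable \<V>" "\<V> \<subseteq> \<W>" "\<Union>\<V> = \<Union>\<U>"
    using second_countable_countable_subcover[OF sc, of \<W>] cov by metis
  then obtain H where H: "countable H" "H \<subseteq> G" "\<V> = (\<lambda>f. {y \<in> topspace X. f y > 0}) ` H"
    using countable_subset_image[of \<V> "\<lambda>f. {y \<in> topspace X. f y > 0}" G] unfolding \<W>_def by auto
  show ?thesis
  proof (cases "H = {}")
    \<comment> \<open>Then the union is empty and the family itself may be. The zero sequence is
      admissible because containment in a member is claimed only for nonempty cozero sets.\<close>
    case True
    show ?thesis
      by (rule that[of "\<lambda>_ _. 0"]) (use True H(3) V(3) in auto)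
  next
    case False
    define F where "F = from_nat_into H"
    have FG: "F n \<in> G" for n using H(2) from_nat_into[OF False] unfolding F_def by blast
    have rF: "range F = H" unfolding F_def using False H(1) by (rule range_from_nat_into)
    have "\<V> = range (\<lambda>n. {y \<in> topspace X. F n y > 0})" unfolding H(3) rF[symmetric] image_image ..
    then have "\<Union>\<U> = (\<Union>n. {y \<in> topspace X. F n y > 0})" using V(3) by simp
    then have "\<Union>\<U> = {y \<in> topspace X. \<exists>n. F n y > 0}" by auto
    moreover have "continuous_map X euclideanreal (F n)" "\<forall>y. 0 \<le> F n y \<and> F n y \<le> 1"
      "\<exists>U\<in>\<U>. {y \<in> topspace X. F n y > 0} \<subseteq> U" for n
      using FG[of n] unfolding G_def by simp_all
    ultimately show ?thesis by (intro that[of F]) auto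
  qed
qed

text \<open>The distance to 0 in the product metric on sequences plays the role of a weighted sum of
  the \<open>F n\<close>: it is continuous and vanishes exactly when all coordinates do.\<close>

lemma weak_topology_open_eq_cozero:
  assumes "openin (weak_topology X) U"
  obtains f where "continuous_map X euclideanreal f" "U = {x \<in> topspace X. f x \<noteq> 0}"
proof -
  obtain F :: "nat \<Rightarrow> 'a \<Rightarrow> real" where F: "\<And>n. continuous_map X euclideanreal (F n)" "\<And>n y. 0 \<le> F n y"
      "U = {y \<in> topspace X. \<exists>n. F n y > 0}"
    using weak_topology_countable_cozero_cover[of "{U}"] assms by auto
  define f where "f = (\<lambda>x. dist (\<lambda>n. F n x) (\<lambda>_. 0))"
  have "continuous_map X euclidean (\<lambda>x n. F n x)" by (intro continuous_map_into_product F)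
  moreover have "continuous_map euclidean euclideanreal (\<lambda>y::nat \<Rightarrow> real. dist y (\<lambda>_. 0))"
    by (simp add: continuous_intros)
  ultimately have "continuous_map X euclideanreal f"
    unfolding f_def using continuous_map_compose[of X euclidean "\<lambda>x n. F n x" euclideanreal] by (simp add: comp_def)
  moreover have "f x \<noteq> 0 \<longleftrightarrow> (\<exists>n. F n x > 0)" for x
    unfolding f_def using F(2)[of _ x] by (auto simp: fun_eq_iff less_le)
  ultimately show ?thesis using that F(3) by auto
qed

lemma perfectly_normal_weak_topology:
  assumes "Hausdorff_space (weak_topology X)"
  shows "perfectly_normal_space (weak_topology X)"
  unfolding perfectly_normal_space_def
proof (intro conjI allI impI)
  fix C assume C: "closedin (weak_topology X) C"
  then obtain f where f: "continuous_map X euclideanreal f" "topspace X - C = {x \<in> topspace X. f x \<noteq> 0}"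
    using weak_topology_open_eq_cozero[of "topspace X - C"]
    unfolding closedin_def by (metis topspace_weak_topology)
  have "C \<subseteq> topspace X" using closedin_subset[OF C] by (simp add: topspace_weak_topology)
  then have "C = {x \<in> topspace (weak_topology X). f x = 0}"
    using f(2) unfolding topspace_weak_topology by blast
  then show "\<exists>f. continuous_map (weak_topology X) euclideanreal f \<and>
      C = {x \<in> topspace (weak_topology X). f x = 0}"
    using f(1) continuous_map_weak_topology by blast
qed (rule assms)

text \<open>A countable cozero cover is made locally finite by cutting from the \<open>n\<close>-th
  set the points where some earlier function is at least \<open>1 / n\<close>.\<close>

lemma paracompact_weak_topology: "paracompact_space (weak_topology X)"
  unfolding paracompact_space_def
proof (intro allI impI)
  fix \<U> assume U: "(\<forall>U\<in>\<U>. openin (weak_topology X) U) \<and> \<Union>\<U> = topspace (weak_topology X)"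
  obtain F :: "nat \<Rightarrow> 'a \<Rightarrow> real" where F: "\<And>n. continuous_map X euclideanreal (F n)" "\<And>n y. 0 \<le> F n y"
      "\<And>n y. F n y \<le> 1"
      "\<And>n. (\<exists>y\<in>topspace X. F n y > 0) \<Longrightarrow> \<exists>U\<in>\<U>. {y \<in> topspace X. F n y > 0} \<subseteq> U"
      "\<Union>\<U> = {y \<in> topspace X. \<exists>n. F n y > 0}"
    by (rule weak_topology_countable_cozero_cover[of \<U>], use U in simp, rule that)
  have F_pos: "\<exists>n. F n x > 0" if "x \<in> topspace X" for x
    using F(5) U that unfolding topspace_weak_topology by blast
  have op: "openin (weak_topology X) {x \<in> topspace X. F n x \<in> V}" if "open V" for n V
    using continuous_map_weak_topology[THEN iffD2, OF F(1)[of n]] that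
    unfolding continuous_map_def topspace_weak_topology by simp
  define W where "W n = {x \<in> topspace X. F n x > 0} \<inter>
      (\<Inter>m\<in>{..<n}. {x \<in> topspace X. F m x < 1 / real n}) " for n
  have W_alt: "W n = {x \<in> topspace X. F n x \<in> {0<..} \<and> (\<forall>m<n. F m x < 1 / real n)}" for n
    unfolding W_def by auto
  have W_open: "openin (weak_topology X) (W n)" for n
  proof (cases "n = 0")
    case True then show ?thesis using op[of "{0<..}" n] unfolding W_alt by auto
  next
    case False
    have "openin (weak_topology X) (\<Inter>m\<in>{..<n}. {x \<in> topspace X. F m x < 1 / real n})"
      by (rule openin_INT2) (use False op[of "{..<1 / real n}"] in auto)
    then show ?thesis using op[of "{0<..}" n] unfolding W_def by auto
  qed
  have W_cover: "\<exists>n. x \<in> W n" if "x \<in> topspace X" for x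
  proof -
    have ex: "\<exists>n. F n x > 0" by (rule F_pos[OF that])
    \<comment> \<open>At the first index with a positive value all earlier functions vanish at
      \<open>x\<close>, so the upper bounds in \<open>W n\<close> hold.\<close>
    define n where "n = (LEAST n. F n x > 0)"
    have n: "F n x > 0" unfolding n_def using ex by (rule LeastI_ex)
    have "F m x = 0" if "m < n" for m
      using not_less_Least[of m "\<lambda>n. F n x > 0"] that F(2)[of m x] unfolding n_def by simp
    then have "x \<in> W n" unfolding W_alt using n that by auto
    then show ?thesis by blast
  qed
  define \<V> where "\<V> = {W n | n. W n \<noteq> {}}"
  have W_sub: "W n \<subseteq> topspace X" for n unfolding W_def by auto
  have "\<Union>\<V> = (\<Union>n. W n)" unfolding \<V>_def by blast
  also have "\<dots> = topspace X" using W_cover W_sub by (intro equalityI UN_least subsetI) auto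
  finally have VT: "\<Union>\<V> = topspace X" .
  have "locally_finite_in (weak_topology X) \<V>"
    unfolding locally_finite_in_def
  proof (intro conjI ballI)
    show "\<Union>\<V> \<subseteq> topspace (weak_topology X)" using VT by (simp add: topspace_weak_topology)
    fix x assume "x \<in> topspace (weak_topology X)"
    then have x: "x \<in> topspace X" by (simp add: topspace_weak_topology)
    then obtain N where N: "F N x > 0" using F_pos by blast
    \<comment> \<open>On \<open>B\<close> the function \<open>F N\<close> exceeds
      \<open>F N x / 2\<close>, while on \<open>W n\<close> with \<open>n > N\<close> it is below
      \<open>1 / n\<close>; the two exclude each other once
      \<open>1 / n \<le> F N x / 2\<close>.\<close>
    define B where "B = {y \<in> topspace X. F N y \<in> {F N x / 2<..}}"
    obtain k :: nat where k: "real k > 2 / F N x" using reals_Archimedean2 by blast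
    have "W n \<inter> B = {}" if n: "n > max N k" for n
    proof -
      have "1 / real n \<le> F N x / 2"
      proof -
        have n0: "real n > 0" "real n \<ge> real k" using n by auto
        then have "2 / F N x \<le> real n" using k by linarith
        then show ?thesis using N n0 by (simp add: field_simps)
      qed
      then show ?thesis unfolding W_alt B_def using n by fastforce
    qed
    then have "{U \<in> \<V>. U \<inter> B \<noteq> {}} \<subseteq> W ` {..max N k}" unfolding \<V>_def using not_le by blast
    then have "finite {U \<in> \<V>. U \<inter> B \<noteq> {}}" by (rule finite_subset) simp
    then show "\<exists>V. openin (weak_topology X) V \<and> x \<in> V \<and> finite {U \<in> \<V>. U \<inter> V \<noteq> {}}"
      using op[of "{F N x / 2<..}" N] x N unfolding B_def[symmetric]
      by (intro exI[of _ B]) (auto simp: B_def)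
  qed
  moreover have "\<exists>U\<in>\<U>. V \<subseteq> U" if V: "V \<in> \<V>" for V
  proof -
    obtain n where n: "V = W n" "W n \<noteq> {}" using V unfolding \<V>_def by blast
    then have "\<exists>y\<in>topspace X. F n y > 0" unfolding W_def by blast
    then obtain U where "U \<in> \<U>" "{y \<in> topspace X. F n y > 0} \<subseteq> U" using F(4) by blast
    then show ?thesis using n unfolding W_def by blast
  qed
  ultimately show "\<exists>\<V>. (\<forall>V\<in>\<V>. openin (weak_topology X) V) \<and> \<Union>\<V> = topspace (weak_topology X) \<and>
             (\<forall>V\<in>\<V>. \<exists>U\<in>\<U>. V \<subseteq> U) \<and> locally_finite_in (weak_topology X) \<V>"
    using VT W_open unfolding \<V>_def topspace_weak_topology
    by (intro exI[of _ "{W n | n. W n \<noteq> {}}"] conjI) (auto simp: topspace_weak_topology)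
qed

end

text \<open>Perfect normality exhibits each open set as the preimage of the nonzero reals under a
  single continuous function, hence as a Baire set.\<close>

lemma Borel_eq_Baire_perfectly_normal:
  assumes "perfectly_normal_space Y"
  shows "Borel_sets Y = Baire_sets Y"
proof
  have "{U. openin Y U} \<subseteq> Baire_sets Y"
  proof
    fix U assume "U \<in> {U. openin Y U}"
    then have U: "openin Y U" by simp
    then have "closedin Y (topspace Y - U)" by blast
    then obtain f where f: "continuous_map Y euclideanreal f" "topspace Y - U = {x \<in> topspace Y. f x = 0}"
      using assms unfolding perfectly_normal_space_def by blast
    have "U = {x \<in> topspace Y. f x \<in> - {0}}" using f(2) openin_subset[OF U] by auto
    moreover have "- {0::real} \<in> sets borel" by auto
    ultimately show "U \<in> Baire_sets Y" unfolding Baire_sets_def using f(1) by (intro sigma_sets.Basic) blast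
  qed
  then show "Borel_sets Y \<subseteq> Baire_sets Y"
    unfolding Borel_sets_def Baire_sets_def by (rule sigma_sets_mono)
  show "Baire_sets Y \<subseteq> Borel_sets Y"
    unfolding Baire_sets_def
    unfolding Borel_sets_def
  proof (rule sigma_sets_mono, clarify)
    fix f :: "'a \<Rightarrow> real" and B :: "real set"
    assume f: "continuous_map Y euclideanreal f" and B: "B \<in> sets borel"
    interpret sigma_algebra "topspace Y" "sigma_sets (topspace Y) {U. openin Y U}"
      by (rule sigma_algebra_sigma_sets) (use openin_subset in blast)
    have B': "B \<in> sigma_sets UNIV {S. open S}" using B by (simp add: borel_def)
    show "{x \<in> topspace Y. f x \<in> B} \<in> sigma_sets (topspace Y) {U. openin Y U}"
      using B'
    proof induction
      case (Basic a)
      then have "openin Y {x \<in> topspace Y. f x \<in> a}" using f unfolding continuous_map_def by simp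
      then show ?case by (intro sigma_sets.Basic) simp
    next
      case Empty then show ?case by (simp add: sigma_sets.Empty)
    next
      case (Compl a)
      have "{x \<in> topspace Y. f x \<in> UNIV - a} = topspace Y - {x \<in> topspace Y. f x \<in> a}" by blast
      then show ?case using sigma_sets.Compl[OF Compl.IH] by simp
    next
      case (Union a)
      have "{x \<in> topspace Y. f x \<in> \<Union>(range a)} = (\<Union>i. {x \<in> topspace Y. f x \<in> a i})" by blast
      then show ?case using sigma_sets.Union[OF Union.IH] by simp
    qed
  qed
qed

section \<open>Sequential topologies with compact pieces\<close>

lemma tendsto_coordinatewise:
  fixes l :: "'b \<Rightarrow> 'c::topological_space"
  assumes "\<And>j. ((\<lambda>x. f x j) \<longlongrightarrow> l j) F"
  shows "(f \<longlongrightarrow> l) F"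
  using assms limitin_componentwise[of "\<lambda>_. euclidean" UNIV f l F]
  by (simp add: euclidean_product_topology)

lemma closedin_sequential_topology:
  "closedin (sequential_topology D conv) A \<longleftrightarrow> seq_closed D conv A"
proof -
  have "D - (D - A) = A" if "A \<subseteq> D" using that by blast
  then show ?thesis
    unfolding closedin_def openin_sequential_topology topspace_sequential_topology
    by (auto simp: seq_closed_def)
qed

text \<open>Testing \<open>conv\<close>-convergent sequences is enough: a subsequentially convergent
  sequence has at least one such subsequence, and along it the limit is seen to stay in a closed
  preimage.\<close>

lemma continuous_map_sequential_topology:
  fixes f :: "'a \<Rightarrow> 'b::topological_space"
  assumes "\<And>x l. range x \<subseteq> D \<Longrightarrow> l \<in> D \<Longrightarrow> conv x l \<Longrightarrow> (\<lambda>n. f (x n)) \<longlonglongrightarrow> f l"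
  shows "continuous_map (sequential_topology D conv) euclidean f"
  unfolding continuous_map_closedin
proof (intro conjI allI impI)
  fix K :: "'b set" assume "closedin euclidean K"
  then have K: "closed K" by simp
  show "closedin (sequential_topology D conv) {x \<in> topspace (sequential_topology D conv). f x \<in> K}"
    unfolding closedin_sequential_topology topspace_sequential_topology seq_closed_def
  proof (intro conjI allI impI)
    fix x l assume x: "range x \<subseteq> {x \<in> D. f x \<in> K} \<and> l \<in> D \<and> subseq_converges conv x l"
    then obtain q :: "nat \<Rightarrow> nat" where "conv (x \<circ> id \<circ> q) l"
      unfolding subseq_converges_def using strict_mono_id by blast
    then have "(\<lambda>n. f ((x \<circ> id \<circ> q) n)) \<longlonglongrightarrow> f l" using x by (intro assms) (auto simp: comp_def)
    then have "f l \<in> K" by (rule closed_sequentially[OF K, rotated]) (use x in auto)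
    then show "l \<in> {x \<in> D. f x \<in> K}" using x by simp
  qed auto
qed auto

text \<open>If infinitely many terms lay outside an open neighbourhood of \<open>l\<close>, they
  would form a subsequence in its closed complement that still converges to
  \<open>l\<close>.\<close>

lemma limitin_sequential_topology:
  assumes "\<And>x l r. conv x l \<Longrightarrow> strict_mono r \<Longrightarrow> conv (x \<circ> r) l"
    and "conv x l" "range x \<subseteq> D" "l \<in> D"
  shows "limitin (sequential_topology D conv) x l sequentially"
  unfolding limitin_def topspace_sequential_topology
proof (intro conjI allI impI)
  fix U assume U: "openin (sequential_topology D conv) U \<and> l \<in> U"
  show "eventually (\<lambda>n. x n \<in> U) sequentially"
  proof (rule ccontr)
    assume "\<not> eventually (\<lambda>n. x n \<in> U) sequentially"
    then have inf: "infinite {n. x n \<notin> U}"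
      using cofinite_eq_sequentially eventually_cofinite by metis
    define r where "r = enumerate {n. x n \<notin> U}"
    have r: "strict_mono r" using strict_mono_enumerate[OF inf] by (simp add: r_def)
    have "x (r n) \<notin> U" for n using enumerate_in_set[OF inf, of n] by (simp add: r_def)
    then have rng: "range (x \<circ> r) \<subseteq> D - U" using assms(3) by auto
    have "subseq_converges conv (x \<circ> r) l"
      unfolding subseq_converges_def
    proof (intro allI impI)
      fix s :: "nat \<Rightarrow> nat" assume "strict_mono s"
      then have "conv (x \<circ> r \<circ> s) l" using assms(1)[OF assms(1)[OF assms(2) r]] by blast
      then show "\<exists>q. strict_mono q \<and> conv (x \<circ> r \<circ> s \<circ> q) l"
        using strict_mono_id by (intro exI[of _ id]) simp
    qed
    then have "l \<in> D - U"
      using rng U assms(4) unfolding openin_sequential_topology seq_closed_def by blast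
    then show False using U by blast
  qed
qed (rule assms)

lemma convergent_nat_sequence:
  fixes s :: "nat \<Rightarrow> nat"
  assumes "(\<lambda>n. real (s n)) \<longlonglongrightarrow> a"
  obtains m where "a = real m" "eventually (\<lambda>n. s n = m) sequentially"
proof -
  have "eventually (\<lambda>n. dist (real (s n)) a < 1/2) sequentially"
    using assms by (rule tendstoD) simp
  then obtain N where N: "\<And>n. n \<ge> N \<Longrightarrow> \<bar>real (s n) - a\<bar> < 1/2"
    unfolding eventually_sequentially dist_real_def by blast
  have "s n = s N" if "n \<ge> N" for n
    using N[OF that] N[of N] by linarith
  then have ev: "eventually (\<lambda>n. s n = s N) sequentially" unfolding eventually_sequentially by blast
  then have "(\<lambda>n. real (s n)) \<longlonglongrightarrow> real (s N)" by (rule tendsto_eventually[OF eventually_mono]) simp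
  then show ?thesis using that ev LIMSEQ_unique[OF assms] by blast
qed

text \<open>The strata \<open>C k m\<close> play the role of the conditions \<open>quantity k \<le> m\<close>; sequences on which every
  quantity is bounded are relatively compact for \<open>conv\<close>.\<close>
locale compactly_stratified =
  fixes D :: "'a set" and conv :: "(nat \<Rightarrow> 'a) \<Rightarrow> 'a \<Rightarrow> bool"
    and \<Phi> :: "'a \<Rightarrow> 'j::countable \<Rightarrow> real" and C :: "'k::countable \<Rightarrow> nat \<Rightarrow> 'a set"
  assumes conv_subseq: "\<And>x l r. conv x l \<Longrightarrow> strict_mono r \<Longrightarrow> conv (x \<circ> r) l"
    and conv_coordinate: "\<And>x l j. range x \<subseteq> D \<Longrightarrow> l \<in> D \<Longrightarrow> conv x l \<Longrightarrow> (\<lambda>n. \<Phi> (x n) j) \<longlonglongrightarrow> \<Phi> l j"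
    and inj: "inj_on \<Phi> D"
    and C_mono: "\<And>k m m'. m \<le> m' \<Longrightarrow> C k m \<subseteq> C k m'"
    and C_cover: "\<And>x k. x \<in> D \<Longrightarrow> \<exists>m. x \<in> C k m"
    and C_bounded: "\<And>x l k. range x \<subseteq> D \<Longrightarrow> l \<in> D \<Longrightarrow> conv x l \<Longrightarrow> \<exists>m. range x \<subseteq> C k m"
    and C_compact: "\<And>x::nat \<Rightarrow> 'a. range x \<subseteq> D \<Longrightarrow> (\<And>k. \<exists>m. range x \<subseteq> C k m) \<Longrightarrow>
        \<exists>(r::nat \<Rightarrow> nat) l. strict_mono r \<and> l \<in> D \<and> conv (x \<circ> r) l"
    and C_closed: "\<And>k m. closedin (pullback_topology D \<Phi> euclidean) (C k m)"
begin

section \<open>Levels and the two metrizable topologies enclosing \<open>S\<close>\<close>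

definition level :: "'a \<Rightarrow> 'k \<Rightarrow> nat" where "level x k = (LEAST m. x \<in> C k m)"

text \<open>The image of \<open>\<Psi>\<close> is a \<open>G\<^sub>\<delta>\<close> set: prescribing bounds \<open>s\<close> gives a closed set by compactness, and
  minimality of \<open>s\<close> is an intersection of countably many open conditions.\<close>
definition \<Psi> :: "'a \<Rightarrow> ('j \<Rightarrow> real) \<times> ('k \<Rightarrow> real)" where
  "\<Psi> x = (\<Phi> x, \<lambda>k. real (level x k))"

abbreviation "S \<equiv> sequential_topology D conv"
abbreviation "coarse \<equiv> pullback_topology D \<Phi> euclidean"
abbreviation "refined \<equiv> pullback_topology D \<Psi> euclidean"

lemma topspace_coarse: "topspace coarse = D" and topspace_refined: "topspace refined = D"
  by (simp_all add: topspace_pullback_topology)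

lemma inj_refined: "inj_on \<Psi> D"
  using inj unfolding inj_on_def \<Psi>_def by auto

lemma in_C_level:
  assumes "x \<in> D"
  shows "x \<in> C k m \<longleftrightarrow> level x k \<le> m"
proof
  have *: "x \<in> C k (level x k)" unfolding level_def by (rule LeastI_ex[OF C_cover[OF assms]])
  show "x \<in> C k m" if "level x k \<le> m" using * C_mono[OF that, of k] by (rule subsetD[rotated])
qed (simp add: level_def Least_le)

lemma C_subset: "C k m \<subseteq> D"
  using closedin_subset[OF C_closed] topspace_coarse by blast

lemma C_closed_preimage: obtains F where "closed F" "C k m = {x \<in> D. \<Phi> x \<in> F}"
proof -
  have "openin coarse (D - C k m)" using C_closed[of k m] unfolding closedin_def topspace_coarse by blast
  then obtain U where U: "open U" "D - C k m = \<Phi> -` U \<inter> D" unfolding openin_pullback_topology by auto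
  have "C k m = {x \<in> D. \<Phi> x \<in> - U}" using U(2) C_subset[of k m] by auto
  then show ?thesis using that[of "-U"] U(1) by (simp add: closed_Compl)
qed

lemma metrizable_coarse: "metrizable_space coarse"
proof -
  have "coarse homeomorphic_space subtopology euclidean (\<Phi> ` D)"
    by (rule pullback_topology_homeomorphic_space[OF inj]) simp
  then show ?thesis
    using metrizable_space_subtopology[OF metrizable_space_euclidean] homeomorphic_metrizable_space by blast
qed

lemma coarse_le_weak:
  assumes "openin coarse U"
  shows "openin (weak_topology S) U"
proof -
  obtain V where V: "open V" "U = \<Phi> -` V \<inter> D" using assms unfolding openin_pullback_topology by auto
  have "continuous_map (weak_topology S) euclidean \<Phi>"
    by (intro continuous_map_into_product)
       (simp add: continuous_map_weak_topology continuous_map_sequential_topology conv_coordinate)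
  then have "openin (weak_topology S) {x \<in> D. \<Phi> x \<in> V}"
    using V(1) unfolding continuous_map_def topspace_weak_topology topspace_sequential_topology by simp
  moreover have "{x \<in> D. \<Phi> x \<in> V} = U" using V(2) by blast
  ultimately show ?thesis by simp
qed

lemma conv_limit_in_C:
  assumes "range x \<subseteq> C k m" "l \<in> D" "conv x l"
  shows "l \<in> C k m"
proof -
  obtain F where F: "closed F" "C k m = {x \<in> D. \<Phi> x \<in> F}" by (rule C_closed_preimage)
  have "(\<lambda>n. \<Phi> (x n)) \<longlonglongrightarrow> \<Phi> l"
    using conv_coordinate[of x l] assms C_subset by (intro tendsto_coordinatewise) blast
  then have "\<Phi> l \<in> F" by (rule closed_sequentially[OF F(1), rotated]) (use assms F(2) in auto)
  then show ?thesis using F(2) assms(2) by blast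
qed

text \<open>Compactness gives every subsequence a further one converging to some point with
  \<open>\<Phi>\<close>-image \<open>y\<close>; injectivity of \<open>\<Phi>\<close> makes this the
  same point for all subsequences.\<close>

lemma bounded_seq_subconv:
  assumes "range x \<subseteq> D" "\<And>k. \<exists>m. \<forall>n. level (x n) k \<le> m" "(\<lambda>n. \<Phi> (x n)) \<longlonglongrightarrow> y"
  shows "\<exists>l\<in>D. \<Phi> l = y \<and> subseq_converges conv x l"
proof -
  have ex: "\<exists>(q::nat \<Rightarrow> nat) l. strict_mono q \<and> l \<in> D \<and> \<Phi> l = y \<and> conv (x \<circ> r \<circ> q) l" if r: "strict_mono r" for r :: "nat \<Rightarrow> nat"
  proof -
    have "\<exists>m. range (x \<circ> r) \<subseteq> C k m" for k
    proof -
      obtain m where m: "\<And>n. level (x n) k \<le> m" using assms(2) by blast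
      have "x n \<in> C k m" for n using m[of n] in_C_level[of "x n" k m] assms(1) by auto
      then show ?thesis by auto
    qed
    moreover have "range (x \<circ> r) \<subseteq> D" using assms(1) by auto
    ultimately obtain q l where ql: "strict_mono q" "l \<in> D" "conv (x \<circ> r \<circ> q) l"
      using C_compact[of "x \<circ> r"] by auto
    have "(\<lambda>n. \<Phi> ((x \<circ> r \<circ> q) n) j) \<longlonglongrightarrow> \<Phi> l j" for j
      using ql assms(1) by (intro conv_coordinate) (auto simp: comp_def)
    moreover have "(\<lambda>n. \<Phi> ((x \<circ> r \<circ> q) n) j) \<longlonglongrightarrow> y j" for j
    proof -
      have "(\<lambda>n. \<Phi> (x n) j) \<longlonglongrightarrow> y j"
        using continuous_on_tendsto_compose[OF continuous_on_product_coordinates assms(3)] by simp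
      from LIMSEQ_subseq_LIMSEQ[OF this strict_mono_o[OF r ql(1)]] show ?thesis by (simp add: comp_def)
    qed
    ultimately have "\<Phi> l = y" using LIMSEQ_unique by blast
    then show ?thesis using ql by blast
  qed
  obtain l where l: "l \<in> D" "\<Phi> l = y" using ex[OF strict_mono_id] by blast
  have "subseq_converges conv x l"
    unfolding subseq_converges_def
  proof (intro allI impI)
    fix r :: "nat \<Rightarrow> nat" assume "strict_mono r"
    then obtain q l' where q: "strict_mono q" "l' \<in> D" "\<Phi> l' = y" "conv (x \<circ> r \<circ> q) l'" using ex by blast
    have "l' = l" using inj_onD[OF inj] q l by simp
    then show "\<exists>q. strict_mono q \<and> conv (x \<circ> r \<circ> q) l" using q by blast
  qed
  then show ?thesis using l by blast
qed

text \<open>Convergence in the refined topology makes every level converge, hence bounded.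
  Coordinatewise convergence then upgrades to subsequential \<open>conv\<close>-convergence, so
  sequentially closed sets are closed in the refined topology.\<close>

lemma S_le_refined:
  assumes "openin S U"
  shows "openin refined U"
proof -
  define A where "A = D - U"
  have A: "seq_closed D conv A" "U \<subseteq> D" using assms unfolding openin_sequential_topology A_def by auto
  have "x \<in> A" if x: "x \<in> D" "\<Psi> x \<in> closure (\<Psi> ` A)" for x
  proof -
    obtain y where y: "\<And>n. y n \<in> \<Psi> ` A" "y \<longlonglongrightarrow> \<Psi> x" using x(2) unfolding closure_sequential by blast
    then obtain \<xi> where \<xi>: "\<And>n. \<xi> n \<in> A" "\<And>n. y n = \<Psi> (\<xi> n)" unfolding image_iff by metis
    have lim: "(\<lambda>n. \<Phi> (\<xi> n)) \<longlonglongrightarrow> \<Phi> x" "(\<lambda>n k. real (level (\<xi> n) k)) \<longlonglongrightarrow> (\<lambda>k. real (level x k))"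
      using tendsto_fst[OF y(2)] tendsto_snd[OF y(2)] by (simp_all add: \<xi>(2) \<Psi>_def)
    have bd: "\<exists>m. \<forall>n. level (\<xi> n) k \<le> m" for k
    proof -
      have "(\<lambda>n. real (level (\<xi> n) k)) \<longlonglongrightarrow> real (level x k)"
        using continuous_on_tendsto_compose[OF continuous_on_product_coordinates lim(2)] by simp
      then have "Bseq (\<lambda>n. real (level (\<xi> n) k))" by (intro convergent_imp_Bseq convergentI)
      then obtain b where "\<And>n. \<bar>real (level (\<xi> n) k)\<bar> \<le> b" unfolding Bseq_def by auto
      then have "level (\<xi> n) k \<le> nat \<lceil>b\<rceil>" for n by (meson abs_le_D1 nat_ceiling_le_eq nat_le_real_less of_nat_ceiling of_nat_le_iff order_trans)
      then show ?thesis by blast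
    qed
    have rng: "range \<xi> \<subseteq> D" using \<xi>(1) unfolding A_def by auto
    obtain l where l: "l \<in> D" "\<Phi> l = \<Phi> x" "subseq_converges conv \<xi> l"
      using bounded_seq_subconv[OF rng bd lim(1)] by blast
    then have "l = x" using inj x(1) unfolding inj_on_def by blast
    then show "x \<in> A" using A(1) l \<xi>(1) unfolding seq_closed_def by blast
  qed
  then have "A = {x \<in> D. \<Psi> x \<in> closure (\<Psi> ` A)}"
    using closure_subset unfolding A_def by fast
  then have "U = \<Psi> -` (- closure (\<Psi> ` A)) \<inter> D" using A(2) unfolding A_def by blast
  moreover have "open (- closure (\<Psi> ` A))" by (intro open_Compl closed_closure)
  ultimately show ?thesis unfolding openin_pullback_topology by auto
qed

section \<open>The refined topology is Polish\<close>

lemma second_countable_refined: "second_countable refined"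
proof -
  obtain B :: "(('j \<Rightarrow> real) \<times> ('k \<Rightarrow> real)) set set" where B: "countable B" "\<And>X. X \<in> B \<Longrightarrow> open X"
      "\<And>U. open U \<Longrightarrow> \<exists>B'\<subseteq>B. U = \<Union>B'"
    using univ_second_countable by metis
  show ?thesis
    unfolding second_countable_def
  proof (intro exI[of _ "(\<lambda>b. \<Psi> -` b \<inter> D) ` B"] conjI ballI allI impI)
    fix V assume "V \<in> (\<lambda>b. \<Psi> -` b \<inter> D) ` B"
    then show "openin refined V" unfolding openin_pullback_topology using B(2) by auto
  next
    fix U x assume U: "openin refined U \<and> x \<in> U"
    then obtain W where W: "open W" "U = \<Psi> -` W \<inter> D" unfolding openin_pullback_topology by auto
    then obtain b where "b \<in> B" "\<Psi> x \<in> b" "b \<subseteq> W" using B(3)[OF W(1)] U by blast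
    then show "\<exists>V\<in>(\<lambda>b. \<Psi> -` b \<inter> D) ` B. x \<in> V \<and> V \<subseteq> U"
      using U W by (intro bexI[of _ "\<Psi> -` b \<inter> D"]) auto
  qed (simp add: B(1))
qed

text \<open>Arbitrary admissible bounds in place of the least ones: admissibility survives limits,
  minimality need not.\<close>

definition graph_hull :: "(('j \<Rightarrow> real) \<times> ('k \<Rightarrow> real)) set" where
  "graph_hull = {(y, s). \<exists>x\<in>D. y = \<Phi> x \<and> (\<forall>k. \<exists>m. s k = real m \<and> x \<in> C k m)}"

text \<open>A convergent sequence of integers is eventually constant, so the limiting bounds are
  admissible along a tail of the sequence and, the strata being closed, also for the limit.\<close>

lemma closed_graph_hull: "closed graph_hull"
  unfolding closed_sequential_limits
proof (intro allI impI)
  fix z p assume "(\<forall>n. z n \<in> graph_hull) \<and> z \<longlonglongrightarrow> p"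
  then have z: "\<And>n. z n \<in> graph_hull" "z \<longlonglongrightarrow> p" by auto
  have "\<exists>x m. x \<in> D \<and> fst (z n) = \<Phi> x \<and> (\<forall>k. snd (z n) k = real (m k) \<and> x \<in> C k (m k))" for n
    using z(1)[of n] unfolding graph_hull_def by (auto simp: split_beta) metis
  then obtain x m where xm: "\<And>n. x n \<in> D" "\<And>n. fst (z n) = \<Phi> (x n)"
      "\<And>n k. snd (z n) k = real (m n k)" "\<And>n k. x n \<in> C k (m n k)" by metis
  have lim: "(\<lambda>n. \<Phi> (x n)) \<longlonglongrightarrow> fst p" using tendsto_fst[OF z(2)] by (simp add: xm(2))
  have "(\<lambda>n. real (m n k)) \<longlonglongrightarrow> snd p k" for k
    using continuous_on_tendsto_compose[OF continuous_on_product_coordinates tendsto_snd[OF z(2)], of k]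
    by (simp add: xm(3))
  then have "\<exists>M. snd p k = real M \<and> eventually (\<lambda>n. m n k = M) sequentially" for k
    using convergent_nat_sequence by metis
  then obtain M where M: "\<And>k. snd p k = real (M k)" "\<And>k. eventually (\<lambda>n. m n k = M k) sequentially"
    by metis
  have bd: "\<exists>b. \<forall>n. level (x n) k \<le> b" for k
  proof -
    obtain N where N: "\<And>n. n \<ge> N \<Longrightarrow> m n k = M k" using M(2) unfolding eventually_sequentially by blast
    \<comment> \<open>Before the index \<open>N\<close> there are finitely many bounds; the maximum
      covers these and the eventual value \<open>M k\<close>.\<close>
    have "m n k \<le> Max (insert (M k) ((\<lambda>n. m n k) ` {..<N}))" for n
      by (cases "n < N") (use N[of n] in auto)
    then show ?thesis using xm(1,4) in_C_level order_trans by metis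
  qed
  obtain l where l: "l \<in> D" "\<Phi> l = fst p" "subseq_converges conv x l"
    using bounded_seq_subconv[OF _ bd lim] xm(1) by blast
  have "l \<in> C k (M k)" for k
  proof -
    obtain F where F: "closed F" "C k (M k) = {x \<in> D. \<Phi> x \<in> F}" by (rule C_closed_preimage)
    have "eventually (\<lambda>n. \<Phi> (x n) \<in> F) sequentially"
      using M(2)[of k]
    proof eventually_elim
      case (elim n)
      then have "x n \<in> C k (M k)" using xm(4)[of n k] by simp
      then show ?case unfolding F(2) by simp
    qed
    then have "fst p \<in> F" using Lim_in_closed_set[OF F(1) _ _ lim] by simp
    then show ?thesis using F(2) l by simp
  qed
  then have "p = (fst p, snd p)" "\<exists>x\<in>D. fst p = \<Phi> x \<and> (\<forall>k. \<exists>m. snd p k = real m \<and> x \<in> C k m)"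
    using l M(1) by (auto intro!: bexI[of _ l])
  then show "p \<in> graph_hull" unfolding graph_hull_def by (auto simp: split_beta)
qed

lemma gdelta_image_refined: "gdelta_in euclidean (\<Psi> ` D)"
proof -
  have "\<exists>F. closed F \<and> C k m = {x \<in> D. \<Phi> x \<in> F}" for k m
    by (rule C_closed_preimage[of k m]) blast
  then obtain F where F: "\<And>k m. closed (F k m)" "\<And>k m. C k m = {x \<in> D. \<Phi> x \<in> F k m}" by metis
  \<comment> \<open>For points of \<open>graph_hull\<close>, whose bounds are integers,
    \<open>snd p k < m + 1\<close> is an open way to say that the bound is at most \<open>m\<close>.
    Membership in all \<open>O' (k, m)\<close> therefore says that no bound smaller than the given
    one is admissible.\<close>
  define O' where "O' km = {p. snd p (fst km) < real (snd km) + 1} \<union> {p. fst p \<in> - F (fst km) (snd km)}"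
    for km :: "'k \<times> nat"
  have op: "open (O' km)" for km
  proof -
    have "continuous_on UNIV (\<lambda>p::('j \<Rightarrow> real) \<times> ('k \<Rightarrow> real). snd p (fst km))"
      by (rule continuous_on_product_then_coordinatewise) (rule continuous_on_snd[OF continuous_on_id])
    then have "open {p::('j \<Rightarrow> real) \<times> ('k \<Rightarrow> real). snd p (fst km) < real (snd km) + 1}"
      by (intro open_Collect_less continuous_on_const) auto
    moreover have "open (fst -` (- F (fst km) (snd km)) :: (('j \<Rightarrow> real) \<times> ('k \<Rightarrow> real)) set)"
      by (rule open_vimage_fst) (simp add: F(1) open_Compl)
    ultimately show ?thesis unfolding O'_def vimage_def by blast
  qed
  have "\<Psi> ` D = graph_hull \<inter> (\<Inter>km. O' km)"
  proof (intro equalityI subsetI)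
    fix p assume "p \<in> \<Psi> ` D"
    then obtain x where x: "x \<in> D" "p = \<Psi> x" by blast
    have "p \<in> graph_hull" unfolding graph_hull_def x(2) \<Psi>_def using x(1) in_C_level by auto
    moreover have "p \<in> O' km" for km
    proof (cases "level x (fst km) \<le> snd km")
      case True then show ?thesis unfolding O'_def x(2) \<Psi>_def by simp
    next
      case False
      then have "x \<notin> C (fst km) (snd km)" using in_C_level[OF x(1)] by blast
      then show ?thesis using x F(2) unfolding O'_def \<Psi>_def by auto
    qed
    ultimately show "p \<in> graph_hull \<inter> (\<Inter>km. O' km)" by blast
  next
    fix p assume p: "p \<in> graph_hull \<inter> (\<Inter>km. O' km)"
    then obtain x where x: "x \<in> D" "fst p = \<Phi> x" "\<And>k. \<exists>m. snd p k = real m \<and> x \<in> C k m"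
      unfolding graph_hull_def by (auto simp: split_beta)
    have "snd p k = real (level x k)" for k
    proof -
      obtain m where m: "snd p k = real m" "x \<in> C k m" using x(3) by blast
      have "level x k \<le> m" using m(2) in_C_level[OF x(1)] by blast
      moreover have "m \<le> level x k"
      proof (rule ccontr)
        assume "\<not> m \<le> level x k"
        then have "\<not> snd p k < real (level x k) + 1" using m(1) by linarith
        moreover have "p \<in> O' (k, level x k)" using p by blast
        ultimately have "\<Phi> x \<notin> F k (level x k)" unfolding O'_def x(2)[symmetric] by simp
        then show False using F(2)[of k "level x k"] in_C_level[OF x(1)] by blast
      qed
      ultimately show ?thesis using m(1) by simp
    qed
    then have "p = \<Psi> x" unfolding \<Psi>_def by (intro prod_eqI) (auto simp: x(2))
    then show "p \<in> \<Psi> ` D" using x(1) by blast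
  qed
  moreover have "gdelta_in euclidean (\<Inter>km. O' km)"
    by (rule gdelta_in_Inter) (auto intro!: open_imp_gdelta_in op)
  moreover have "gdelta_in euclidean graph_hull"
    by (rule closed_imp_gdelta_in[OF metrizable_space_euclidean]) (simp add: closed_graph_hull)
  ultimately show ?thesis by (simp add: gdelta_in_Int)
qed

lemma completely_metrizable_refined: "completely_metrizable_space refined"
proof -
  have "refined homeomorphic_space subtopology euclidean (\<Psi> ` D)"
    by (rule pullback_topology_homeomorphic_space[OF inj_refined]) simp
  then show ?thesis
    using completely_metrizable_space_gdelta_in[OF completely_metrizable_space_euclidean gdelta_image_refined]
      homeomorphic_completely_metrizable_space by blast
qed

text \<open>The one-to-one mapping is the identity from the Polish refined topology.\<close>

lemma Lusin_space_coarser_than_refined: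
  assumes "topspace X = D" "\<And>U. openin X U \<Longrightarrow> openin refined U"
  shows "Lusin_space X"
proof -
  obtain M d where M: "Metric_space M d" "Metric_space.mcomplete M d" "refined = Metric_space.mtopology M d"
    using completely_metrizable_refined unfolding completely_metrizable_space_def by blast
  have "separable_space (Metric_space.mtopology M d)"
    using second_countable_imp_separable_space[OF second_countable_refined] M(3) by simp
  moreover have "M = D"
    using M(1,3) topspace_refined Metric_space.topspace_mtopology by metis
  moreover have "continuous_map refined X id"
    unfolding continuous_map_def topspace_refined assms(1)
  proof (intro conjI allI impI)
    fix U assume U: "openin X U"
    then have "{x \<in> D. id x \<in> U} = U" using openin_subset assms(1) by fastforce
    then show "openin refined {x \<in> D. id x \<in> U}" using assms(2)[OF U] by simp
  qed auto
  ultimately show ?thesis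
    unfolding Lusin_space_def using M assms(1)
    by (intro exI[of _ M] exI[of _ d] exI[of _ id]) auto
qed

text \<open>The strata are closed in the coarse topology, so the least \<open>m\<close> with
  \<open>x \<in> C k m\<close> is a Borel function of \<open>x\<close>. Hence \<open>\<Psi>\<close>
  is Borel, and refined open sets are preimages of open sets under it.\<close>

lemma refined_Borel_coarse:
  assumes "openin refined U"
  shows "U \<in> Borel_sets coarse"
proof -
  define N where "N = sigma D {U. openin coarse U}"
  have sub: "{U. openin coarse U} \<subseteq> Pow D" using openin_subset topspace_coarse by blast
  have sp: "space N = D" and st: "sets N = Borel_sets coarse"
    unfolding N_def Borel_sets_def topspace_coarse using sub by simp_all
  have "{x \<in> space N. \<Phi> x \<in> V} \<in> sets N" if "open V" for V
  proof -
    have "openin coarse {x \<in> D. \<Phi> x \<in> V}"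
      unfolding openin_pullback_topology using that by (intro exI[of _ V]) auto
    then show ?thesis unfolding sp st Borel_sets_def by (intro sigma_sets.Basic) simp
  qed
  then have \<Phi>_meas: "\<Phi> \<in> borel_measurable N"
    by (intro borel_measurableI) (simp add: vimage_def Int_def conj_commute)
  have "C k m \<in> sets N" for k m
  proof -
    have "D - C k m \<in> sets N" using C_closed[of k m] unfolding st Borel_sets_def closedin_def topspace_coarse
      by (intro sigma_sets.Basic) simp
    then have "space N - (D - C k m) \<in> sets N" by (rule sets.compl_sets)
    moreover have "space N - (D - C k m) = C k m" using C_subset sp by blast
    ultimately show ?thesis by simp
  qed
  then have "(\<lambda>x. LEAST m. x \<in> C k m) \<in> measurable N (count_space UNIV)" for k
    by (intro measurable_Least pred_sets2[OF _ measurable_ident_sets[OF refl]])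
  then have "(\<lambda>x. real (level x k)) \<in> borel_measurable N" for k
    unfolding level_def by (rule measurable_compose) simp
  then have "(\<lambda>x k. real (level x k)) \<in> borel_measurable N"
    by (rule measurable_coordinatewise_then_product)
  then have "\<Psi> \<in> borel_measurable N" unfolding \<Psi>_def using \<Phi>_meas by (rule borel_measurable_Pair[rotated])
  moreover obtain W where W: "open W" "U = \<Psi> -` W \<inter> D" using assms unfolding openin_pullback_topology by auto
  ultimately have "\<Psi> -` W \<inter> space N \<in> sets N" by (intro measurable_sets) auto
  then show ?thesis using W sp st by simp
qed

lemma Borel_sets_between:
  assumes "topspace X = D" "\<And>U. openin coarse U \<Longrightarrow> openin X U" "\<And>U. openin X U \<Longrightarrow> openin refined U"
  shows "Borel_sets X = Borel_sets coarse"
proof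
  show "Borel_sets X \<subseteq> Borel_sets coarse"
    unfolding Borel_sets_def assms(1) topspace_coarse
    by (rule sigma_sets_mono)
      (use refined_Borel_coarse assms(3) in \<open>auto simp: Borel_sets_def topspace_coarse\<close>)
  show "Borel_sets coarse \<subseteq> Borel_sets X"
    unfolding Borel_sets_def assms(1) topspace_coarse using assms(2) by (intro sigma_sets_mono') auto
qed

section \<open>Compact sets of the weak topology\<close>

lemma weak_compact_bounded:
  assumes K: "compactin (weak_topology S) K"
  shows "\<exists>m. K \<subseteq> C k m"
proof (rule ccontr)
  assume "\<nexists>m. K \<subseteq> C k m"
  then have "\<exists>y. y \<in> K \<and> y \<notin> C k m" for m by blast
  then obtain x where x: "\<And>m. x m \<in> K" "\<And>m. x m \<notin> C k m" by metis
  have KD: "K \<subseteq> D" using compactin_subset_topspace[OF K]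
    by (simp add: topspace_weak_topology topspace_sequential_topology)
  have "\<exists>F. closed F \<and> C k m = {x \<in> D. \<Phi> x \<in> F}" for m
    by (rule C_closed_preimage[of k m]) blast
  then obtain F where F: "\<And>m. closed (F m)" "\<And>m. C k m = {x \<in> D. \<Phi> x \<in> F m}" by metis
  \<comment> \<open>\<open>infdist\<close> to the empty set is 0 by convention, which would hide
    that no point belongs to \<open>F m\<close>; the constant 1 is used in that case.\<close>
  define \<psi> where "\<psi> m y = (if F m = {} then 1 else infdist y (F m))" for m y
  have \<psi>0: "\<psi> m y = 0 \<longleftrightarrow> y \<in> F m" for m y
    unfolding \<psi>_def using in_closed_iff_infdist_zero[OF F(1)] by auto
  have \<psi>ge: "\<psi> m y \<ge> 0" for m y unfolding \<psi>_def by (simp add: infdist_nonneg)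
  have \<psi>cont: "continuous_on UNIV (\<psi> m)" for m
    unfolding \<psi>_def by (cases "F m = {}") (auto intro!: continuous_intros)
  \<comment> \<open>Scales the \<open>m\<close>-th term to the value \<open>m + 1\<close> at
    \<open>x m\<close>. The denominator is positive because \<open>x m\<close> avoids the closed set
    \<open>F m\<close>.\<close>
  define c where "c m = real (Suc m) / \<psi> m (\<Phi> (x m))" for m
  have pos: "\<psi> m (\<Phi> (x m)) > 0" for m
    using \<psi>0[of m "\<Phi> (x m)"] \<psi>ge[of m "\<Phi> (x m)"] x F(2)[of m] KD by (auto simp: less_le)
  then have cge: "c m \<ge> 0" for m unfolding c_def using \<psi>ge by simp
  \<comment> \<open>Cutting the series at the level of \<open>y\<close> drops only vanishing terms,
    as \<open>y\<close> lies in all later strata. The cut may therefore sit at any \<open>M\<close>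
    with \<open>y \<in> C k M\<close>, and so at one \<open>M\<close> for a whole convergent
    sequence; this gives continuity.\<close>
  define f where "f y = (\<Sum>m<level y k. c m * \<psi> m (\<Phi> y))" for y
  have f_eq: "f y = (\<Sum>m<M. c m * \<psi> m (\<Phi> y))" if y: "y \<in> C k M" for y M
  proof -
    have yD: "y \<in> D" using y C_subset by blast
    have "level y k \<le> M" using y in_C_level[OF yD] by blast
    moreover have "\<psi> m (\<Phi> y) = 0" if "level y k \<le> m" for m
      using in_C_level[OF yD, of k m] that F(2)[of m] \<psi>0 by blast
    ultimately show ?thesis unfolding f_def by (intro sum.mono_neutral_left) auto
  qed
  have "continuous_map S euclidean f"
  proof (rule continuous_map_sequential_topology)
    fix \<xi> l assume \<xi>: "range \<xi> \<subseteq> D" "l \<in> D" "conv \<xi> l"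
    then obtain M where M: "range \<xi> \<subseteq> C k M" using C_bounded by blast
    have l: "l \<in> C k M" by (rule conv_limit_in_C[OF M \<xi>(2,3)])
    have "(\<lambda>n. \<Phi> (\<xi> n)) \<longlonglongrightarrow> \<Phi> l" using conv_coordinate[OF \<xi>] by (intro tendsto_coordinatewise)
    then have "(\<lambda>n. \<psi> m (\<Phi> (\<xi> n))) \<longlonglongrightarrow> \<psi> m (\<Phi> l)" for m
      using continuous_on_tendsto_compose[OF \<psi>cont] by simp
    then have "(\<lambda>n. \<Sum>m<M. c m * \<psi> m (\<Phi> (\<xi> n))) \<longlonglongrightarrow> (\<Sum>m<M. c m * \<psi> m (\<Phi> l))"
      by (intro tendsto_intros)
    moreover have "f (\<xi> n) = (\<Sum>m<M. c m * \<psi> m (\<Phi> (\<xi> n)))" for n using M by (intro f_eq) auto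
    ultimately show "(\<lambda>n. f (\<xi> n)) \<longlonglongrightarrow> f l" using f_eq[OF l] by simp
  qed
  then have "compactin euclideanreal (f ` K)"
    using image_compactin[OF K] continuous_map_weak_topology by blast
  then have "bounded (f ` K)" by (simp add: compact_imp_bounded)
  then obtain b where b: "\<And>y. y \<in> K \<Longrightarrow> \<bar>f y\<bar> \<le> b" unfolding bounded_iff by auto
  have "real (Suc m) \<le> f (x m)" for m
  proof -
    have "m < level (x m) k" using x in_C_level KD by (meson not_le subsetD)
    then have "c m * \<psi> m (\<Phi> (x m)) \<le> f (x m)"
      unfolding f_def by (intro member_le_sum) (auto simp: cge \<psi>ge)
    then show ?thesis using pos[of m] unfolding c_def by simp
  qed
  then have "real (Suc m) \<le> b" for m using b[OF x(1)] by (meson abs_le_D1 order_trans)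
  then show False by (metis not_less_eq_eq of_nat_le_iff order_trans real_arch_simple Suc_n_not_le_n)
qed

text \<open>\<open>K\<close> is closed in the Hausdorff topology \<open>S*\<close>, hence in the
  finer \<open>S\<close>. Since \<open>K\<close> is bounded in every stratum index, each of its
  sequences has a \<open>conv\<close>-convergent subsequence, whose limit stays in
  \<open>K\<close>.\<close>

lemma weak_compact_imp_compact:
  assumes K: "compactin (weak_topology S) K"
  shows "compactin S K"
proof -
  have top: "topspace coarse = topspace S" "topspace coarse = topspace (weak_topology S)"
    by (simp_all add: topspace_weak_topology topspace_sequential_topology topspace_coarse)
  have "Hausdorff_space (weak_topology S)"
    by (rule submetrizable_Hausdorff[OF top(2) coarse_le_weak metrizable_coarse])
  then have "closedin (weak_topology S) K" using K compactin_imp_closedin by blast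
  then have "closedin S K"
    unfolding closedin_def topspace_weak_topology using openin_weak_topology_imp by blast
  then have Kc: "seq_closed D conv K" by (simp add: closedin_sequential_topology)
  have "sequentially_compactin S K"
    unfolding sequentially_compactin_def topspace_sequential_topology
  proof (intro conjI allI impI)
    show KD: "K \<subseteq> D" using Kc unfolding seq_closed_def by blast
    fix x :: "nat \<Rightarrow> 'a" assume x: "range x \<subseteq> K"
    then have "\<exists>m. range x \<subseteq> C k m" for k using weak_compact_bounded[OF K] by blast
    moreover have xD: "range x \<subseteq> D" using x KD by blast
    ultimately obtain r l where rl: "strict_mono r" "l \<in> D" "conv (x \<circ> r) l" using C_compact by blast
    have "subseq_converges conv (x \<circ> r) l"
      unfolding subseq_converges_def
    proof (intro allI impI)
      fix s :: "nat \<Rightarrow> nat" assume "strict_mono s"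
      then have "conv (x \<circ> r \<circ> s) l" using conv_subseq[OF rl(3)] by blast
      then show "\<exists>q. strict_mono q \<and> conv (x \<circ> r \<circ> s \<circ> q) l"
        using strict_mono_id by (intro exI[of _ id]) simp
    qed
    moreover have "range (x \<circ> r) \<subseteq> K" using x by auto
    ultimately have "l \<in> K" using Kc rl(2) unfolding seq_closed_def by blast
    moreover have "limitin S (x \<circ> r) l sequentially"
      by (rule limitin_sequential_topology[where conv = conv and D = D])
        (use xD rl conv_subseq in auto)
    ultimately show "\<exists>l\<in>K. \<exists>r. strict_mono r \<and> limitin S (x \<circ> r) l sequentially"
      using rl(1) by blast
  qed
  then show ?thesis
    using submetrizable_compactin_iff_sequentially_compactin[OF top(1) _ metrizable_coarse]
      openin_weak_topology_imp coarse_le_weak by blast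
qed

text \<open>The five properties common to both topologies use only that each lies between
  \<open>coarse\<close> and \<open>refined\<close>.\<close>

theorem sequential_topology_properties:
  shows "(\<forall>\<tau>\<in>{S, weak_topology S}.
           Hausdorff_space \<tau> \<and>
           (\<forall>K. compactin \<tau> K \<longrightarrow> metrizable_space (subtopology \<tau> K)) \<and>
           (\<forall>K. compactin \<tau> K \<longleftrightarrow> sequentially_compactin \<tau> K) \<and>
           Borel_sets \<tau> = Borel_sets coarse \<and>
           Lusin_space \<tau>) \<and>
         perfectly_normal_space (weak_topology S) \<and> paracompact_space (weak_topology S) \<and>
         Borel_sets (weak_topology S) = Baire_sets (weak_topology S) \<and>
         {f. continuous_map S euclideanreal f} = {f. continuous_map (weak_topology S) euclideanreal f} \<and>
         {K. compactin S K} = {K. compactin (weak_topology S) K}"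
proof -
  have tops: "topspace coarse = topspace \<tau>" "topspace \<tau> = D"
      and le1: "\<And>U. openin coarse U \<Longrightarrow> openin \<tau> U"
      and le2: "\<And>U. openin \<tau> U \<Longrightarrow> openin refined U"
    if "\<tau> \<in> {S, weak_topology S}" for \<tau>
    using that coarse_le_weak openin_weak_topology_imp S_le_refined
    by (auto simp: topspace_weak_topology topspace_sequential_topology topspace_coarse)
  have 1: "Hausdorff_space \<tau> \<and>
           (\<forall>K. compactin \<tau> K \<longrightarrow> metrizable_space (subtopology \<tau> K)) \<and>
           (\<forall>K. compactin \<tau> K \<longleftrightarrow> sequentially_compactin \<tau> K) \<and>
           Borel_sets \<tau> = Borel_sets coarse \<and> Lusin_space \<tau>" if \<tau>: "\<tau> \<in> {S, weak_topology S}" for \<tau>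
    using submetrizable_Hausdorff[OF tops(1)[OF \<tau>] le1[OF \<tau>] metrizable_coarse]
      submetrizable_compact_metrizable[OF tops(1)[OF \<tau>] le1[OF \<tau>] metrizable_coarse]
      submetrizable_compactin_iff_sequentially_compactin[OF tops(1)[OF \<tau>] le1[OF \<tau>] metrizable_coarse]
      Borel_sets_between[OF tops(2)[OF \<tau>] le1[OF \<tau>] le2[OF \<tau>]]
      Lusin_space_coarser_than_refined[OF tops(2)[OF \<tau>] le2[OF \<tau>]]
    by (intro conjI allI impI)
  have H: "Hausdorff_space (weak_topology S)" using 1 by blast
  have f: "topspace refined = topspace S" by (simp add: topspace_refined topspace_sequential_topology)
  have pn: "perfectly_normal_space (weak_topology S)"
    by (rule perfectly_normal_weak_topology[OF f S_le_refined second_countable_refined H])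
  moreover have "paracompact_space (weak_topology S)"
    by (rule paracompact_weak_topology[OF f S_le_refined second_countable_refined])
  moreover have "compactin S K = compactin (weak_topology S) K" for K
  proof
    show "compactin S K" if "compactin (weak_topology S) K"
      using that by (rule weak_compact_imp_compact)
    show "compactin (weak_topology S) K" if "compactin S K"
      by (rule compactin_contractive[OF that _ openin_weak_topology_imp]) (simp add: topspace_weak_topology)
  qed
  moreover have "continuous_map (weak_topology S) euclideanreal f = continuous_map S euclideanreal f" for f
    by (rule continuous_map_weak_topology)
  ultimately show ?thesis
    using 1 Borel_eq_Baire_perfectly_normal[OF pn] by (intro conjI ballI Collect_cong) simp_all
qed

end

section \<open>The variation of a right-continuous function\<close>

lemma variation_sums_extend:
  assumes "x \<in> variation_sums a g" "0 \<le> a" "a < b"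
  shows "x + \<bar>g b - g a\<bar> \<in> variation_sums b g"
proof -
  obtain \<D> where D: "\<D> division_of {0..a}" "x = (\<Sum>K\<in>\<D>. \<bar>g (Sup K) - g (Inf K)\<bar>)"
    using assms(1) unfolding variation_sums_def by blast
  have ab: "{{a..b}} division_of {a..b}" using division_of_self[of a b] assms by (simp add: cbox_interval)
  have "interior {0..a} \<inter> interior {a..b} = {}" by auto
  from division_disjoint_union[OF D(1) ab this]
  have D': "insert {a..b} \<D> division_of {0..b}" using assms by (simp add: ivl_disj_un_two_touch(4) Un_commute)
  \<comment> \<open>If the new interval already belonged to the division, inserting it would not
    contribute a summand.\<close>
  have "{a..b} \<notin> \<D>"
  proof
    assume "{a..b} \<in> \<D>"
    then have "{a..b} \<subseteq> {0..a}" using D(1) by (meson division_ofD(2))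
    then show False using assms by auto
  qed
  then have "(\<Sum>K\<in>insert {a..b} \<D>. \<bar>g (Sup K) - g (Inf K)\<bar>) = \<bar>g b - g a\<bar> + x"
    using D division_of_finite[OF D(1)] assms by (simp add: cSup_atLeastAtMost cInf_atLeastAtMost)
  then show ?thesis unfolding variation_sums_def using D' by (force simp: add.commute)
qed

lemma variation_sums_singleton:
  assumes "0 \<le> a"
  shows "\<bar>g a - g 0\<bar> \<in> variation_sums a g"
proof -
  have "{{0..a}} division_of {0..a}" using division_of_self[of 0 a] assms by (simp add: cbox_interval)
  then show ?thesis unfolding variation_sums_def using assms
    by (intro image_eqI[of _ _ "{{0..a}}"]) (auto simp: cSup_atLeastAtMost cInf_atLeastAtMost)
qed

text \<open>The increments of \<open>U\<close> telescope over any division. Tagging each interval by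
  its left end point brings the division into the form for which the telescoping law is
  available.\<close>

lemma variation_sums_le_majorant:
  assumes x: "x \<in> variation_sums b g" and b: "0 \<le> b"
    and U: "\<And>s t. 0 \<le> s \<Longrightarrow> s \<le> t \<Longrightarrow> t \<le> b \<Longrightarrow> \<bar>g t - g s\<bar> \<le> U t - U s"
  shows "x \<le> U b - U 0"
proof -
  obtain \<D> where D: "\<D> division_of {0..b}" "x = (\<Sum>K\<in>\<D>. \<bar>g (Sup K) - g (Inf K)\<bar>)"
    using x unfolding variation_sums_def by blast
  define p where "p = (\<lambda>K. (Inf K, K)) ` \<D>"
  have K: "\<exists>c d. K = {c..d} \<and> c \<le> d \<and> 0 \<le> c \<and> d \<le> b" if KD: "K \<in> \<D>" for K
  proof -
    obtain c d where cd: "K = {c..d}" using division_ofD(4)[OF D(1) KD] by (auto simp: cbox_interval)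
    moreover have "K \<noteq> {}" "K \<subseteq> {0..b}" using division_ofD(2,3)[OF D(1) KD] by auto
    ultimately show ?thesis by auto
  qed
  have "p tagged_division_of {0..b}"
  proof (rule tagged_division_ofI)
    show "finite p" unfolding p_def using division_of_finite[OF D(1)] by simp
    fix y L assume "(y, L) \<in> p"
    then have L: "L \<in> \<D>" "y = Inf L" unfolding p_def by auto
    then obtain c d where cd: "L = {c..d}" "c \<le> d" "0 \<le> c" "d \<le> b" using K by blast
    show "y \<in> L" "L \<subseteq> {0..b}" "\<exists>a c. L = cbox a c" using cd L(2) by (auto simp: cInf_atLeastAtMost cbox_interval)
    fix y' L' assume "(y', L') \<in> p" "(y, L) \<noteq> (y', L')"
    then have "L' \<in> \<D>" "L \<noteq> L'" using L unfolding p_def by auto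
    then show "interior L \<inter> interior L' = {}" using division_ofD(5)[OF D(1) L(1)] by blast
  next
    have "{L. \<exists>y. (y, L) \<in> p} = \<D>" unfolding p_def by auto
    then show "\<Union>{L. \<exists>y. (y, L) \<in> p} = {0..b}" using division_ofD(6)[OF D(1)] by simp
  qed
  from additive_tagged_division_1[OF b this, of U]
  have "U b - U 0 = (\<Sum>(y,L)\<in>p. U (Sup L) - U (Inf L))" by simp
  also have "\<dots> = (\<Sum>L\<in>\<D>. U (Sup L) - U (Inf L))"
    unfolding p_def by (subst sum.reindex) (auto simp: inj_on_def)
  also have "\<dots> \<ge> x"
    unfolding D(2)
  proof (rule sum_mono)
    fix L assume "L \<in> \<D>"
    then obtain c d where cd: "L = {c..d}" "c \<le> d" "0 \<le> c" "d \<le> b" using K by blast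
    then show "\<bar>g (Sup L) - g (Inf L)\<bar> \<le> U (Sup L) - U (Inf L)" using U[of c d] by simp
  qed
  finally show ?thesis by simp
qed

section \<open>The total variation and its right continuity\<close>

locale finite_variation_function =
  fixes T :: real and g :: "real \<Rightarrow> real"
  assumes T_pos: "0 < T" and fv: "finite_variation T g"
begin

definition var :: "real \<Rightarrow> real" where "var a = Sup (variation_sums a g)"

lemma right_cont: "0 \<le> t \<Longrightarrow> t < T \<Longrightarrow> continuous (at_right t) g"
  using fv unfolding finite_variation_def by auto

lemma bdd: assumes "0 \<le> a" "a \<le> T" shows "bdd_above (variation_sums a g)"
proof -
  obtain B where B: "\<And>x. x \<in> variation_sums T g \<Longrightarrow> x \<le> B"
    using fv unfolding finite_variation_def bdd_above_def by auto
  show ?thesis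
  proof (cases "a = T")
    case False
    have "x \<le> B" if "x \<in> variation_sums a g" for x
      using B[OF variation_sums_extend[OF that, of T]] assms False by simp
    then show ?thesis unfolding bdd_above_def by blast
  qed (use B in \<open>auto simp: bdd_above_def\<close>)
qed

text \<open>Appending \<open>[a, b]\<close> to a division of \<open>[0, a]\<close> adds
  \<open>\<bar>g b - g a\<bar>\<close> to its sum; the supremum over divisions of
  \<open>[0, a]\<close> gives the claim.\<close>

lemma var_increment:
  assumes "0 \<le> a" "a \<le> b" "b \<le> T"
  shows "\<bar>g b - g a\<bar> \<le> var b - var a"
proof (cases "a = b")
  case False
  then have ab: "a < b" using assms by simp
  have "var a \<le> var b - \<bar>g b - g a\<bar>"
    unfolding var_def
  proof (rule cSup_least)
    show "variation_sums a g \<noteq> {}" using variation_sums_singleton[OF assms(1)] by blast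
    fix x assume "x \<in> variation_sums a g"
    then have "x + \<bar>g b - g a\<bar> \<le> Sup (variation_sums b g)"
      using assms by (intro cSup_upper bdd variation_sums_extend ab) auto
    then show "x \<le> Sup (variation_sums b g) - \<bar>g b - g a\<bar>" by simp
  qed
  then show ?thesis by simp
qed simp

lemma var_nonneg: "0 \<le> a \<Longrightarrow> a \<le> T \<Longrightarrow> 0 \<le> var a"
  unfolding var_def using cSup_upper[OF variation_sums_singleton bdd] by (meson abs_ge_zero order_trans)

text \<open>If the variation jumped by \<open>e\<close> immediately to the right of \<open>t\<close>, then lowering it by \<open>e\<close>
  there would still leave a majorant of the increments of \<open>g\<close>.\<close>
lemma var_right_cont_aux:
  assumes t: "0 \<le> t" "t < T" and e: "e > 0"
  shows "\<exists>s>t. s \<le> T \<and> var s < var t + e"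
proof (rule ccontr)
  assume "\<nexists>s. s > t \<and> s \<le> T \<and> var s < var t + e"
  then have jump: "\<And>s. t < s \<Longrightarrow> s \<le> T \<Longrightarrow> var s \<ge> var t + e" by (meson not_le)
  define U where "U s = var s - (if s > t then e else 0)" for s
  have U: "\<bar>g b - g a\<bar> \<le> U b - U a" if ab: "0 \<le> a" "a \<le> b" "b \<le> T" for a b
  proof (cases "a \<le> t \<and> t < b")
    case True
    \<comment> \<open>For \<open>s\<close> slightly above \<open>t\<close> the supposed jump gives
      this bound with \<open>g s\<close> in place of \<open>g t\<close>; right continuity of
      \<open>g\<close> carries it to \<open>t\<close>.\<close>
    have "\<bar>g b - g t\<bar> \<le> var b - var t - e"
    proof (rule tendsto_upperbound)
      show "((\<lambda>s. \<bar>g b - g s\<bar>) \<longlongrightarrow> \<bar>g b - g t\<bar>) (at_right t)"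
        using right_cont[OF t] unfolding continuous_within by (intro tendsto_intros)
      have "eventually (\<lambda>s. s \<in> {t<..<b}) (at_right t)"
        by (rule eventually_at_rightI[of _ b]) (use True in auto)
      then show "\<forall>\<^sub>F s in at_right t. \<bar>g b - g s\<bar> \<le> var b - var t - e"
      proof eventually_elim
        case (elim s)
        then show ?case using var_increment[of s b] jump[of s] t ab by auto
      qed
    qed simp
    moreover have "\<bar>g t - g a\<bar> \<le> var t - var a" using var_increment[of a t] True ab t by simp
    ultimately show ?thesis using True unfolding U_def by auto
  next
    case False
    then show ?thesis using var_increment[OF ab] ab unfolding U_def by auto
  qed
  have "var T \<le> U T - U 0"
    unfolding var_def
  proof (rule cSup_least)
    show "variation_sums T g \<noteq> {}" using variation_sums_singleton[of T g] T_pos by auto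
    show "x \<le> U T - U 0" if "x \<in> variation_sums T g" for x
      by (rule variation_sums_le_majorant[OF that]) (use T_pos U in auto)
  qed
  moreover have "U T - U 0 \<le> var T - e" using t var_nonneg[of 0] T_pos unfolding U_def by auto
  ultimately show False using e by simp
qed

definition ext :: "real \<Rightarrow> real" where "ext = zero_extension T g"
definition tv :: "real \<Rightarrow> real" where "tv = total_variation T g"

lemma ext_simps: "t < 0 \<Longrightarrow> ext t = 0" "0 \<le> t \<Longrightarrow> ext t = g (min t T)"
  and tv_simps: "t < 0 \<Longrightarrow> tv t = 0" "0 \<le> t \<Longrightarrow> tv t = \<bar>g 0\<bar> + var (min t T)"
  unfolding ext_def tv_def zero_extension_def total_variation_def var_def by auto

lemma tv_increment: "s \<le> t \<Longrightarrow> \<bar>ext t - ext s\<bar> \<le> tv t - tv s"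
proof -
  assume st: "s \<le> t"
  consider "t < 0" | "s < 0" "0 \<le> t" | "0 \<le> s" by linarith
  then show ?thesis
  proof cases
    \<comment> \<open>An increment across 0 contains the atom \<open>g 0\<close>, which is matched
      by the summand \<open>\<bar>g 0\<bar>\<close> in \<open>tv\<close>.\<close>
    case 2
    have "\<bar>g (min t T) - g 0\<bar> \<le> var (min t T) - var 0" using 2 T_pos by (intro var_increment) auto
    moreover have "var 0 \<ge> 0" using T_pos by (intro var_nonneg) auto
    ultimately show ?thesis using 2 by (simp add: ext_simps tv_simps)
  next
    case 3
    then show ?thesis using var_increment[of "min s T" "min t T"] st T_pos by (simp add: ext_simps tv_simps)
  qed (use st in \<open>simp add: ext_simps tv_simps\<close>)
qed

lemma tv_mono: "s \<le> t \<Longrightarrow> tv s \<le> tv t"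
  using tv_increment[of s t] by linarith

lemma tv_minus_ext_mono: "s \<le> t \<Longrightarrow> tv s - ext s \<le> tv t - ext t"
  using tv_increment[of s t] by linarith

lemma eventually_right_less: "t < b \<Longrightarrow> eventually (\<lambda>s. t < s \<and> s < b) (at_right t)" for t b :: real
  by (rule eventually_at_rightI[of _ b]) auto

lemma ext_right_cont: "continuous (at_right t) ext"
proof -
  consider "t < 0" | "0 \<le> t" "t < T" | "T \<le> t" by linarith
  then show ?thesis
  proof cases
    case 1
    show ?thesis unfolding continuous_within
      by (rule tendsto_eventually, rule eventually_mono[OF eventually_right_less[OF 1]])
         (use 1 in \<open>auto simp: ext_simps\<close>)
  next
    case 2
    have "(g \<longlongrightarrow> g t) (at_right t)" using right_cont[OF 2] by (simp add: continuous_within)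
    moreover have "eventually (\<lambda>s. g s = ext s) (at_right t)"
      by (rule eventually_mono[OF eventually_right_less[OF 2(2)]]) (use 2 in \<open>auto simp: ext_simps\<close>)
    ultimately have "(ext \<longlongrightarrow> g t) (at_right t)" by (rule Lim_transform_eventually)
    then show ?thesis using 2 by (simp add: continuous_within ext_simps)
  next
    case 3
    show ?thesis unfolding continuous_within
      by (rule tendsto_eventually, rule eventually_mono[OF eventually_right_less[of t "t+1"]])
         (use 3 T_pos in \<open>auto simp: ext_simps min_def\<close>)
  qed
qed

text \<open>By monotonicity the upper half reduces to a single \<open>s > t\<close> with
  \<open>tv s < a\<close>.\<close>

lemma tv_right_cont: "continuous (at_right t) tv"
  unfolding continuous_within
proof (rule order_tendstoI)
  fix a assume "a < tv t"
  then show "eventually (\<lambda>s. a < tv s) (at_right t)"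
    by (intro eventually_mono[OF eventually_right_less[of t "t+1"]]) (use tv_mono in \<open>auto intro: less_le_trans\<close>)
next
  fix a assume a: "tv t < a"
  have "\<exists>s>t. tv s < a"
  proof -
    consider "t < 0" | "0 \<le> t" "t < T" | "T \<le> t" by linarith
    then show ?thesis
    proof cases
      case 1 then show ?thesis using a by (intro exI[of _ "t/2"]) (auto simp: tv_simps)
    next
      case 2
      then obtain s where "s > t" "s \<le> T" "var s < var t + (a - tv t)"
        using var_right_cont_aux[of t "a - tv t"] a by auto
      then show ?thesis using 2 by (intro exI[of _ s]) (auto simp: tv_simps)
    next
      case 3 then show ?thesis using a T_pos by (intro exI[of _ "t+1"]) (auto simp: tv_simps min_absorb2)
    qed
  qed
  then obtain s where s: "s > t" "tv s < a" by blast
  show "eventually (\<lambda>s. tv s < a) (at_right t)"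
    by (rule eventually_mono[OF eventually_right_less[OF s(1)]])
       (use tv_mono s(2) in \<open>auto intro: le_less_trans less_imp_le\<close>)
qed

end

section \<open>The Stieltjes functional\<close>

text \<open>\<open>interval_measure\<close> is known on half-open intervals, so [0, u] is reached
  through (-1, u], whose part (-1, 0) is null because \<open>F\<close> vanishes left of 0.\<close>

lemma interval_measure_Icc_zero:
  assumes mono: "\<And>x y. x \<le> y \<Longrightarrow> F x \<le> F y" and rc: "\<And>a. continuous (at_right a) F"
    and F0: "\<And>x. x < 0 \<Longrightarrow> F x = 0" and u: "0 \<le> u"
  shows "emeasure (interval_measure F) {0..u} = ennreal (F u)"
proof -
  have "{-1<..<0} \<subseteq> (\<Union>n::nat. {-1<..-1/real (Suc n)})"
  proof
    fix x :: real assume x: "x \<in> {-1<..<0}"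
    then obtain n where "1 / real (Suc n) < - x" using reals_Archimedean[of "-x"] by (auto simp: inverse_eq_divide)
    then show "x \<in> (\<Union>n::nat. {-1<..-1/real (Suc n)})" using x by (auto intro!: exI[of _ n])
  qed
  moreover have "emeasure (interval_measure F) {-1<..-1/real (Suc n)} = 0" for n
    using emeasure_interval_measure_Ioc[of "-1" "-1/real (Suc n)" F] mono rc
    by (simp add: F0 divide_less_0_iff field_simps)
  then have "emeasure (interval_measure F) (\<Union>n::nat. {-1<..-1/real (Suc n)}) = 0"
    by (intro emeasure_UN_eq_0) auto
  ultimately have "emeasure (interval_measure F) {-1<..<0} = 0"
    by (metis (no_types, lifting) emeasure_mono le_zero_eq sets.countable_UN sets_interval_measure
        greaterThanAtMost_borel image_subset_iff)
  moreover have "{-1<..u} = {-1<..<0} \<union> {0..u}" using u by auto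
  moreover have "emeasure (interval_measure F) ({-1<..<0} \<union> {0..u})
      = emeasure (interval_measure F) {-1<..<0} + emeasure (interval_measure F) {0..u}"
    by (intro plus_emeasure[symmetric]) auto
  moreover have "emeasure (interval_measure F) {-1<..u} = ennreal (F u)"
    using emeasure_interval_measure_Ioc[of "-1" u F] u mono rc by (simp add: F0)
  ultimately show ?thesis by simp
qed

definition bounded_Borel_on :: "real \<Rightarrow> (real \<Rightarrow> real) \<Rightarrow> bool" where
  "bounded_Borel_on T f \<longleftrightarrow> f \<in> borel_measurable borel \<and> (\<exists>B. \<forall>t\<in>{0..T}. \<bar>f t\<bar> \<le> B)"

lemma set_integrable_interval_measure:
  assumes "emeasure (interval_measure F) {0..T} < \<infinity>" "bounded_Borel_on T f"
  shows "set_integrable (interval_measure F) {0..T} f"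
proof -
  obtain B where f: "f \<in> borel_measurable borel" and B: "\<And>t. t \<in> {0..T} \<Longrightarrow> \<bar>f t\<bar> \<le> B"
    using assms(2) unfolding bounded_Borel_on_def by blast
  have "set_integrable (interval_measure F) {0..T} (\<lambda>_. B)"
    unfolding set_integrable_def using assms(1) by simp
  then show ?thesis
  proof (rule set_integrable_bound)
    show "set_borel_measurable (interval_measure F) {0..T} f"
      unfolding set_borel_measurable_def using f by measurable
    show "AE t in interval_measure F. t \<in> {0..T} \<longrightarrow> norm (f t) \<le> norm B"
      using B by (intro AE_I2) force
  qed
qed

context finite_variation_function
begin

abbreviation "\<Lambda> \<equiv> Stieltjes_functional T g"

lemma measures:
  assumes "0 \<le> u"
  shows "emeasure (interval_measure tv) {0..u} = ennreal (tv u)"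
    "emeasure (interval_measure (\<lambda>s. tv s - ext s)) {0..u} = ennreal (tv u - ext u)"
proof -
  show "emeasure (interval_measure tv) {0..u} = ennreal (tv u)"
    using assms by (intro interval_measure_Icc_zero tv_mono tv_right_cont) (auto simp: tv_simps)
  show "emeasure (interval_measure (\<lambda>s. tv s - ext s)) {0..u} = ennreal (tv u - ext u)"
    using assms by (intro interval_measure_Icc_zero tv_minus_ext_mono continuous_diff tv_right_cont ext_right_cont)
      (auto simp: tv_simps ext_simps)
qed

lemma Stieltjes_alt:
  "\<Lambda> f = (LINT t:{0..T}|interval_measure tv. f t) - (LINT t:{0..T}|interval_measure (\<lambda>s. tv s - ext s). f t)"
  unfolding Stieltjes_functional_def tv_def ext_def ..

lemma integrable:
  assumes "bounded_Borel_on T f"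
  shows "set_integrable (interval_measure tv) {0..T} f"
    "set_integrable (interval_measure (\<lambda>s. tv s - ext s)) {0..T} f"
  using assms T_pos by (auto intro!: set_integrable_interval_measure simp: measures)

lemma Stieltjes_cong:
  assumes "\<And>t. t \<in> {0..T} \<Longrightarrow> f t = h t"
  shows "\<Lambda> f = \<Lambda> h"
proof -
  have "(\<lambda>t. indicator {0..T} t *\<^sub>R f t) = (\<lambda>t. indicator {0..T} t *\<^sub>R h t)"
    using assms by (auto simp: indicator_def)
  then show ?thesis unfolding Stieltjes_alt set_lebesgue_integral_def by simp
qed

lemma Stieltjes_add:
  assumes "bounded_Borel_on T f" "bounded_Borel_on T h"
  shows "\<Lambda> (\<lambda>t. f t + h t) = \<Lambda> f + \<Lambda> h"
  using integrable[OF assms(1)] integrable[OF assms(2)]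
  unfolding Stieltjes_alt by (simp add: set_integral_add)

lemma Stieltjes_mult: "\<Lambda> (\<lambda>t. c * f t) = c * \<Lambda> f"
  unfolding Stieltjes_alt by (simp add: right_diff_distrib)

lemma Stieltjes_zero: "\<Lambda> (\<lambda>t. 0) = 0"
  using Stieltjes_mult[of 0 "\<lambda>_. 0"] by simp

text \<open>With \<open>v = min u T\<close>, the two measures give [0, v] the masses
  \<open>tv v\<close> and \<open>tv v - ext v\<close>, and the difference returns
  \<open>g v\<close>. Point values of \<open>g\<close> are thus values of the functional.\<close>

lemma Stieltjes_atMost:
  assumes "0 \<le> u"
  shows "\<Lambda> (indicator {..u}) = g (min u T)"
proof -
  define v where "v = min u T"
  have v: "0 \<le> v" "v \<le> T" "min v T = v" using assms T_pos unfolding v_def by auto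
  have eq: "indicator {0..T} t *\<^sub>R indicator {..u} t = (indicator {0..v} t :: real)" for t
    unfolding v_def by (auto simp: indicator_def)
  have "(LINT t:{0..T}|interval_measure tv. indicator {..u} t) = tv v"
    unfolding set_lebesgue_integral_def eq using measures(1)[OF v(1)] tv_mono[of "-1" v] v
    by (simp add: measure_def tv_simps)
  moreover have "(LINT t:{0..T}|interval_measure (\<lambda>s. tv s - ext s). indicator {..u} t) = tv v - ext v"
    unfolding set_lebesgue_integral_def eq using measures(2)[OF v(1)] tv_minus_ext_mono[of "-1" v] v
    by (simp add: measure_def tv_simps ext_simps)
  ultimately show ?thesis unfolding Stieltjes_alt using v by (simp add: ext_simps v_def)
qed

text \<open>\<open>K\<close> is the total mass of [0, T] under the two measures together.\<close>

lemma Stieltjes_bounded: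
  obtains K where "K \<ge> 0" "\<And>f B. bounded_Borel_on T f \<Longrightarrow> (\<And>t. t \<in> {0..T} \<Longrightarrow> \<bar>f t\<bar> \<le> B) \<Longrightarrow> \<bar>\<Lambda> f\<bar> \<le> K * B"
proof -
  define K where "K = tv T + (tv T - ext T)"
  have pos: "tv T \<ge> 0" "tv T - ext T \<ge> 0"
    using tv_mono[of "-1" T] tv_minus_ext_mono[of "-1" T] T_pos by (auto simp: tv_simps ext_simps)
  have *: "\<bar>LINT t:{0..T}|interval_measure F. f t\<bar> \<le> F T * B"
    if F: "emeasure (interval_measure F) {0..T} = ennreal (F T)" "F T \<ge> 0"
      and f: "set_integrable (interval_measure F) {0..T} f" and B: "\<And>t. t \<in> {0..T} \<Longrightarrow> \<bar>f t\<bar> \<le> B" for F f B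
  proof -
    have BI: "set_integrable (interval_measure F) {0..T} (\<lambda>_. B)"
      unfolding set_integrable_def using F by simp
    have "\<bar>LINT t:{0..T}|interval_measure F. f t\<bar> \<le> (LINT t:{0..T}|interval_measure F. \<bar>f t\<bar>)"
      using set_integral_norm_bound[OF f] by simp
    also have "\<dots> \<le> (LINT t:{0..T}|interval_measure F. B)"
      by (intro set_integral_mono set_integrable_abs f BI B)
    also have "\<dots> = F T * B" using F by (simp add: set_lebesgue_integral_def measure_def)
    finally show ?thesis .
  qed
  have "\<bar>\<Lambda> f\<bar> \<le> K * B" if "bounded_Borel_on T f" "\<And>t. t \<in> {0..T} \<Longrightarrow> \<bar>f t\<bar> \<le> B" for f B
    using *[OF measures(1) pos(1) integrable(1)[OF that(1)] that(2)]
      *[OF measures(2) pos(2) integrable(2)[OF that(1)] that(2)] T_pos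
    unfolding Stieltjes_alt K_def by (simp add: algebra_simps)
  then show ?thesis using that[of K] pos unfolding K_def by auto
qed

lemma Stieltjes_dominated_convergence:
  assumes f: "\<And>n. f n \<in> borel_measurable borel" "h \<in> borel_measurable borel"
    and B: "\<And>n t. t \<in> {0..T} \<Longrightarrow> \<bar>f n t\<bar> \<le> B"
    and lim: "\<And>t. t \<in> {0..T} \<Longrightarrow> (\<lambda>n. f n t) \<longlonglongrightarrow> h t"
  shows "(\<lambda>n. \<Lambda> (f n)) \<longlonglongrightarrow> \<Lambda> h"
proof -
  have *: "(\<lambda>n. LINT t:{0..T}|interval_measure F. f n t) \<longlonglongrightarrow> (LINT t:{0..T}|interval_measure F. h t)"
    if F: "emeasure (interval_measure F) {0..T} < \<infinity>" for F
    unfolding set_lebesgue_integral_def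
  proof (rule integral_dominated_convergence[where w = "\<lambda>t. indicator {0..T} t *\<^sub>R B"])
    show "integrable (interval_measure F) (\<lambda>t. indicator {0..T} t *\<^sub>R B)" using F by simp
    show "AE t in interval_measure F. (\<lambda>i. indicator {0..T} t *\<^sub>R f i t) \<longlonglongrightarrow> indicator {0..T} t *\<^sub>R h t"
      using lim by (intro AE_I2) (auto simp: indicator_def)
    show "AE t in interval_measure F. norm (indicator {0..T} t *\<^sub>R f n t) \<le> indicator {0..T} t *\<^sub>R B" for n
      using B by (intro AE_I2) (auto simp: indicator_def)
  qed (use f in measurable)
  show ?thesis
    unfolding Stieltjes_alt using T_pos by (intro tendsto_diff *) (auto simp: measures)
qed

lemma bounded_Borel_on_sum:
  assumes "\<And>i. i \<in> A \<Longrightarrow> bounded_Borel_on T (f i)" "finite A"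
  shows "bounded_Borel_on T (\<lambda>t. \<Sum>i\<in>A. f i t)"
proof -
  have "\<exists>B. \<forall>i\<in>A. \<forall>t\<in>{0..T}. \<bar>f i t\<bar> \<le> B i" using assms(1) unfolding bounded_Borel_on_def by metis
  then obtain B where B: "\<And>i t. i \<in> A \<Longrightarrow> t \<in> {0..T} \<Longrightarrow> \<bar>f i t\<bar> \<le> B i" by blast
  have "\<bar>\<Sum>i\<in>A. f i t\<bar> \<le> (\<Sum>i\<in>A. B i)" if "t \<in> {0..T}" for t
    by (rule order_trans[OF sum_abs sum_mono]) (use B that in auto)
  moreover have "(\<lambda>t. \<Sum>i\<in>A. f i t) \<in> borel_measurable borel"
    using assms(1) unfolding bounded_Borel_on_def by (intro borel_measurable_sum) blast
  ultimately show ?thesis unfolding bounded_Borel_on_def by blast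
qed

lemma Stieltjes_sum:
  assumes "finite A" "\<And>i. i \<in> A \<Longrightarrow> bounded_Borel_on T (f i)"
  shows "\<Lambda> (\<lambda>t. \<Sum>i\<in>A. c i * f i t) = (\<Sum>i\<in>A. c i * \<Lambda> (f i))"
  using assms
proof (induction A rule: finite_induct)
  case (insert a A)
  have c: "bounded_Borel_on T (\<lambda>t. c i * f i t)" if i: "i \<in> insert a A" for i
  proof -
    obtain B where B: "\<forall>t\<in>{0..T}. \<bar>f i t\<bar> \<le> B" "f i \<in> borel_measurable borel"
      using insert.prems[OF i] unfolding bounded_Borel_on_def by blast
    have "\<forall>t\<in>{0..T}. \<bar>c i * f i t\<bar> \<le> \<bar>c i\<bar> * B" using B(1) by (simp add: abs_mult mult_left_mono)
    then show ?thesis using B(2) unfolding bounded_Borel_on_def by auto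
  qed
  have "\<Lambda> (\<lambda>t. c a * f a t + (\<Sum>i\<in>A. c i * f i t)) = \<Lambda> (\<lambda>t. c a * f a t) + \<Lambda> (\<lambda>t. \<Sum>i\<in>A. c i * f i t)"
    by (intro Stieltjes_add bounded_Borel_on_sum c insert.hyps) auto
  then show ?case using insert by (simp add: Stieltjes_mult)
qed (simp add: Stieltjes_zero)

end

section \<open>Riemann sums\<close>

abbreviation grid :: "real \<Rightarrow> nat \<Rightarrow> nat \<Rightarrow> real" where
  "grid T n j \<equiv> real j * T / real (Suc n)"

text \<open>For \<open>0 \<le> t \<le> T\<close> the value is \<open>f\<close> at the first grid point that is at least \<open>t\<close>; it is \<open>0\<close> for \<open>t > T\<close>.\<close>
definition grid_approx :: "real \<Rightarrow> nat \<Rightarrow> (real \<Rightarrow> real) \<Rightarrow> real \<Rightarrow> real" where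
  "grid_approx T n f t = f 0 * indicator {..0} t +
     (\<Sum>j<Suc n. f (grid T n (Suc j)) *
        (indicator {..grid T n (Suc j)} t - indicator {..grid T n j} t))"

lemma grid_approx_eq:
  assumes t: "0 < t" "t \<le> T"
  obtains s where "t \<le> s" "s \<le> T" "s < t + T / real (Suc n)" "\<And>f. grid_approx T n f t = f s"
proof -
  have T: "T > 0" using t by simp
  \<comment> \<open>The ceiling numbers the right end point of the grid cell, open on the left, that
    contains \<open>t\<close>; subtracting 1 passes to its left end point.\<close>
  define k where "k = nat \<lceil>t * real (Suc n) / T\<rceil> - 1"
  have pos: "t * real (Suc n) / T > 0" using t T by simp
  then have c: "\<lceil>t * real (Suc n) / T\<rceil> \<ge> 1" by linarith
  then have k1: "real (Suc k) = of_int \<lceil>t * real (Suc n) / T\<rceil>" unfolding k_def by (simp add: nat_diff_distrib)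
  have k2: "real k < t * real (Suc n) / T" "t * real (Suc n) / T \<le> real (Suc k)"
    unfolding k1 using ceiling_correct[of "t * real (Suc n) / T"] k1 by linarith+
  have "t * real (Suc n) \<le> real (Suc n) * T" using t by simp
  then have "t * real (Suc n) / T \<le> real (Suc n)" using T by (simp add: pos_divide_le_eq del: of_nat_Suc)
  then have "k < Suc n" using k2(1) by linarith
  define s where "s = real (Suc k) * T / real (Suc n)"
  have "t \<le> s" using k2(2) T unfolding s_def by (simp add: field_simps del: of_nat_Suc)
  moreover have "s < t + T / real (Suc n)"
  proof -
    have "real k * T / real (Suc n) < t" using k2(1) T by (simp add: field_simps del: of_nat_Suc)
    moreover have "s = real k * T / real (Suc n) + T / real (Suc n)"
      unfolding s_def of_nat_Suc[of k] by (simp add: add_divide_distrib distrib_right)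
    ultimately show ?thesis by simp
  qed
  moreover have "s \<le> T"
  proof -
    have "real (Suc k) \<le> real (Suc n)" using \<open>k < Suc n\<close> by simp
    then have "real (Suc k) * T \<le> real (Suc n) * T" using T by (intro mult_right_mono) auto
    then show ?thesis unfolding s_def by (simp add: field_simps)
  qed
  moreover have "grid_approx T n f t = f s" for f
  proof -
    have ind: "indicator {..grid T n (Suc j)} t - indicator {..grid T n j} t
        = (if j = k then 1 else 0 :: real)" for j
    proof -
      have e: "t \<le> real i * T / real (Suc n) \<longleftrightarrow> t * real (Suc n) / T \<le> real i" for i
        using T by (simp add: field_simps)
      show ?thesis unfolding indicator_def atMost_iff e using k2 by (auto simp del: of_nat_Suc)
    qed
    show ?thesis unfolding grid_approx_def ind s_def using \<open>k < Suc n\<close> t(1)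
      by (simp add: if_distrib cong: if_cong del: of_nat_Suc lessThan_Suc sum.lessThan_Suc)
  qed
  ultimately show ?thesis using that by blast
qed

lemma grid_approx_zero: "0 < T \<Longrightarrow> grid_approx T n f 0 = f 0"
  unfolding grid_approx_def by (simp add: indicator_def)

lemma grid_approx_greater:
  assumes "T < t" "0 < T"
  shows "grid_approx T n f t = 0"
proof -
  have "grid T n j < t" if "j \<le> Suc n" for j
  proof -
    have "real j * T \<le> real (Suc n) * T" using assms that by (intro mult_right_mono) auto
    then have "grid T n j \<le> T" by (simp add: field_simps)
    then show ?thesis using assms by simp
  qed
  then have "indicator {..grid T n j} t = (0::real)" if "j \<le> Suc n" for j
    using that by (simp add: indicator_def not_le)
  then have "(\<Sum>j<Suc n. f (grid T n (Suc j)) *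
        (indicator {..grid T n (Suc j)} t - indicator {..grid T n j} t)) = 0"
    by (intro sum.neutral) (auto simp del: of_nat_Suc)
  then show ?thesis unfolding grid_approx_def using assms by (simp add: indicator_def)
qed

lemma grid_approx_bounded:
  assumes "\<And>t. t \<in> {0..T} \<Longrightarrow> \<bar>f t\<bar> \<le> B" "t \<in> {0..T}" "0 < T"
  shows "\<bar>grid_approx T n f t\<bar> \<le> B"
proof (cases "t = 0")
  case False
  then obtain s where "t \<le> s" "s \<le> T" "grid_approx T n f t = f s"
    using grid_approx_eq[of t T n thesis] assms(2) by auto
  then show ?thesis using assms by auto
qed (use assms grid_approx_zero in auto)

text \<open>The sampled points approach \<open>t\<close> from the right within
  \<open>T / (n + 1)\<close>, so right continuity suffices. At \<open>t = T\<close>, where no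
  continuity is assumed, the sampled point is \<open>T\<close> itself.\<close>

lemma grid_approx_tendsto:
  assumes T: "0 < T" and rc: "\<And>t. 0 \<le> t \<Longrightarrow> t < T \<Longrightarrow> continuous (at_right t) f" and t: "t \<in> {0..T}"
  shows "(\<lambda>n. grid_approx T n f t) \<longlonglongrightarrow> f t"
proof (cases "t = 0")
  case False
  then have t0: "0 < t" "t \<le> T" using t by auto
  have "\<exists>s. t \<le> s \<and> s \<le> T \<and> s < t + T / real (Suc n) \<and> grid_approx T n f t = f s" for n
    using grid_approx_eq[OF t0, of n] by metis
  then obtain s where s: "\<And>n. t \<le> s n" "\<And>n. s n \<le> T" "\<And>n. s n < t + T / real (Suc n)"
      "\<And>n. grid_approx T n f t = f (s n)" by metis
  show ?thesis
  proof (cases "t = T")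
    case True
    then have "s n = T" for n using s(1,2)[of n] by simp
    then show ?thesis using s(4) True by simp
  next
    case False
    then have "(f \<longlongrightarrow> f t) (at_right t)" using rc[of t] t0 by (simp add: continuous_within)
    then have cont: "continuous (at t within {t..}) f"
      by (simp add: continuous_within at_within_Ici_at_right)
    have lim: "s \<longlonglongrightarrow> t"
    proof (rule tendsto_sandwich[where f = "\<lambda>_. t" and h = "\<lambda>n. t + T / real (Suc n)"])
      have "(\<lambda>n. t + T * inverse (real (Suc n))) \<longlonglongrightarrow> t + T * 0"
        by (intro tendsto_intros LIMSEQ_inverse_real_of_nat)
      then show "(\<lambda>n. t + T / real (Suc n)) \<longlonglongrightarrow> t" by (simp add: field_simps)
      show "\<forall>\<^sub>F n in sequentially. t \<le> s n" using s(1) by simp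
      show "\<forall>\<^sub>F n in sequentially. s n \<le> t + T / real (Suc n)" using s(3) less_imp_le by (intro always_eventually) blast
    qed auto
    have "(\<lambda>n. f (s n)) \<longlonglongrightarrow> f t"
      using cont lim s(1) unfolding continuous_within_sequentially by (auto simp: comp_def)
    then show ?thesis using s(4) by simp
  qed
qed (use T grid_approx_zero in simp)

text \<open>The Riemann sums are integrals of \<open>grid_approx\<close>, which converges boundedly
  and pointwise to \<open>x\<close>; dominated convergence yields integrability together with the
  limit. The sums reappear when integrals of paths are shown to be measurable.\<close>

lemma Riemann_sums:
  fixes x :: "real \<Rightarrow> real"
  assumes b: "0 < b" and rc: "\<And>t. 0 \<le> t \<Longrightarrow> t < b \<Longrightarrow> continuous (at_right t) x"
    and B: "\<And>t. t \<in> {0..b} \<Longrightarrow> \<bar>x t\<bar> \<le> B"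
  shows "x integrable_on {0..b}"
    "(\<lambda>n. \<Sum>j<Suc n. b / real (Suc n) * x (grid b n (Suc j))) \<longlonglongrightarrow> integral {0..b} x"
proof -
  have ind: "(indicator {..q} has_integral q) {0..b}" if "0 \<le> q" "q \<le> b" for q :: real
  proof -
    have "((\<lambda>u. 1) has_integral q) {0..q}" using has_integral_const_real[of "1::real" 0 q] that by simp
    then have "((\<lambda>u. if u \<in> {0..q} then 1 else 0) has_integral q) {0..b}"
      using has_integral_restrict[of "{0..q}" "{0..b}" "\<lambda>_. 1::real" q] that by simp
    then show ?thesis by (rule has_integral_eq[rotated]) (auto simp: indicator_def)
  qed
  \<comment> \<open>The term \<open>x 0 * 0\<close> is the contribution of the single point
    0.\<close>
  have gr: "((\<lambda>u. grid_approx b n x u) has_integral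
     (x 0 * 0 + (\<Sum>j<Suc n. x (grid b n (Suc j)) * (grid b n (Suc j) - grid b n j)))) {0..b}" for n
    unfolding grid_approx_def
  proof (intro has_integral_add has_integral_sum has_integral_mult_right has_integral_diff ind)
    fix j assume "j \<in> {..<Suc n}"
    then have "j \<le> n" by simp
    then have "real j * b \<le> real (Suc n) * b" "real (Suc j) * b \<le> real (Suc n) * b"
      using b by (auto intro!: mult_right_mono simp del: of_nat_Suc simp: of_nat_le_iff)
    then show "grid b n (Suc j) \<le> b" "grid b n j \<le> b"
      by (simp_all add: field_simps)
  qed (use b in auto)
  have lim: "(\<lambda>n. grid_approx b n x u) \<longlonglongrightarrow> x u" if "u \<in> {0..b}" for u
    by (rule grid_approx_tendsto[OF b rc that])
  have dc: "x integrable_on {0..b}" "(\<lambda>n. integral {0..b} (grid_approx b n x)) \<longlonglongrightarrow> integral {0..b} x"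
  proof (atomize (full), intro conjI)
    have 1: "\<And>n. grid_approx b n x integrable_on {0..b}" using gr by blast
    have 2: "(\<lambda>_. B) integrable_on {0..b}" by (rule integrable_const_ivl)
    have 3: "norm (grid_approx b n x u) \<le> B" if "u \<in> {0..b}" for n u
      using grid_approx_bounded[OF B that b] by simp
    show "x integrable_on {0..b}" by (rule dominated_convergence(1)[OF 1 2 3 lim])
    show "(\<lambda>n. integral {0..b} (grid_approx b n x)) \<longlonglongrightarrow> integral {0..b} x"
      by (rule dominated_convergence(2)[OF 1 2 3 lim])
  qed
  show "x integrable_on {0..b}" by (rule dc)
  have "integral {0..b} (grid_approx b n x) = (\<Sum>j<Suc n. b / real (Suc n) * x (grid b n (Suc j)))" for n
  proof -
    have "grid b n (Suc j) - grid b n j = b / real (Suc n)" for j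
      unfolding diff_divide_distrib[symmetric] left_diff_distrib[symmetric] by simp
    then show ?thesis using integral_unique[OF gr[of n]] by (simp add: mult.commute del: of_nat_Suc lessThan_Suc sum.lessThan_Suc)
  qed
  then show "(\<lambda>n. \<Sum>j<Suc n. b / real (Suc n) * x (grid b n (Suc j))) \<longlonglongrightarrow> integral {0..b} x"
    using dc(2) by simp
qed

section \<open>The Stieltjes functional on special functions\<close>

context finite_variation_function
begin

lemma bounded_Borel_on_atMost: "bounded_Borel_on T (indicator {..u})"
  unfolding bounded_Borel_on_def by (auto simp: indicator_def intro!: exI[of _ 1])

lemma bounded_on_ext: obtains K where "\<And>u. 0 \<le> u \<Longrightarrow> \<bar>g (min u T)\<bar> \<le> K"
proof -
  obtain K where K: "\<And>f B. bounded_Borel_on T f \<Longrightarrow> (\<And>t. t \<in> {0..T} \<Longrightarrow> \<bar>f t\<bar> \<le> B) \<Longrightarrow> \<bar>\<Lambda> f\<bar> \<le> K * B"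
    by (rule Stieltjes_bounded) blast
  have "\<bar>g (min u T)\<bar> \<le> K" if "0 \<le> u" for u
    using K[OF bounded_Borel_on_atMost, of u 1] Stieltjes_atMost[OF that] by (simp add: indicator_def)
  then show ?thesis using that by blast
qed

lemma ext_eq_right_cont: "0 \<le> t \<Longrightarrow> continuous (at_right t) (\<lambda>u. g (min u T))"
proof -
  assume t: "0 \<le> t"
  have "(ext \<longlongrightarrow> ext t) (at_right t)" using ext_right_cont[of t] by (simp add: continuous_within)
  moreover have "eventually (\<lambda>s. ext s = g (min s T)) (at_right t)"
    by (rule eventually_mono[OF eventually_right_less[of t "t+1"]]) (use t in \<open>auto simp: ext_simps\<close>)
  ultimately have "((\<lambda>u. g (min u T)) \<longlongrightarrow> ext t) (at_right t)" by (rule Lim_transform_eventually)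
  then show ?thesis using t by (simp add: continuous_within ext_simps)
qed

text \<open>The ramp at \<open>u\<close> is the integral of \<open>indicator {..s} u\<close> over
  \<open>s\<close> in [0, b]; interchanging this with the functional, on the level of Riemann sums,
  leaves an integral of \<open>g\<close>. This continuous test function is how weak-star convergence
  controls integrals of paths. \<open>b\<close> may exceed \<open>T\<close>, with \<open>g\<close>
  continued constantly.\<close>

lemma Stieltjes_ramp:
  assumes "0 \<le> b"
  shows "(\<lambda>u. g (min u T)) integrable_on {0..b}"
    and "\<Lambda> (\<lambda>u. max 0 (b - u)) = integral {0..b} (\<lambda>u. g (min u T))"
proof -
  obtain K where K: "\<And>u. 0 \<le> u \<Longrightarrow> \<bar>g (min u T)\<bar> \<le> K" by (rule bounded_on_ext) blast
  have "(\<lambda>u. g (min u T)) integrable_on {0..b} \<and> \<Lambda> (\<lambda>u. max 0 (b - u)) = integral {0..b} (\<lambda>u. g (min u T))"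
  proof (cases "b = 0")
    case True
    have "\<Lambda> (\<lambda>u. max 0 (b - u)) = \<Lambda> (\<lambda>u. 0)" by (rule Stieltjes_cong) (use True in auto)
    then show ?thesis using True by (simp add: Stieltjes_zero integrable_negligible)
  next
    case False
    then have b: "b > 0" using assms by simp
    define F where "F n u = (\<Sum>j<Suc n. b / real (Suc n) * indicator {..grid b n (Suc j)} u)" for n :: nat and u :: real
    have lim: "(\<lambda>n. F n u) \<longlonglongrightarrow> max 0 (b - u)" if u: "0 \<le> u" for u
    proof -
      have rc: "continuous (at_right t) (indicator {u..} :: real \<Rightarrow> real)" for t
      proof -
        have "eventually (\<lambda>s. indicator {u..} s = (indicator {u..} t :: real)) (at_right t)"
        proof (cases "t < u")
          case True
          show ?thesis by (rule eventually_mono[OF eventually_right_less[OF True]]) (use True in \<open>auto simp: indicator_def\<close>)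
        next
          case False
          show ?thesis by (rule eventually_mono[OF eventually_right_less[of t "t+1"]]) (use False in \<open>auto simp: indicator_def\<close>)
        qed
        then show ?thesis unfolding continuous_within by (rule tendsto_eventually)
      qed
      have "(\<lambda>n. \<Sum>j<Suc n. b / real (Suc n) * indicator {u..} (grid b n (Suc j))) \<longlonglongrightarrow> integral {0..b} (indicator {u..} :: real \<Rightarrow> real)"
        by (rule Riemann_sums(2)[OF b rc, where B = 1]) (auto simp: indicator_def)
      moreover have "integral {0..b} (indicator {u..} :: real \<Rightarrow> real) = max 0 (b - u)"
      proof (cases "u \<le> b")
        case True
        have "((\<lambda>_. 1::real) has_integral (b - u)) {u..b}" using has_integral_const_real[of "1::real" u b] True by simp
        then have "((\<lambda>s. if s \<in> {u..b} then 1 else 0::real) has_integral (b - u)) {0..b}"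
          using has_integral_restrict[of "{u..b}" "{0..b}" "\<lambda>_. 1::real" "b - u"] u by simp
        then have "(indicator {u..} has_integral (b - u)) {0..b}" by (rule has_integral_eq[rotated]) (auto simp: indicator_def)
        then show ?thesis using True by (simp add: integral_unique)
      next
        case False
        have "integral {0..b} (indicator {u..} :: real \<Rightarrow> real) = integral {0..b} (\<lambda>_. 0)"
          by (rule integral_cong) (use False in \<open>auto simp: indicator_def\<close>)
        then show ?thesis using False by simp
      qed
      moreover have "indicator {u..} v = (indicator {..v} u :: real)" for v by (auto simp: indicator_def)
      ultimately show ?thesis unfolding F_def by simp
    qed
    have "\<bar>F n u\<bar> \<le> b" for n u
    proof -
      have "\<bar>F n u\<bar> \<le> (\<Sum>j<Suc n. b / real (Suc n))"
        unfolding F_def by (rule order_trans[OF sum_abs sum_mono]) (use b in \<open>auto simp: indicator_def\<close>)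
      then show ?thesis by simp
    qed
    moreover have "F n \<in> borel_measurable borel" for n unfolding F_def by measurable
    ultimately have 1: "(\<lambda>n. \<Lambda> (F n)) \<longlonglongrightarrow> \<Lambda> (\<lambda>u. max 0 (b - u))"
      by (intro Stieltjes_dominated_convergence[where B = b] lim) auto
    have "\<Lambda> (F n) = (\<Sum>j<Suc n. b / real (Suc n) * g (min (grid b n (Suc j)) T))" for n
    proof -
      have "\<Lambda> (F n) = (\<Sum>j<Suc n. b / real (Suc n) * \<Lambda> (indicator {..grid b n (Suc j)}))"
        unfolding F_def by (rule Stieltjes_sum) (auto intro: bounded_Borel_on_atMost)
      then show ?thesis using b by (simp add: Stieltjes_atMost del: of_nat_Suc lessThan_Suc sum.lessThan_Suc)
    qed
    moreover have rs: "(\<lambda>u. g (min u T)) integrable_on {0..b}"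
      "(\<lambda>n. \<Sum>j<Suc n. b / real (Suc n) * g (min (grid b n (Suc j)) T)) \<longlonglongrightarrow> integral {0..b} (\<lambda>u. g (min u T))"
    proof -
      have rc: "continuous (at_right t) (\<lambda>u. g (min u T))" if "0 \<le> t" "t < b" for t
        by (rule ext_eq_right_cont[OF that(1)])
      have bd: "\<bar>g (min t T)\<bar> \<le> K" if "t \<in> {0..b}" for t using that by (intro K) simp
      show "(\<lambda>u. g (min u T)) integrable_on {0..b}" by (rule Riemann_sums(1)[OF b rc bd])
      show "(\<lambda>n. \<Sum>j<Suc n. b / real (Suc n) * g (min (grid b n (Suc j)) T)) \<longlonglongrightarrow> integral {0..b} (\<lambda>u. g (min u T))"
        by (rule Riemann_sums(2)[OF b rc bd])
    qed
    ultimately have "(\<lambda>n. \<Lambda> (F n)) \<longlonglongrightarrow> integral {0..b} (\<lambda>u. g (min u T))" by (simp only:)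
    then show ?thesis using LIMSEQ_unique[OF 1] rs(1) by blast
  qed
  then show "(\<lambda>u. g (min u T)) integrable_on {0..b}" "\<Lambda> (\<lambda>u. max 0 (b - u)) = integral {0..b} (\<lambda>u. g (min u T))"
    by blast+
qed

text \<open>These Riemann-Stieltjes sums are the values of the functional at
  \<open>grid_approx T n f\<close>, which tends to \<open>f\<close> boundedly. The leading term
  \<open>f 0 * g 0\<close> is the atom at 0.\<close>

lemma Stieltjes_grid:
  assumes f: "continuous_on {0..T} f"
  shows "(\<lambda>n. f 0 * g 0 + (\<Sum>j<Suc n. f (grid T n (Suc j)) *
      (g (grid T n (Suc j)) - g (grid T n j)))) \<longlonglongrightarrow> \<Lambda> f"
proof -
  have "\<exists>B. \<forall>t\<in>{0..T}. \<bar>f t\<bar> \<le> B"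
    using compact_imp_bounded[OF compact_continuous_image[OF f compact_Icc]] unfolding bounded_iff by auto
  then obtain B where B: "\<And>t. t \<in> {0..T} \<Longrightarrow> \<bar>f t\<bar> \<le> B" by blast
  have rc: "continuous (at_right t) f" if "0 \<le> t" "t < T" for t
  proof -
    have "continuous (at t within {0..T}) f" using f that unfolding continuous_on_eq_continuous_within by auto
    then have "continuous (at t within {t..T}) f" by (rule continuous_within_subset) (use that in auto)
    then show ?thesis by (simp add: continuous_within at_within_Icc_at_right[OF that(2)])
  qed
  \<comment> \<open>A continuous extension of \<open>f\<close> to the whole line, so that the limit
    function in the dominated convergence is Borel.\<close>
  define h where "h t = f (max 0 (min t T))" for t
  have "continuous_on UNIV h" unfolding h_def
    by (rule continuous_on_compose2[OF f]) (use T_pos in \<open>auto intro!: continuous_intros\<close>)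
  then have h: "h \<in> borel_measurable borel" by (rule borel_measurable_continuous_onI)
  have hf: "h t = f t" if "t \<in> {0..T}" for t using that unfolding h_def by auto
  have "(\<lambda>n. \<Lambda> (grid_approx T n f)) \<longlonglongrightarrow> \<Lambda> h"
  proof (rule Stieltjes_dominated_convergence[where B = B])
    show "grid_approx T n f \<in> borel_measurable borel" for n unfolding grid_approx_def by measurable
    show "\<bar>grid_approx T n f t\<bar> \<le> B" if "t \<in> {0..T}" for n t by (rule grid_approx_bounded[OF B that T_pos])
    show "(\<lambda>n. grid_approx T n f t) \<longlonglongrightarrow> h t" if "t \<in> {0..T}" for t
      unfolding hf[OF that] by (rule grid_approx_tendsto[OF T_pos rc that])
  qed (rule h)
  moreover have "\<Lambda> h = \<Lambda> f" by (rule Stieltjes_cong) (rule hf)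
  moreover have "\<Lambda> (grid_approx T n f) = f 0 * g 0 + (\<Sum>j<Suc n. f (grid T n (Suc j)) *
      (g (grid T n (Suc j)) - g (grid T n j)))" for n
  proof -
    have bd: "bounded_Borel_on T (\<lambda>t. indicator {..p} t - indicator {..q} t)" for p q
      unfolding bounded_Borel_on_def by (auto simp: indicator_def intro!: exI[of _ 1])
    have diff: "\<Lambda> (\<lambda>t. indicator {..p} t - indicator {..q} t) = g p - g q" if "0 \<le> p" "p \<le> T" "0 \<le> q" "q \<le> T" for p q
    proof -
      have m: "bounded_Borel_on T (\<lambda>t. - 1 * indicator {..q} t)"
        unfolding bounded_Borel_on_def by (auto simp: indicator_def intro!: exI[of _ 1])
      have "\<Lambda> (\<lambda>t. indicator {..p} t + (- 1) * indicator {..q} t) = g p + (- 1) * g q"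
        using Stieltjes_add[OF bounded_Borel_on_atMost m] Stieltjes_mult[of "-1" "indicator {..q}"]
          Stieltjes_atMost that by simp
      then show ?thesis by simp
    qed
    have le: "grid T n j \<le> T" if "j \<le> Suc n" for j
    proof -
      have "real j * T \<le> real (Suc n) * T" using T_pos that by (intro mult_right_mono) auto
      then show ?thesis by (simp add: field_simps)
    qed
    have "\<Lambda> (grid_approx T n f) = \<Lambda> (\<lambda>t. f 0 * indicator {..0} t) + \<Lambda> (\<lambda>t. \<Sum>j<Suc n. f (grid T n (Suc j)) *
        (indicator {..grid T n (Suc j)} t - indicator {..grid T n j} t))"
      unfolding grid_approx_def
    proof (rule Stieltjes_add)
      have cm: "bounded_Borel_on T (\<lambda>t. c * (indicator {..p} t - indicator {..q} t))" for p q c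
        unfolding bounded_Borel_on_def by (auto simp: indicator_def intro!: exI[of _ "\<bar>c\<bar>"])
      show "bounded_Borel_on T (\<lambda>t. f 0 * indicator {..0} t)"
        unfolding bounded_Borel_on_def by (auto simp: indicator_def intro!: exI[of _ "\<bar>f 0\<bar>"])
      show "bounded_Borel_on T (\<lambda>t. \<Sum>j<Suc n. f (grid T n (Suc j)) *
        (indicator {..grid T n (Suc j)} t - indicator {..grid T n j} t))"
        by (intro bounded_Borel_on_sum cm) auto
    qed
    also have "\<Lambda> (\<lambda>t. f 0 * indicator {..0} t) = f 0 * g 0"
      using Stieltjes_mult Stieltjes_atMost[of 0] T_pos by (simp add: min_absorb1)
    also have "\<Lambda> (\<lambda>t. \<Sum>j<Suc n. f (grid T n (Suc j)) *
        (indicator {..grid T n (Suc j)} t - indicator {..grid T n j} t))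
       = (\<Sum>j<Suc n. f (grid T n (Suc j)) *
      (g (grid T n (Suc j)) - g (grid T n j)))"
    proof (subst Stieltjes_sum)
      show "(\<Sum>j<Suc n. f (grid T n (Suc j)) *
        \<Lambda> (\<lambda>t. indicator {..grid T n (Suc j)} t - indicator {..grid T n j} t))
       = (\<Sum>j<Suc n. f (grid T n (Suc j)) *
      (g (grid T n (Suc j)) - g (grid T n j)))"
      proof (rule sum.cong[OF refl])
        fix j assume "j \<in> {..<Suc n}"
        then have "j \<le> Suc n" "Suc j \<le> Suc n" by auto
        then show "f (grid T n (Suc j)) *
        \<Lambda> (\<lambda>t. indicator {..grid T n (Suc j)} t - indicator {..grid T n j} t)
       = f (grid T n (Suc j)) *
      (g (grid T n (Suc j)) - g (grid T n j))"
          using T_pos by (subst diff) (auto intro!: le simp del: of_nat_Suc)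
      qed
    qed (auto intro: bd)
    finally show ?thesis .
  qed
  ultimately show ?thesis by simp
qed

end

section \<open>Step functions\<close>

text \<open>Jump times may be unordered and may coincide, as limits of distinct jump times can
  merge.\<close>

definition step_function :: "nat \<Rightarrow> (nat \<Rightarrow> real) \<Rightarrow> (nat \<Rightarrow> real) \<Rightarrow> real \<Rightarrow> real" where
  "step_function m \<tau> d t = (\<Sum>j<m. d j * indicator {..t} (\<tau> j))"

lemma step_function_right_cont: "continuous (at_right t) (step_function m \<tau> d)"
proof -
  have "((\<lambda>s. indicator {..s} c) \<longlongrightarrow> (indicator {..t} c :: real)) (at_right t)" for c
  proof (rule tendsto_eventually)
    show "eventually (\<lambda>s. indicator {..s} c = (indicator {..t} c :: real)) (at_right t)"
    proof (cases "t < c")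
      case True
      show ?thesis by (rule eventually_at_rightI[OF _ True]) (use True in \<open>auto simp: indicator_def\<close>)
    next
      case False
      show ?thesis by (rule eventually_at_rightI[of t "t+1"]) (use False in \<open>auto simp: indicator_def\<close>)
    qed
  qed
  then show ?thesis unfolding continuous_within step_function_def by (intro tendsto_sum tendsto_mult tendsto_const)
qed

lemma finite_variation_step_function:
  assumes "0 < T"
  shows "finite_variation T (step_function m \<tau> d)"
  unfolding finite_variation_def
proof (intro conjI ballI step_function_right_cont)
  \<comment> \<open>The same jumps with absolute sizes give a majorant of the increments.\<close>
  define U where "U = step_function m \<tau> (\<lambda>j. \<bar>d j\<bar>)"
  have "x \<le> U T - U 0" if "x \<in> variation_sums T (step_function m \<tau> d)" for x
  proof (rule variation_sums_le_majorant[OF that])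
    fix s t :: real assume "0 \<le> s" "s \<le> t" "t \<le> T"
    have "step_function m \<tau> d t - step_function m \<tau> d s = (\<Sum>j<m. d j * (indicator {..t} (\<tau> j) - indicator {..s} (\<tau> j)))"
      unfolding step_function_def by (simp add: sum_subtractf right_diff_distrib)
    also have "\<bar>\<dots>\<bar> \<le> (\<Sum>j<m. \<bar>d j\<bar> * (indicator {..t} (\<tau> j) - indicator {..s} (\<tau> j)))"
      by (rule order_trans[OF sum_abs sum_mono]) (use \<open>s \<le> t\<close> in \<open>auto simp: indicator_def\<close>)
    also have "\<dots> = U t - U s" unfolding U_def step_function_def by (simp add: sum_subtractf right_diff_distrib)
    finally show "\<bar>step_function m \<tau> d t - step_function m \<tau> d s\<bar> \<le> U t - U s" .
  qed (use assms in simp)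
  then show "bdd_above (variation_sums T (step_function m \<tau> d))" unfolding bdd_above_def by blast
qed

text \<open>Interchanging the sums over jumps and over grid points turns the Riemann-Stieltjes sums
  into values of \<open>grid_approx\<close> at the jump times. These tend to \<open>f\<close> up to
  \<open>T\<close> and are 0 beyond it.\<close>

lemma Stieltjes_step_function:
  assumes T: "0 < T" and \<tau>: "\<And>j. j < m \<Longrightarrow> 0 \<le> \<tau> j" and f: "continuous_on {0..T} f"
  shows "Stieltjes_functional T (step_function m \<tau> d) f = (\<Sum>j<m. if \<tau> j \<le> T then d j * f (\<tau> j) else 0)"
proof -
  interpret finite_variation_function T "step_function m \<tau> d"
    by standard (use T finite_variation_step_function in auto)
  let ?g = "step_function m \<tau> d"
  have rc: "continuous (at_right t) f" if "0 \<le> t" "t < T" for t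
  proof -
    have "continuous (at t within {0..T}) f" using f that unfolding continuous_on_eq_continuous_within by auto
    then have "continuous (at t within {t..T}) f" by (rule continuous_within_subset) (use that in auto)
    then show ?thesis by (simp add: continuous_within at_within_Icc_at_right[OF that(2)])
  qed
  have eq: "f 0 * ?g 0 + (\<Sum>j<Suc n. f (grid T n (Suc j)) *
      (?g (grid T n (Suc j)) - ?g (grid T n j))) = (\<Sum>i<m. d i * grid_approx T n f (\<tau> i))" for n
  proof -
    have "(\<Sum>i<m. d i * grid_approx T n f (\<tau> i)) = (\<Sum>i<m. d i * (f 0 * indicator {..0} (\<tau> i))) +
       (\<Sum>i<m. \<Sum>j<Suc n. d i * (f (grid T n (Suc j)) *
        (indicator {..grid T n (Suc j)} (\<tau> i) - indicator {..grid T n j} (\<tau> i))))"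
      unfolding grid_approx_def by (simp only: distrib_left sum.distrib sum_distrib_left)
    also have "\<dots> = (\<Sum>i<m. d i * (f 0 * indicator {..0} (\<tau> i))) +
       (\<Sum>j<Suc n. \<Sum>i<m. d i * (f (grid T n (Suc j)) *
        (indicator {..grid T n (Suc j)} (\<tau> i) - indicator {..grid T n j} (\<tau> i))))"
      by (subst (2) sum.swap) (rule refl)
    also have "(\<Sum>i<m. d i * (f 0 * indicator {..0} (\<tau> i))) = f 0 * ?g 0"
      unfolding step_function_def sum_distrib_left by (intro sum.cong) auto
    also have "(\<Sum>j<Suc n. \<Sum>i<m. d i * (f (grid T n (Suc j)) *
        (indicator {..grid T n (Suc j)} (\<tau> i) - indicator {..grid T n j} (\<tau> i))))
      = (\<Sum>j<Suc n. f (grid T n (Suc j)) *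
      (?g (grid T n (Suc j)) - ?g (grid T n j)))"
      unfolding step_function_def sum_subtractf[symmetric] sum_distrib_left
      by (intro sum.cong refl) (simp add: algebra_simps)
    finally show ?thesis by simp
  qed
  have "(\<lambda>n. d i * grid_approx T n f (\<tau> i)) \<longlonglongrightarrow> (if \<tau> i \<le> T then d i * f (\<tau> i) else 0)" if "i < m" for i
  proof (cases "\<tau> i \<le> T")
    case True
    then show ?thesis using grid_approx_tendsto[OF T rc, of "\<tau> i"] \<tau>[OF that] by (auto intro: tendsto_mult_left)
  next
    case False
    then show ?thesis using grid_approx_greater[of T "\<tau> i"] T by simp
  qed
  then have "(\<lambda>n. \<Sum>i<m. d i * grid_approx T n f (\<tau> i)) \<longlonglongrightarrow> (\<Sum>i<m. if \<tau> i \<le> T then d i * f (\<tau> i) else 0)"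
    by (intro tendsto_sum) auto
  moreover have "(\<lambda>n. \<Sum>i<m. d i * grid_approx T n f (\<tau> i)) \<longlonglongrightarrow> Stieltjes_functional T ?g f"
    using Stieltjes_grid[OF f] unfolding eq .
  ultimately show ?thesis using LIMSEQ_unique by blast
qed

section \<open>Weak-star convergent sequences have bounded oscillation\<close>

text \<open>The functions of the first Baire class on the line.\<close>

definition limit_of_continuous :: "(real \<Rightarrow> real) \<Rightarrow> bool" where
  "limit_of_continuous f \<longleftrightarrow>
     (\<exists>h. (\<forall>k::nat. continuous_on UNIV (h k)) \<and> (\<forall>t. (\<lambda>k. h k t) \<longlonglongrightarrow> f t))"

lemma limit_of_continuous_const: "limit_of_continuous (\<lambda>_. c)"
  unfolding limit_of_continuous_def by (intro exI[of _ "\<lambda>_ _. c"]) simp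

lemma limit_of_continuous_add:
  assumes "limit_of_continuous f" "limit_of_continuous g"
  shows "limit_of_continuous (\<lambda>t. f t + c * g t)"
proof -
  obtain h k where "\<And>n::nat. continuous_on UNIV (h n)" "\<And>t. (\<lambda>n. h n t) \<longlonglongrightarrow> f t"
    "\<And>n::nat. continuous_on UNIV (k n)" "\<And>t. (\<lambda>n. k n t) \<longlonglongrightarrow> g t"
    using assms unfolding limit_of_continuous_def by metis
  then show ?thesis unfolding limit_of_continuous_def
    by (intro exI[of _ "\<lambda>n t. h n t + c * k n t"]) (auto intro!: continuous_intros tendsto_intros)
qed

lemma limit_of_continuous_atMost: "limit_of_continuous (indicator {..u})"
proof -
  have "(\<lambda>k. max 0 (1 - real k * max 0 (t - u))) \<longlonglongrightarrow> indicator {..u} t" for t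
  proof (cases "t \<le> u")
    case False
    obtain N where N: "real N * (t - u) > 1" using reals_Archimedean3[of "t - u"] False by auto
    have "max 0 (1 - real k * max 0 (t - u)) = 0" if "k \<ge> N" for k
    proof -
      have "real N * (t - u) \<le> real k * (t - u)" using that False by (intro mult_right_mono) auto
      then have "1 - real k * (t - u) \<le> 0" using N by linarith
      then show ?thesis using False by simp
    qed
    then have "(\<lambda>k. max 0 (1 - real k * max 0 (t - u))) \<longlonglongrightarrow> 0"
      by (intro tendsto_eventually) (auto simp: eventually_sequentially)
    then show ?thesis using False by (simp add: indicator_def)
  qed (simp add: indicator_def)
  then show ?thesis unfolding limit_of_continuous_def
    by (intro exI[of _ "\<lambda>k t. max 0 (1 - real k * max 0 (t - u))"]) (auto intro!: continuous_intros)
qed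

text \<open>Uniform boundedness on the Banach space of bounded continuous functions; the bound passes to
  indicators of intervals, which are limits of continuous functions but not continuous themselves.\<close>
lemma weak_star_bounded:
  assumes T: "0 < T" and fv: "\<And>n. finite_variation T (\<nu> n)" and ws: "weak_star_converges T \<nu> \<nu>0"
  obtains C where "\<And>n f. limit_of_continuous f \<Longrightarrow> (\<And>t. \<bar>f t\<bar> \<le> 1) \<Longrightarrow> \<bar>Stieltjes_functional T (\<nu> n) f\<bar> \<le> C"
proof -
  have fvf: "finite_variation_function T (\<nu> n)" for n by standard (use T fv in auto)
  define L where "L n h = Stieltjes_functional T (\<nu> n) (apply_bcontfun h)" for n and h :: "real \<Rightarrow>\<^sub>C real"
  have bB: "bounded_Borel_on T (apply_bcontfun h)" for h :: "real \<Rightarrow>\<^sub>C real"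
  proof -
    have "continuous_on UNIV (apply_bcontfun h)" by (rule continuous_on_apply_bcontfun)
    then show ?thesis unfolding bounded_Borel_on_def
      using norm_bounded[of h] by (auto intro: borel_measurable_continuous_onI)
  qed
  have lin: "bounded_linear (L n)" for n
  proof -
    obtain K where K: "\<And>f B. bounded_Borel_on T f \<Longrightarrow> (\<And>t. t \<in> {0..T} \<Longrightarrow> \<bar>f t\<bar> \<le> B) \<Longrightarrow> \<bar>Stieltjes_functional T (\<nu> n) f\<bar> \<le> K * B"
      using finite_variation_function.Stieltjes_bounded[OF fvf] by metis
    show ?thesis
    proof (rule bounded_linear_intro[where K = K])
      show "L n (h + h') = L n h + L n h'" for h h'
        using finite_variation_function.Stieltjes_add[OF fvf bB bB] unfolding L_def by (simp add: plus_bcontfun.rep_eq)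
      show "L n (c *\<^sub>R h) = c *\<^sub>R L n h" for c h
        using finite_variation_function.Stieltjes_mult[OF fvf] unfolding L_def by (simp add: scaleR_bcontfun.rep_eq)
      show "norm (L n h) \<le> norm h * K" for h
        using K[OF bB, of h "norm h"] norm_bounded[of h] unfolding L_def by (simp add: mult.commute)
    qed
  qed
  define A where "A m = {h. \<forall>n. \<bar>L n h\<bar> \<le> real m}" for m
  have closed: "closed (A m)" for m
  proof -
    have "A m = (\<Inter>n. {h. \<bar>L n h\<bar> \<le> real m})" unfolding A_def by auto
    moreover have "closed {h. \<bar>L n h\<bar> \<le> real m}" for n
      by (intro closed_Collect_le continuous_on_rabs linear_continuous_on lin continuous_on_const)
    ultimately show ?thesis by auto
  qed
  have cover: "\<exists>m. h \<in> A m" for h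
  proof -
    have "continuous_on {0..T} (apply_bcontfun h)"
      using continuous_on_apply_bcontfun continuous_on_subset by blast
    then have "(\<lambda>n. L n h) \<longlonglongrightarrow> Stieltjes_functional T \<nu>0 (apply_bcontfun h)"
      using ws unfolding weak_star_converges_def L_def by blast
    then have "Bseq (\<lambda>n. L n h)" by (intro convergent_imp_Bseq convergentI)
    then obtain b where b: "\<And>n. \<bar>L n h\<bar> \<le> b" unfolding Bseq_def by auto
    obtain m :: nat where "b \<le> real m" using real_arch_simple by blast
    then have "h \<in> A m" unfolding A_def using b order_trans by blast
    then show ?thesis by blast
  qed
  have "\<exists>m. interior (A m) \<noteq> {}"
  proof (rule ccontr)
    assume "\<nexists>m. interior (A m) \<noteq> {}"
    then have "euclidean interior_of \<Union>(range A) = {}"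
      using closed by (intro Baire_category_alt) (auto simp: completely_metrizable_space_euclidean)
    moreover have "\<Union>(range A) = UNIV" using cover by auto
    ultimately show False by simp
  qed
  then obtain m h0 r where r: "r > 0" "ball h0 r \<subseteq> A m"
    by (meson ex_in_conv mem_interior)
  have L1: "\<bar>L n h\<bar> \<le> 4 * real m / r" if h: "norm h \<le> 1" for n h
  proof -
    have "norm ((r/2) *\<^sub>R h) \<le> r / 2" using h r(1) by simp
    then have "h0 + (r/2) *\<^sub>R h \<in> ball h0 r" "h0 \<in> ball h0 r" using r(1) by (auto simp: dist_norm)
    then have "\<bar>L n (h0 + (r/2) *\<^sub>R h)\<bar> \<le> real m" "\<bar>L n h0\<bar> \<le> real m" using r(2) unfolding A_def by blast+
    moreover have "L n (h0 + (r/2) *\<^sub>R h) = L n h0 + (r/2) * L n h"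
      using lin[of n] by (simp add: bounded_linear.linear linear_add linear_scale)
    ultimately have "\<bar>(r/2) * L n h\<bar> \<le> 2 * real m" by linarith
    then show ?thesis using r(1) by (simp add: abs_mult field_simps)
  qed
  have "\<bar>Stieltjes_functional T (\<nu> n) f\<bar> \<le> 4 * real m / r" if f: "limit_of_continuous f" "\<And>t. \<bar>f t\<bar> \<le> 1" for n f
  proof -
    obtain k where k: "\<And>j::nat. continuous_on UNIV (k j)" "\<And>t. (\<lambda>j. k j t) \<longlonglongrightarrow> f t"
      using f(1) unfolding limit_of_continuous_def by blast
    \<comment> \<open>Truncation puts the approximants into the unit ball, where the uniform bound
      applies, and leaves the limit \<open>f\<close> unchanged.\<close>
    define c where "c j t = max (-1) (min 1 (k j t))" for j t
    have c_cont: "continuous_on UNIV (c j)" for j unfolding c_def by (intro continuous_intros k)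
    have c_bd: "\<bar>c j t\<bar> \<le> 1" for j t unfolding c_def by auto
    have "(\<lambda>j. c j t) \<longlonglongrightarrow> max (-1) (min 1 (f t))" for t unfolding c_def by (intro tendsto_intros k)
    moreover have "max (-1) (min 1 (f t)) = f t" for t using f(2)[of t] by auto
    ultimately have c_lim: "(\<lambda>j. c j t) \<longlonglongrightarrow> f t" for t by metis
    have c_meas: "c j \<in> borel_measurable borel" for j by (rule borel_measurable_continuous_onI[OF c_cont])
    have "c j \<in> bcontfun" for j unfolding bcontfun_def using c_cont c_bd by (auto simp: bounded_iff)
    then have inv: "apply_bcontfun (Bcontfun (c j)) = c j" for j by (rule Bcontfun_inverse)
    then have "norm (Bcontfun (c j)) \<le> 1" for j using c_bd by (intro norm_bound) auto
    then have le: "\<bar>Stieltjes_functional T (\<nu> n) (c j)\<bar> \<le> 4 * real m / r" for j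
      using L1[of "Bcontfun (c j)" n] unfolding L_def inv by blast
    have "f \<in> borel_measurable borel" by (rule borel_measurable_LIMSEQ_real[OF c_lim c_meas])
    then have "(\<lambda>j. Stieltjes_functional T (\<nu> n) (c j)) \<longlonglongrightarrow> Stieltjes_functional T (\<nu> n) f"
      by (intro finite_variation_function.Stieltjes_dominated_convergence[OF fvf, where B = 1] c_meas c_bd c_lim)
    then show ?thesis using le by (intro LIMSEQ_le_const2[OF tendsto_rabs]) auto
  qed
  then show ?thesis using that by blast
qed

text \<open>\<open>oscillates x \<eta> j t\<close>: there are \<open>j\<close> disjoint pairs \<open>s\<^sub>1 < u\<^sub>1 < s\<^sub>2 < u\<^sub>2 < \<dots> < u\<^sub>j\<close> in \<open>(0, t]\<close>
  with \<open>\<bar>x u\<^sub>i - x s\<^sub>i\<bar> > \<eta>\<close>.\<close>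
primrec oscillates :: "(real \<Rightarrow> real) \<Rightarrow> real \<Rightarrow> nat \<Rightarrow> real \<Rightarrow> bool" where
  "oscillates x \<eta> 0 t \<longleftrightarrow> 0 \<le> t"
| "oscillates x \<eta> (Suc j) t \<longleftrightarrow>
     (\<exists>t' s u. oscillates x \<eta> j t' \<and> t' < s \<and> s < u \<and> u \<le> t \<and> \<eta> < \<bar>x u - x s\<bar>)"

lemma oscillates_later: "oscillates x \<eta> j t \<Longrightarrow> t \<le> t2 \<Longrightarrow> oscillates x \<eta> j t2"
  by (cases j) (auto, meson order_trans)

lemma oscillates_nonneg: "oscillates x \<eta> j t \<Longrightarrow> 0 \<le> t"
  by (induction j arbitrary: t) (auto, fastforce)

lemma oscillates_less: "oscillates x \<eta> k t \<Longrightarrow> j \<le> k \<Longrightarrow> oscillates x \<eta> j t"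
proof (induction k)
  case (Suc k)
  have "oscillates x \<eta> k t" using Suc.prems(1) by (auto intro: oscillates_later)
  then show ?case using Suc by (cases "j = Suc k") auto
qed simp

lemma oscillates_perturb:
  assumes "\<And>u. 0 \<le> u \<Longrightarrow> u \<le> t \<Longrightarrow> \<bar>x u - y u\<bar> \<le> e"
  shows "oscillates x (\<eta> + 2 * e) j t \<Longrightarrow> oscillates y \<eta> j t"
  using assms
proof (induction j arbitrary: t)
  case (Suc j)
  then obtain t' s u where *: "oscillates x (\<eta> + 2 * e) j t'" "t' < s" "s < u" "u \<le> t" "\<eta> + 2 * e < \<bar>x u - x s\<bar>"
    by auto
  have t': "0 \<le> t'" using *(1) by (rule oscillates_nonneg)
  have "oscillates y \<eta> j t'" using * by (intro Suc.IH Suc.prems(2)) auto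
  moreover have "\<bar>x u - y u\<bar> \<le> e" "\<bar>x s - y s\<bar> \<le> e" using Suc.prems(2) * t' by auto
  then have "\<eta> < \<bar>y u - y s\<bar>" using *(5) by linarith
  ultimately show ?case using * by auto
qed simp

lemma oscillates_cong:
  assumes "\<And>u. 0 \<le> u \<Longrightarrow> u \<le> t \<Longrightarrow> x u = y u"
  shows "oscillates x \<eta> j t \<longleftrightarrow> oscillates y \<eta> j t"
  using oscillates_perturb[of t x y 0 \<eta> j] oscillates_perturb[of t y x 0 \<eta> j] assms by auto

text \<open>\<open>f\<close> is a signed sum of indicators of the disjoint intervals
  \<open>(s\<^sub>i, u\<^sub>i]\<close>, with signs that make the functional add up the absolute
  increments of \<open>g\<close>. Vanishing beyond \<open>t\<close> is carried along so that the
  next interval does not overlap and \<open>\<bar>f v\<bar> \<le> 1\<close> persists.\<close>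

lemma (in finite_variation_function) oscillates_test_function:
  assumes "oscillates (\<lambda>u. g (min u T)) \<eta> j t"
  shows "\<exists>f. limit_of_continuous f \<and> f \<in> borel_measurable borel \<and> (\<forall>v. \<bar>f v\<bar> \<le> 1) \<and> (\<forall>v>t. f v = 0) \<and> real j * \<eta> \<le> \<Lambda> f"
  using assms
proof (induction j arbitrary: t)
  case 0
  show ?case by (intro exI[of _ "\<lambda>_. 0"]) (auto simp: limit_of_continuous_const Stieltjes_zero)
next
  case (Suc j)
  then obtain t' s u where *: "oscillates (\<lambda>u. g (min u T)) \<eta> j t'" "t' < s" "s < u" "u \<le> t"
      "\<eta> < \<bar>g (min u T) - g (min s T)\<bar>" by auto
  obtain f where f: "limit_of_continuous f" "f \<in> borel_measurable borel" "\<And>v. \<bar>f v\<bar> \<le> 1" "\<And>v. v > t' \<Longrightarrow> f v = 0" "real j * \<eta> \<le> \<Lambda> f"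
    using Suc.IH[OF *(1)] by blast
  have s0: "0 \<le> s" "0 \<le> u" using oscillates_nonneg[OF *(1)] *(2,3) by auto
  define \<sigma> where "\<sigma> = (if g (min u T) \<ge> g (min s T) then 1 else -1 :: real)"
  define h where "h v = f v + \<sigma> * indicator {..u} v + (- \<sigma>) * indicator {..s} v" for v
  have h_eq: "h v = f v + \<sigma> * (indicator {..u} v - indicator {..s} v)" for v
    unfolding h_def by (simp add: right_diff_distrib)
  have fB: "bounded_Borel_on T f" using f(2,3) unfolding bounded_Borel_on_def by blast
  have iB: "bounded_Borel_on T (\<lambda>v. c * indicator {..p} v)" for c p
    unfolding bounded_Borel_on_def by (auto simp: indicator_def intro!: exI[of _ "\<bar>c\<bar>"])
  have fiB: "bounded_Borel_on T (\<lambda>v. f v + \<sigma> * indicator {..u} v)"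
  proof -
    have "\<bar>f v + \<sigma> * indicator {..u} v\<bar> \<le> 2" for v
      using f(3)[of v] unfolding \<sigma>_def by (auto simp: indicator_def)
    then show ?thesis unfolding bounded_Borel_on_def using f(2) by auto
  qed
  have "\<Lambda> h = \<Lambda> f + \<sigma> * g (min u T) + (- \<sigma>) * g (min s T)"
    unfolding h_def Stieltjes_add[OF fiB iB] Stieltjes_add[OF fB iB] Stieltjes_mult
    using s0 by (simp add: Stieltjes_atMost)
  also have "\<dots> = \<Lambda> f + \<bar>g (min u T) - g (min s T)\<bar>" unfolding \<sigma>_def by auto
  finally have "real (Suc j) * \<eta> \<le> \<Lambda> h" using f(5) *(5) by (simp add: distrib_right)
  moreover have "limit_of_continuous h"
    unfolding h_def by (intro limit_of_continuous_add f limit_of_continuous_atMost)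
  moreover have "h \<in> borel_measurable borel" unfolding h_def using f(2) by measurable
  moreover have "\<bar>h v\<bar> \<le> 1" for v
    using f(3)[of v] f(4)[of v] *(2,3) unfolding h_eq \<sigma>_def by (auto simp: indicator_def)
  moreover have "h v = 0" if "v > t" for v
    using f(4)[of v] *(2,3,4) that unfolding h_eq by (auto simp: indicator_def)
  ultimately show ?case by blast
qed

section \<open>Consequences of \<open>S\<close>-convergence\<close>

lemma S_converges_realE:
  assumes "S_converges_real T x x0" "0 < e"
  obtains \<nu> \<nu>0 where "\<And>n. finite_variation T (\<nu> n)" "finite_variation T \<nu>0"
    "\<And>n t. t \<in> {0..T} \<Longrightarrow> \<bar>x n t - \<nu> n t\<bar> \<le> e" "\<And>t. t \<in> {0..T} \<Longrightarrow> \<bar>x0 t - \<nu>0 t\<bar> \<le> e"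
    "weak_star_converges T \<nu> \<nu>0"
proof -
  obtain \<nu> \<nu>0 where \<nu>: "\<forall>n. finite_variation T (\<nu> n)" "finite_variation T \<nu>0"
        "\<forall>n. \<forall>t\<in>{0..T}. \<bar>x n t - \<nu> n t\<bar> \<le> e" "\<forall>t\<in>{0..T}. \<bar>x0 t - \<nu>0 t\<bar> \<le> e" "weak_star_converges T \<nu> \<nu>0"
    using assms(1)[unfolded S_converges_real_def, rule_format, OF assms(2)] by (elim exE conjE) (rule that)
  show ?thesis by (rule that[of \<nu> \<nu>0]) (use \<nu> in blast)+
qed

text \<open>The values of approximants of accuracy 1 are values of their functionals at indicators,
  and those are uniformly bounded.\<close>

lemma S_converges_real_bounded:
  assumes T: "0 < T" and S: "S_converges_real T x x0"
  shows "\<exists>B. \<forall>n u. 0 \<le> u \<longrightarrow> \<bar>x n (min u T)\<bar> \<le> B"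
proof -
  obtain \<nu> \<nu>0 where \<nu>: "\<And>n. finite_variation T (\<nu> n)" "\<And>n t. t \<in> {0..T} \<Longrightarrow> \<bar>x n t - \<nu> n t\<bar> \<le> 1" "weak_star_converges T \<nu> \<nu>0"
    by (rule S_converges_realE[OF S zero_less_one], rule that)
  obtain C where C: "\<And>n f. limit_of_continuous f \<Longrightarrow> (\<And>t. \<bar>f t\<bar> \<le> 1) \<Longrightarrow> \<bar>Stieltjes_functional T (\<nu> n) f\<bar> \<le> C"
    using weak_star_bounded[OF T \<nu>(1) \<nu>(3)] by metis
  have "\<bar>x n (min u T)\<bar> \<le> C + 1" if u: "0 \<le> u" for n u
  proof -
    interpret finite_variation_function T "\<nu> n" by standard (use T \<nu> in auto)
    have "\<bar>\<Lambda> (indicator {..u})\<bar> \<le> C" by (rule C[OF limit_of_continuous_atMost]) (auto simp: indicator_def)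
    then have "\<bar>\<nu> n (min u T)\<bar> \<le> C" using Stieltjes_atMost[OF u] by simp
    moreover have "\<bar>x n (min u T) - \<nu> n (min u T)\<bar> \<le> 1" using u T by (intro \<nu>(2)) auto
    ultimately show ?thesis by linarith
  qed
  then show ?thesis by blast
qed

text \<open>Approximation up to \<open>\<eta> / 3\<close> leaves every oscillation above
  \<open>\<eta> / 3\<close>, so \<open>m\<close> of them push the functional at a test function
  bounded by 1 to at least \<open>m * (\<eta> / 3)\<close>. The uniform bound caps
  \<open>m\<close>.\<close>

lemma S_converges_real_oscillates:
  assumes T: "0 < T" and S: "S_converges_real T x x0" and \<eta>: "0 < \<eta>"
  shows "\<exists>m. \<forall>n t. \<not> oscillates (\<lambda>u. x n (min u T)) \<eta> m t"
proof -
  obtain \<nu> \<nu>0 where \<nu>: "\<And>n. finite_variation T (\<nu> n)" "\<And>n t. t \<in> {0..T} \<Longrightarrow> \<bar>x n t - \<nu> n t\<bar> \<le> \<eta> / 3" "weak_star_converges T \<nu> \<nu>0"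
    by (rule S_converges_realE[OF S, of "\<eta> / 3"], use \<eta> in simp, rule that)
  obtain C where C: "\<And>n f. limit_of_continuous f \<Longrightarrow> (\<And>t. \<bar>f t\<bar> \<le> 1) \<Longrightarrow> \<bar>Stieltjes_functional T (\<nu> n) f\<bar> \<le> C"
    using weak_star_bounded[OF T \<nu>(1) \<nu>(3)] by metis
  obtain m :: nat where m: "C < real m * (\<eta> / 3)" using reals_Archimedean3[of "\<eta> / 3"] \<eta> by auto
  have "\<not> oscillates (\<lambda>u. x n (min u T)) \<eta> m t" for n t
  proof
    assume "oscillates (\<lambda>u. x n (min u T)) \<eta> m t"
    then have "oscillates (\<lambda>u. x n (min u T)) (\<eta> / 3 + 2 * (\<eta> / 3)) m t" by simp
    then have o: "oscillates (\<lambda>u. \<nu> n (min u T)) (\<eta> / 3) m t"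
      by (rule oscillates_perturb[rotated]) (rule \<nu>(2), use T in auto)
    interpret finite_variation_function T "\<nu> n" by standard (use T \<nu> in auto)
    obtain f where "limit_of_continuous f" "\<And>v. \<bar>f v\<bar> \<le> 1" "real m * (\<eta> / 3) \<le> \<Lambda> f"
      using oscillates_test_function[OF o] by blast
    then show False using C[of f n] m by force
  qed
  then show ?thesis by blast
qed

text \<open>The ramp gives the convergence for the finite-variation approximants; passing from them
  to the functions costs at most \<open>\<epsilon> * b\<close> for each integral.\<close>

lemma S_converges_real_integral:
  assumes T: "0 < T" and S: "S_converges_real T x x0" and b: "0 \<le> b"
    and int: "\<And>n. (\<lambda>u. x n (min u T)) integrable_on {0..b}" "(\<lambda>u. x0 (min u T)) integrable_on {0..b}"
  shows "(\<lambda>n. integral {0..b} (\<lambda>u. x n (min u T))) \<longlonglongrightarrow> integral {0..b} (\<lambda>u. x0 (min u T))"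
proof (rule LIMSEQ_I)
  fix e :: real assume e: "0 < e"
  \<comment> \<open>\<open>b + 1\<close> instead of \<open>b\<close> admits \<open>b = 0\<close> and
    makes \<open>\<epsilon> * b < e / 3\<close> strict.\<close>
  define \<epsilon> where "\<epsilon> = e / (3 * (b + 1))"
  have \<epsilon>: "\<epsilon> > 0" "\<epsilon> * b < e / 3" using e b unfolding \<epsilon>_def by (simp_all add: field_simps)
  obtain \<nu> \<nu>0 where \<nu>: "\<And>n. finite_variation T (\<nu> n)" "finite_variation T \<nu>0"
      "\<And>n t. t \<in> {0..T} \<Longrightarrow> \<bar>x n t - \<nu> n t\<bar> \<le> \<epsilon>" "\<And>t. t \<in> {0..T} \<Longrightarrow> \<bar>x0 t - \<nu>0 t\<bar> \<le> \<epsilon>" "weak_star_converges T \<nu> \<nu>0"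
    by (rule S_converges_realE[OF S \<epsilon>(1)], rule that)
  have fvf: "finite_variation_function T (\<nu> n)" "finite_variation_function T \<nu>0" for n
    by (standard, use T \<nu> in auto)+
  have close: "\<bar>integral {0..b} (\<lambda>u. y (min u T)) - integral {0..b} (\<lambda>u. z (min u T))\<bar> \<le> \<epsilon> * b"
    if "\<And>t. t \<in> {0..T} \<Longrightarrow> \<bar>y t - z t\<bar> \<le> \<epsilon>" "(\<lambda>u. y (min u T)) integrable_on {0..b}" "(\<lambda>u. z (min u T)) integrable_on {0..b}" for y z
  proof -
    have "norm (integral (cbox 0 b) (\<lambda>u. y (min u T) - z (min u T))) \<le> \<epsilon> * measure lborel (cbox 0 b)"
    proof (rule integrable_bound)
      show "0 \<le> \<epsilon>" using \<epsilon> by simp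
      show "(\<lambda>u. y (min u T) - z (min u T)) integrable_on cbox 0 b"
        using that by (auto intro!: integrable_diff simp: cbox_interval)
      show "norm (y (min u T) - z (min u T)) \<le> \<epsilon>" if "u \<in> cbox 0 b" for u
        using that T \<open>\<And>t. t \<in> {0..T} \<Longrightarrow> \<bar>y t - z t\<bar> \<le> \<epsilon>\<close>[of "min u T"] by auto
    qed
    then show ?thesis using that b by (simp add: integral_diff cbox_interval)
  qed
  have "continuous_on {0..T} (\<lambda>u. max 0 (b - u))" by (intro continuous_intros)
  from \<nu>(5)[unfolded weak_star_converges_def, rule_format, OF this]
  have "(\<lambda>n. Stieltjes_functional T (\<nu> n) (\<lambda>u. max 0 (b - u))) \<longlonglongrightarrow> Stieltjes_functional T \<nu>0 (\<lambda>u. max 0 (b - u))" .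
  then have lim: "(\<lambda>n. integral {0..b} (\<lambda>u. \<nu> n (min u T))) \<longlonglongrightarrow> integral {0..b} (\<lambda>u. \<nu>0 (min u T))"
    using finite_variation_function.Stieltjes_ramp(2)[OF fvf(1) b] finite_variation_function.Stieltjes_ramp(2)[OF fvf(2) b] by simp
  obtain N where N: "\<And>n. n \<ge> N \<Longrightarrow> \<bar>integral {0..b} (\<lambda>u. \<nu> n (min u T)) - integral {0..b} (\<lambda>u. \<nu>0 (min u T))\<bar> < e / 3"
    using LIMSEQ_D[OF lim, of "e/3"] e by auto
  have "norm (integral {0..b} (\<lambda>u. x n (min u T)) - integral {0..b} (\<lambda>u. x0 (min u T))) < e" if "n \<ge> N" for n
  proof -
    have "\<bar>integral {0..b} (\<lambda>u. x n (min u T)) - integral {0..b} (\<lambda>u. \<nu> n (min u T))\<bar> \<le> \<epsilon> * b"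
      by (rule close[OF \<nu>(3) int(1) finite_variation_function.Stieltjes_ramp(1)[OF fvf(1) b]])
    moreover have "\<bar>integral {0..b} (\<lambda>u. x0 (min u T)) - integral {0..b} (\<lambda>u. \<nu>0 (min u T))\<bar> \<le> \<epsilon> * b"
      by (rule close[OF \<nu>(4) int(2) finite_variation_function.Stieltjes_ramp(1)[OF fvf(2) b]])
    ultimately show ?thesis using N[OF that] \<epsilon>(2) unfolding real_norm_def by linarith
  qed
  then show "\<exists>N. \<forall>n\<ge>N. norm (integral {0..b} (\<lambda>u. x n (min u T)) - integral {0..b} (\<lambda>u. x0 (min u T))) < e" by blast
qed

lemma S_converges_real_subseq:
  assumes "S_converges_real T x x0" "strict_mono r"
  shows "S_converges_real T (\<lambda>n. x (r n)) x0"
  unfolding S_converges_real_def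
proof (intro allI impI)
  fix e :: real assume e: "0 < e"
  obtain \<nu> \<nu>0 where \<nu>: "\<And>n. finite_variation T (\<nu> n)" "finite_variation T \<nu>0"
        "\<And>n t. t \<in> {0..T} \<Longrightarrow> \<bar>x n t - \<nu> n t\<bar> \<le> e" "\<And>t. t \<in> {0..T} \<Longrightarrow> \<bar>x0 t - \<nu>0 t\<bar> \<le> e" "weak_star_converges T \<nu> \<nu>0"
    by (rule S_converges_realE[OF assms(1) e], rule that)
  have "weak_star_converges T (\<lambda>n. \<nu> (r n)) \<nu>0"
    unfolding weak_star_converges_def
  proof (intro allI impI)
    fix f :: "real \<Rightarrow> real" assume "continuous_on {0..T} f"
    then have "(\<lambda>n. Stieltjes_functional T (\<nu> n) f) \<longlonglongrightarrow> Stieltjes_functional T \<nu>0 f"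
      using \<nu>(5) unfolding weak_star_converges_def by blast
    from LIMSEQ_subseq_LIMSEQ[OF this assms(2)]
    show "(\<lambda>n. Stieltjes_functional T (\<nu> (r n)) f) \<longlonglongrightarrow> Stieltjes_functional T \<nu>0 f" by (simp add: comp_def)
  qed
  then show "\<exists>\<nu> \<nu>0.
        (\<forall>n. finite_variation T (\<nu> n)) \<and> finite_variation T \<nu>0 \<and>
        (\<forall>n. \<forall>t\<in>{0..T}. \<bar>x (r n) t - \<nu> n t\<bar> \<le> e) \<and> (\<forall>t\<in>{0..T}. \<bar>x0 t - \<nu>0 t\<bar> \<le> e) \<and>
        weak_star_converges T \<nu> \<nu>0"
    using \<nu> by (intro exI[of _ "\<lambda>n. \<nu> (r n)"] exI[of _ \<nu>0]) auto
qed

lemma S_converges_real_cong: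
  assumes "\<And>n t. t \<in> {0..T} \<Longrightarrow> x n t = y n t" "\<And>t. t \<in> {0..T} \<Longrightarrow> x0 t = y0 t"
  shows "S_converges_real T x x0 \<longleftrightarrow> S_converges_real T y y0"
  unfolding S_converges_real_def using assms by simp

section \<open>Step approximations and compactness\<close>

lemma Cauchy_bound_limit:
  fixes L :: "nat \<Rightarrow> real"
  assumes "\<And>p q. \<bar>L p - L q\<bar> \<le> e p + e q" "e \<longlonglongrightarrow> 0"
  obtains l where "L \<longlonglongrightarrow> l" "\<And>p. \<bar>l - L p\<bar> \<le> e p"
proof -
  have "Cauchy L"
  proof (rule CauchyI)
    fix \<epsilon> :: real assume "0 < \<epsilon>"
    then obtain N where N: "\<And>n. n \<ge> N \<Longrightarrow> \<bar>e n\<bar> < \<epsilon> / 2" using LIMSEQ_D[OF assms(2), of "\<epsilon>/2"] by auto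
    have "norm (L m - L n) < \<epsilon>" if "m \<ge> N" "n \<ge> N" for m n
      using assms(1)[of m n] N[OF that(1)] N[OF that(2)] by auto
    then show "\<exists>M. \<forall>m\<ge>M. \<forall>n\<ge>M. norm (L m - L n) < \<epsilon>" by blast
  qed
  then obtain l where l: "L \<longlonglongrightarrow> l" using Cauchy_convergent convergent_def by blast
  have "\<bar>l - L p\<bar> \<le> e p" for p
  proof (rule LIMSEQ_le)
    show "(\<lambda>q. \<bar>L q - L p\<bar>) \<longlonglongrightarrow> \<bar>l - L p\<bar>" by (intro tendsto_intros l)
    have "(\<lambda>q. e p + e q) \<longlonglongrightarrow> e p + 0" by (intro tendsto_intros assms)
    then show "(\<lambda>q. e p + e q) \<longlonglongrightarrow> e p" by simp
    show "\<exists>N. \<forall>n\<ge>N. \<bar>L n - L p\<bar> \<le> e p + e n" using assms(1) by (metis add.commute)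
  qed
  then show ?thesis using that l by blast
qed

text \<open>Interchange of limits under uniform approximation: the limits \<open>L p\<close> are
  Cauchy with errors controlled by \<open>e\<close>, and their limit is that of
  \<open>y\<close>.\<close>

lemma tendsto_uniform_approx:
  fixes y :: "'a \<Rightarrow> real"
  assumes F: "F \<noteq> bot" and L: "\<And>p. (G p \<longlongrightarrow> L p) F"
    and ev: "\<And>p. eventually (\<lambda>s. \<bar>y s - G p s\<bar> \<le> e p) F" and e: "e \<longlonglongrightarrow> 0"
  obtains l where "(y \<longlongrightarrow> l) F" "L \<longlonglongrightarrow> l"
proof -
  have "\<bar>L p - L q\<bar> \<le> e p + e q" for p q
  proof (rule tendsto_upperbound[OF _ _ F])
    show "((\<lambda>s. \<bar>G p s - G q s\<bar>) \<longlongrightarrow> \<bar>L p - L q\<bar>) F" by (intro tendsto_intros L)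
    show "\<forall>\<^sub>F s in F. \<bar>G p s - G q s\<bar> \<le> e p + e q"
      using ev[of p] ev[of q] by eventually_elim linarith
  qed
  then obtain l where l: "L \<longlonglongrightarrow> l" "\<And>p. \<bar>l - L p\<bar> \<le> e p"
    using Cauchy_bound_limit[OF _ e] by metis
  have "(y \<longlongrightarrow> l) F"
  proof (rule tendstoI)
    fix \<epsilon> :: real assume \<epsilon>: "0 < \<epsilon>"
    then obtain p where p: "\<bar>e p\<bar> < \<epsilon> / 3" using LIMSEQ_D[OF e, of "\<epsilon>/3"] by auto
    have "eventually (\<lambda>s. dist (G p s) (L p) < \<epsilon> / 3) F" by (rule tendstoD[OF L]) (use \<epsilon> in simp)
    then show "eventually (\<lambda>s. dist (y s) l < \<epsilon>) F"
      using ev[of p]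
    proof eventually_elim
      case (elim s)
      then show ?case using l(2)[of p] p unfolding dist_real_def by linarith
    qed
  qed
  then show ?thesis using that l by blast
qed

text \<open>The jump times are the first times at which \<open>j\<close> oscillations are completed; between two of them
  \<open>x\<close> varies by at most \<open>\<eta>\<close>.\<close>
lemma step_approximation:
  assumes H: "0 < H" and rc: "\<And>t. 0 \<le> t \<Longrightarrow> t < H \<Longrightarrow> continuous (at_right t) x"
    and osc: "\<not> oscillates x \<eta> m H" and \<eta>: "0 < \<eta>"
  shows "\<exists>\<tau> d. (\<forall>j. \<tau> j \<in> {0..H}) \<and> (\<forall>B. (\<forall>t\<in>{0..H}. \<bar>x t\<bar> \<le> B) \<longrightarrow> (\<forall>j. \<bar>d j\<bar> \<le> 2 * B)) \<and>
           (\<forall>t\<in>{0..H}. \<bar>x t - step_function (Suc m) \<tau> d t\<bar> \<le> \<eta>)"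
proof -
  \<comment> \<open>\<open>H\<close> is the default: the infimum is \<open>H\<close> if
    \<open>j\<close> oscillations are never completed. By \<open>osc\<close> this is the case for
    \<open>j = m\<close>.\<close>
  define A where "A j = insert H {t\<in>{0..H}. oscillates x \<eta> j t}" for j
  define \<tau> where "\<tau> j = Inf (A j)" for j
  \<comment> \<open>The jumps telescope, so the step function at \<open>t\<close> equals
    \<open>x\<close> at the last jump time not after \<open>t\<close>.\<close>
  define d where "d j = (case j of 0 \<Rightarrow> x 0 | Suc i \<Rightarrow> x (\<tau> j) - x (\<tau> i))" for j
  have A_bdd: "bdd_below (A j)" and A_sub: "A j \<subseteq> {0..H}" for j unfolding A_def using H by auto
  have \<tau>_in: "\<tau> j \<in> {0..H}" for j
  proof -
    have "\<tau> j \<le> H" unfolding \<tau>_def by (rule cInf_lower[OF _ A_bdd]) (simp add: A_def)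
    moreover have "0 \<le> \<tau> j" unfolding \<tau>_def by (rule cInf_greatest) (use A_sub in \<open>auto simp: A_def\<close>)
    ultimately show ?thesis by simp
  qed
  have \<tau>_mono: "\<tau> i \<le> \<tau> j" if "i \<le> j" for i j
    unfolding \<tau>_def
    by (rule cInf_superset_mono[OF _ A_bdd]) (use oscillates_less[OF _ that] in \<open>auto simp: A_def\<close>)
  have \<tau>_0: "\<tau> 0 = 0"
  proof -
    have "\<tau> 0 \<le> 0" unfolding \<tau>_def by (rule cInf_lower[OF _ A_bdd]) (use H in \<open>auto simp: A_def\<close>)
    then show ?thesis using \<tau>_in[of 0] by simp
  qed
  have \<tau>_m: "\<tau> m = H"
  proof -
    have "A m = {H}" unfolding A_def using osc oscillates_later by auto
    then show ?thesis unfolding \<tau>_def by simp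
  qed
  have sum_d: "(\<Sum>j<Suc k. d j) = x (\<tau> k)" for k
    by (induction k) (simp_all add: d_def \<tau>_0)
  have "\<bar>x t - step_function (Suc m) \<tau> d t\<bar> \<le> \<eta>" if t: "t \<in> {0..H}" for t
  proof -
    define k where "k = Max {j. j \<le> m \<and> \<tau> j \<le> t}"
    have fin: "finite {j. j \<le> m \<and> \<tau> j \<le> t}" by simp
    have "0 \<in> {j. j \<le> m \<and> \<tau> j \<le> t}" using t \<tau>_0 by simp
    then have k: "k \<le> m" "\<tau> k \<le> t" using Max_in[OF fin] unfolding k_def by blast+
    have k_max: "j \<le> k" if "j \<le> m" "\<tau> j \<le> t" for j using Max_ge[OF fin] that unfolding k_def by blast
    have "step_function (Suc m) \<tau> d t = (\<Sum>j<Suc m. if j \<le> k then d j else 0)"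
      unfolding step_function_def
    proof (rule sum.cong[OF refl])
      fix j assume "j \<in> {..<Suc m}"
      then have "\<tau> j \<le> t \<longleftrightarrow> j \<le> k" using k_max[of j] \<tau>_mono[of j k] k by auto
      then show "d j * indicator {..t} (\<tau> j) = (if j \<le> k then d j else 0)" by (simp add: indicator_def)
    qed
    also have "\<dots> = (\<Sum>j<Suc k. d j)"
      by (rule sum.mono_neutral_cong_right) (use k in auto)
    finally have eq: "step_function (Suc m) \<tau> d t = x (\<tau> k)" using sum_d by simp
    have "\<bar>x t - x (\<tau> k)\<bar> \<le> \<eta>"
    proof (cases "t = \<tau> k \<or> k = m")
      case True
      then have "t = \<tau> k" using \<tau>_m k t by auto
      then show ?thesis using \<eta> by simp
    next
      case False
      then have tk: "\<tau> k < t" "Suc k \<le> m" using k by auto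
      then have kt: "t < \<tau> (Suc k)" using k_max[of "Suc k"] by (meson not_less not_less_eq_eq order_refl)
      \<comment> \<open>An oscillation between \<open>s\<close> and \<open>t\<close> would come
        after \<open>k\<close> completed ones and force \<open>\<tau> (Suc k) \<le> t\<close>. The
        infimum \<open>\<tau> k\<close> need not be attained, so \<open>s = \<tau> k\<close> is
        reached afterwards by right continuity.\<close>
      have near: "\<bar>x t - x s\<bar> \<le> \<eta>" if s: "\<tau> k < s" "s < t" for s
      proof (rule ccontr)
        assume c: "\<not> \<bar>x t - x s\<bar> \<le> \<eta>"
        obtain t' where t': "t' \<in> A k" "t' < s"
          using cInf_lessD[of "A k" s] s(1) unfolding \<tau>_def A_def by auto
        then have "oscillates x \<eta> k t'" using s t unfolding A_def by auto
        then have "oscillates x \<eta> (Suc k) t" using t' s c by (auto simp: not_le)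
        then have "t \<in> A (Suc k)" using t unfolding A_def by simp
        then have "\<tau> (Suc k) \<le> t" unfolding \<tau>_def by (rule cInf_lower[OF _ A_bdd])
        then show False using kt by simp
      qed
      show ?thesis
      proof (rule tendsto_upperbound)
        have "continuous (at_right (\<tau> k)) x" using rc[of "\<tau> k"] \<tau>_in[of k] tk t by auto
        then show "((\<lambda>s. \<bar>x t - x s\<bar>) \<longlongrightarrow> \<bar>x t - x (\<tau> k)\<bar>) (at_right (\<tau> k))"
          unfolding continuous_within by (intro tendsto_intros)
        show "\<forall>\<^sub>F s in at_right (\<tau> k). \<bar>x t - x s\<bar> \<le> \<eta>"
          by (rule eventually_at_rightI[OF _ tk(1)]) (use near in auto)
      qed simp
    qed
    then show ?thesis unfolding eq .
  qed
  moreover have "\<bar>d j\<bar> \<le> 2 * B" if B: "\<And>t. t \<in> {0..H} \<Longrightarrow> \<bar>x t\<bar> \<le> B" for j B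
  proof (cases j)
    case 0
    then show ?thesis using B[of 0] H unfolding d_def by auto
  next
    case (Suc i)
    then show ?thesis using B[OF \<tau>_in[of j]] B[OF \<tau>_in[of i]] unfolding d_def by auto
  qed
  ultimately show ?thesis using \<tau>_in by (intro exI[of _ \<tau>] exI[of _ d] conjI allI ballI impI) simp_all
qed

lemma bounded_if_not_oscillates:
  assumes H: "0 < H" and rc: "\<And>t. 0 \<le> t \<Longrightarrow> t < H \<Longrightarrow> continuous (at_right t) x"
    and osc: "\<not> oscillates x 1 m H"
  shows "\<exists>B. \<forall>t\<in>{0..H}. \<bar>x t\<bar> \<le> B"
proof -
  have "\<exists>\<tau> d. \<forall>t\<in>{0..H}. \<bar>x t - step_function (Suc m) \<tau> d t\<bar> \<le> 1"
  proof -
    have "\<exists>\<tau> d. (\<forall>j. \<tau> j \<in> {0..H}) \<and> (\<forall>B. (\<forall>t\<in>{0..H}. \<bar>x t\<bar> \<le> B) \<longrightarrow> (\<forall>j. \<bar>d j\<bar> \<le> 2 * B)) \<and>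
           (\<forall>t\<in>{0..H}. \<bar>x t - step_function (Suc m) \<tau> d t\<bar> \<le> 1)"
      by (rule step_approximation[OF H _ osc zero_less_one]) (rule rc)
    then show ?thesis by (elim exE conjE) (intro exI)
  qed
  then obtain \<tau> d where sf: "\<And>t. t \<in> {0..H} \<Longrightarrow> \<bar>x t - step_function (Suc m) \<tau> d t\<bar> \<le> 1" by blast
  have "\<bar>step_function (Suc m) \<tau> d t\<bar> \<le> (\<Sum>j<Suc m. \<bar>d j\<bar>)" for t
    unfolding step_function_def by (rule order_trans[OF sum_abs sum_mono]) (auto simp: indicator_def)
  then have "\<bar>x t\<bar> \<le> 1 + (\<Sum>j<Suc m. \<bar>d j\<bar>)" if "t \<in> {0..H}" for t
  proof -
    have "\<bar>x t\<bar> \<le> \<bar>step_function (Suc m) \<tau> d t\<bar> + 1" using sf[OF that] by linarith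
    moreover have "\<bar>step_function (Suc m) \<tau> d t\<bar> \<le> (\<Sum>j<Suc m. \<bar>d j\<bar>)" by fact
    ultimately show ?thesis by linarith
  qed
  then show ?thesis by blast
qed

text \<open>Supremum argument over the times by which the number of oscillations is still bounded:
  the one-sided limits at the supremum \<open>a\<close> confine the variation on both sides of it,
  which extends the bound beyond \<open>a\<close>.\<close>

lemma oscillates_finite:
  assumes rc: "\<And>t. 0 \<le> t \<Longrightarrow> continuous (at_right t) x"
    and ll: "\<And>t. 0 < t \<Longrightarrow> \<exists>l. (x \<longlongrightarrow> l) (at_left t)" and \<eta>: "0 < \<eta>" and H: "0 \<le> H"
  shows "\<exists>m. \<not> oscillates x \<eta> m H"
proof (rule ccontr)
  assume neg: "\<nexists>m. \<not> oscillates x \<eta> m H"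
  define A where "A = {t\<in>{0..H}. \<exists>m. \<not> oscillates x \<eta> m t}"
  have "\<not> oscillates x \<eta> (Suc 0) 0" by (auto simp: not_less)
  then have A0: "0 \<in> A" unfolding A_def using H by (auto simp del: oscillates.simps)
  have bdd: "bdd_above A" unfolding A_def by auto
  define a where "a = Sup A"
  have a: "0 \<le> a" unfolding a_def by (rule cSup_upper[OF A0 bdd])
  have aH: "a \<le> H" unfolding a_def by (rule cSup_least) (use A0 in \<open>auto simp: A_def\<close>)
  have close: "\<bar>x u - x s\<bar> \<le> \<eta>" if "dist (x u) l < \<eta> / 2" "dist (x s) l < \<eta> / 2" for u s l
    using that unfolding dist_real_def by linarith
  have "eventually (\<lambda>s. dist (x s) (x a) < \<eta> / 2) (at_right a)"
    using rc[OF a] \<eta> unfolding continuous_within by (intro tendstoD) auto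
  then obtain b where b: "b > a" "\<And>s. a < s \<Longrightarrow> s < b \<Longrightarrow> dist (x s) (x a) < \<eta> / 2"
    unfolding eventually_at_right_field by blast
  have right: "\<bar>x u - x s\<bar> \<le> \<eta>" if "a \<le> s" "s < b" "a \<le> u" "u < b" for u s
  proof (rule close[of _ "x a"])
    show "dist (x u) (x a) < \<eta> / 2" using b(2)[of u] that \<eta> by (cases "u = a") auto
    show "dist (x s) (x a) < \<eta> / 2" using b(2)[of s] that \<eta> by (cases "s = a") auto
  qed
  obtain t0 where t0: "t0 \<in> A" "\<And>s u. t0 < s \<Longrightarrow> s < a \<Longrightarrow> t0 < u \<Longrightarrow> u < a \<Longrightarrow> \<bar>x u - x s\<bar> \<le> \<eta>"
  proof (cases "a = 0")
    case True
    show ?thesis by (rule that[OF A0]) (use True in auto)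
  next
    case False
    then have "0 < a" using a by simp
    then obtain l where "(x \<longlongrightarrow> l) (at_left a)" using ll by blast
    then have "eventually (\<lambda>s. dist (x s) l < \<eta> / 2) (at_left a)" using \<eta> by (intro tendstoD) auto
    then obtain c where c: "c < a" "\<And>s. c < s \<Longrightarrow> s < a \<Longrightarrow> dist (x s) l < \<eta> / 2"
      unfolding eventually_at_left_field by blast
    obtain t0 where "t0 \<in> A" "c < t0" using less_cSupD[of A c] A0 c(1) unfolding a_def by blast
    then show ?thesis using c by (intro that[of t0] close[of _ l]) auto
  qed
  then obtain m where m: "\<not> oscillates x \<eta> m t0" unfolding A_def by blast
  \<comment> \<open>The \<open>m\<close>-th oscillation ends after \<open>t0\<close>. The next one
    must end at or after \<open>a\<close>, since \<open>x\<close> varies by at most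
    \<open>\<eta>\<close> on \<open>(t0, a)\<close>; one more would lie inside
    \<open>[a, b)\<close>, where the variation is again at most \<open>\<eta>\<close>.\<close>
  have key: "\<not> oscillates x \<eta> (Suc (Suc m)) t" if t: "t < b" for t
  proof
    assume "oscillates x \<eta> (Suc (Suc m)) t"
    then obtain t2 s2 u2 t1 s1 u1 where *: "oscillates x \<eta> m t1" "t1 < s1" "s1 < u1" "u1 \<le> t2"
        "\<eta> < \<bar>x u1 - x s1\<bar>" "t2 < s2" "s2 < u2" "u2 \<le> t" "\<eta> < \<bar>x u2 - x s2\<bar>" by auto
    have "t0 < t1" using *(1) m oscillates_later by (meson not_le)
    then have "a \<le> u1" using t0(2)[of s1 u1] * by (intro leI) auto
    then show False using right[of s2 u2] * t by auto
  qed
  show False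
  proof (cases "H < b")
    case True then show ?thesis using key[of H] neg by blast
  next
    case False
    define c where "c = (a + b) / 2"
    have c: "a < c" "c < b" using b(1) unfolding c_def by auto
    moreover have "\<exists>m. \<not> oscillates x \<eta> m c" using key[OF c(2)] by blast
    ultimately have "c \<in> A" unfolding A_def using False a by auto
    then have "c \<le> a" unfolding a_def by (rule cSup_upper[OF _ bdd])
    then show False using c by simp
  qed
qed

text \<open>A limit exactly at \<open>t\<close> would leave the side undecided, except when all
  terms stay at or below \<open>t\<close>; the latter covers the end point of the interval
  containing the jump times.\<close>

lemma tendsto_indicator_atMost:
  assumes "(\<lambda>n. \<tau> n) \<longlonglongrightarrow> (\<tau>' :: real)" "\<tau>' \<noteq> t \<or> (\<forall>n. \<tau> n \<le> t)"
  shows "eventually (\<lambda>n. indicator {..t} (\<tau> n) = (indicator {..t} \<tau>' :: real)) sequentially"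
proof -
  consider "\<tau>' < t" | "\<tau>' > t" | "\<forall>n. \<tau> n \<le> t" using assms(2) by (metis linorder_neqE_linordered_idom)
  then show ?thesis
  proof cases
    case 1
    then show ?thesis using order_tendstoD(2)[OF assms(1) 1] by (auto elim!: eventually_mono simp: indicator_def)
  next
    case 2
    then show ?thesis using order_tendstoD(1)[OF assms(1) 2] by (auto elim!: eventually_mono simp: indicator_def)
  next
    case 3
    then have "\<tau>' \<le> t" using assms(1) by (intro LIMSEQ_le_const2) auto
    then show ?thesis using 3 by (simp add: indicator_def)
  qed
qed

lemma step_function_left_limit: "((step_function m \<tau> d) \<longlongrightarrow> (\<Sum>j<m. d j * indicator {..<t} (\<tau> j))) (at_left t)"
proof -
  have "((\<lambda>s. indicator {..s} c) \<longlongrightarrow> (indicator {..<t} c :: real)) (at_left t)" for c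
  proof (rule tendsto_eventually)
    show "eventually (\<lambda>s. indicator {..s} c = (indicator {..<t} c :: real)) (at_left t)"
    proof (cases "c < t")
      case True
      show ?thesis by (rule eventually_at_leftI[OF _ True]) (use True in \<open>auto simp: indicator_def\<close>)
    next
      case False
      show ?thesis by (rule eventually_at_leftI[of "t-1"]) (use False in \<open>auto simp: indicator_def\<close>)
    qed
  qed
  then show ?thesis unfolding step_function_def by (intro tendsto_sum tendsto_mult tendsto_const)
qed

text \<open>For each accuracy \<open>p\<close> the step functions converge with their jump times and
  sizes; the limits \<open>G p\<close> are uniformly Cauchy with errors \<open>e p\<close>, and
  \<open>y\<close> is their uniform limit. Limiting jump times are excluded because a jump can cross
  such a \<open>t\<close> in the limit; no jump can cross \<open>H\<close>.\<close>

lemma S_convergence_of_step_approximations: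
  fixes e :: "nat \<Rightarrow> real"
  assumes H: "0 < H" and e: "e \<longlonglongrightarrow> 0" "\<And>p. 0 \<le> e p"
    and \<tau>_in: "\<And>p n j. \<tau> p n j \<in> {0..H}"
    and approx: "\<And>p n t. t \<in> {0..H} \<Longrightarrow> \<bar>x n t - step_function (M p) (\<tau> p n) (d p n) t\<bar> \<le> e p"
    and \<tau>_lim: "\<And>p j. (\<lambda>n. \<tau> p n j) \<longlonglongrightarrow> \<tau>' p j" and d_lim: "\<And>p j. (\<lambda>n. d p n j) \<longlonglongrightarrow> d' p j"
  obtains y where "\<And>t. 0 \<le> t \<Longrightarrow> t < H \<Longrightarrow> continuous (at_right t) y"
    "\<And>t. 0 < t \<Longrightarrow> t \<le> H \<Longrightarrow> \<exists>l. (y \<longlongrightarrow> l) (at_left t)"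
    "\<And>t. 0 < t \<Longrightarrow> t \<le> H \<Longrightarrow> t = H \<or> (\<forall>p j. \<tau>' p j \<noteq> t) \<Longrightarrow> S_converges_real t x y"
    "\<And>t. 0 \<le> t \<Longrightarrow> t < H \<Longrightarrow> (\<forall>p j. \<tau>' p j \<noteq> t) \<Longrightarrow> (\<lambda>n. x n t) \<longlonglongrightarrow> y t"
proof -
  define G where "G p = step_function (M p) (\<tau>' p) (d' p)" for p
  have \<tau>'_in: "\<tau>' p j \<in> {0..H}" for p j
    using \<tau>_in \<tau>_lim closed_sequentially[of "{0..H}"] by (metis closed_real_atLeastAtMost)
  have step_lim: "(\<lambda>n. step_function (M p) (\<tau> p n) (d p n) t) \<longlonglongrightarrow> G p t"
    if t: "t \<in> {0..H}" "t = H \<or> (\<forall>j<M p. \<tau>' p j \<noteq> t)" for p t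
    unfolding G_def step_function_def
  proof (intro tendsto_sum tendsto_mult d_lim)
    fix j assume j: "j \<in> {..<M p}"
    have "\<tau>' p j \<noteq> t \<or> (\<forall>n. \<tau> p n j \<le> t)" using t(2) j \<tau>_in[of p _ j] by auto
    then show "(\<lambda>n. indicator {..t} (\<tau> p n j)) \<longlonglongrightarrow> (indicator {..t} (\<tau>' p j) :: real)"
      by (intro tendsto_eventually tendsto_indicator_atMost \<tau>_lim)
  qed
  \<comment> \<open>Away from the finitely many limiting jump times of the two accuracies, both
    limits are compared through \<open>x n\<close>; the estimate then reaches every
    \<open>t < H\<close> from the right.\<close>
  have G_close: "\<bar>G p t - G q t\<bar> \<le> e p + e q" if t: "t \<in> {0..H}" for p q t
  proof -
    define E where "E = \<tau>' p ` {..<M p} \<union> \<tau>' q ` {..<M q}"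
    have good: "\<bar>G p s - G q s\<bar> \<le> e p + e q" if s: "s \<in> {0..H}" "s = H \<or> s \<notin> E" for s
    proof (rule LIMSEQ_le_const2)
      have "s = H \<or> (\<forall>j<M p. \<tau>' p j \<noteq> s)" "s = H \<or> (\<forall>j<M q. \<tau>' q j \<noteq> s)" using s(2) unfolding E_def by auto
      then show "(\<lambda>n. \<bar>step_function (M p) (\<tau> p n) (d p n) s - step_function (M q) (\<tau> q n) (d q n) s\<bar>) \<longlonglongrightarrow> \<bar>G p s - G q s\<bar>"
        by (intro tendsto_intros step_lim s(1))
      show "\<exists>N. \<forall>n\<ge>N. \<bar>step_function (M p) (\<tau> p n) (d p n) s - step_function (M q) (\<tau> q n) (d q n) s\<bar> \<le> e p + e q"
      proof (intro exI allI impI)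
        fix n
        show "\<bar>step_function (M p) (\<tau> p n) (d p n) s - step_function (M q) (\<tau> q n) (d q n) s\<bar> \<le> e p + e q"
          using approx[OF s(1), of n p] approx[OF s(1), of n q] by linarith
      qed
    qed
    show ?thesis
    proof (cases "t = H")
      case True then show ?thesis using good[of t] t by simp
    next
      case False
      then have tH: "t < H" using t by simp
      show ?thesis
      proof (rule tendsto_upperbound)
        show "((\<lambda>s. \<bar>G p s - G q s\<bar>) \<longlongrightarrow> \<bar>G p t - G q t\<bar>) (at_right t)"
          using step_function_right_cont[of t] unfolding G_def continuous_within by (intro tendsto_intros) auto
        have "finite E" unfolding E_def by simp
        then have "\<forall>\<^sub>F s in at_right t. \<forall>c\<in>E. s \<noteq> c"
          by (intro eventually_ball_finite ballI eventually_neq_at_within) auto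
        moreover have "\<forall>\<^sub>F s in at_right t. s \<in> {t<..<H}" by (rule eventually_at_rightI[OF _ tH])
        ultimately show "\<forall>\<^sub>F s in at_right t. \<bar>G p s - G q s\<bar> \<le> e p + e q"
          by eventually_elim (use t in \<open>auto intro!: good\<close>)
      qed simp
    qed
  qed
  have "\<exists>l. (\<lambda>p. G p t) \<longlonglongrightarrow> l \<and> (\<forall>p. \<bar>l - G p t\<bar> \<le> e p)" if "t \<in> {0..H}" for t
    using Cauchy_bound_limit[of "\<lambda>p. G p t" e, OF G_close[OF that] e(1)] by metis
  then obtain y where y: "\<And>t. t \<in> {0..H} \<Longrightarrow> (\<lambda>p. G p t) \<longlonglongrightarrow> y t" "\<And>p t. t \<in> {0..H} \<Longrightarrow> \<bar>y t - G p t\<bar> \<le> e p"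
    by metis
  show ?thesis
  proof (rule that[of y])
    fix t assume t: "0 \<le> t" "t < H"
    have ev: "\<forall>\<^sub>F s in at_right t. \<bar>y s - G p s\<bar> \<le> e p" for p
      by (rule eventually_at_rightI[OF _ t(2)]) (use t y(2) in auto)
    have lim: "(G p \<longlongrightarrow> G p t) (at_right t)" for p
      using step_function_right_cont unfolding G_def continuous_within .
    obtain l where l: "(y \<longlongrightarrow> l) (at_right t)" "(\<lambda>p. G p t) \<longlonglongrightarrow> l"
      by (rule tendsto_uniform_approx[OF trivial_limit_at_right_real lim ev e(1)], rule that)
    have "l = y t" using LIMSEQ_unique[OF l(2) y(1)] t by simp
    then show "continuous (at_right t) y" using l(1) unfolding continuous_within by simp
  next
    fix t assume t: "0 \<le> t" "t < H" "\<forall>p j. \<tau>' p j \<noteq> t"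
    show "(\<lambda>n. x n t) \<longlonglongrightarrow> y t"
    proof (rule LIMSEQ_I)
      fix \<epsilon> :: real assume \<epsilon>: "0 < \<epsilon>"
      then obtain p where p: "\<bar>e p\<bar> < \<epsilon> / 3" using LIMSEQ_D[OF e(1), of "\<epsilon> / 3"] by auto
      obtain N where N: "\<And>n. n \<ge> N \<Longrightarrow> \<bar>step_function (M p) (\<tau> p n) (d p n) t - G p t\<bar> < \<epsilon> / 3"
        using LIMSEQ_D[OF step_lim[of t p], of "\<epsilon> / 3"] t \<epsilon> by auto
      have "norm (x n t - y t) < \<epsilon>" if "n \<ge> N" for n
      proof -
        have "\<bar>x n t - step_function (M p) (\<tau> p n) (d p n) t\<bar> \<le> e p" "\<bar>y t - G p t\<bar> \<le> e p"
          using t by (auto intro!: approx y(2))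
        then show ?thesis using N[OF that] p unfolding real_norm_def by linarith
      qed
      then show "\<exists>N. \<forall>n\<ge>N. norm (x n t - y t) < \<epsilon>" by blast
    qed
  next
    fix t assume t: "0 < t" "t \<le> H"
    have ev: "\<forall>\<^sub>F s in at_left t. \<bar>y s - G p s\<bar> \<le> e p" for p
      by (rule eventually_at_leftI[OF _ t(1)]) (use t y(2) in auto)
    have lim: "(G p \<longlongrightarrow> (\<Sum>j<M p. d' p j * indicator {..<t} (\<tau>' p j))) (at_left t)" for p
      unfolding G_def by (rule step_function_left_limit)
    show "\<exists>l. (y \<longlongrightarrow> l) (at_left t)"
      by (rule tendsto_uniform_approx[OF trivial_limit_at_left_real lim ev e(1)]) blast
  next
    fix t assume t: "0 < t" "t \<le> H" "t = H \<or> (\<forall>p j. \<tau>' p j \<noteq> t)"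
    show "S_converges_real t x y"
      unfolding S_converges_real_def
    proof (intro allI impI)
      fix \<epsilon> :: real assume "0 < \<epsilon>"
      then obtain p where "\<bar>e p\<bar> < \<epsilon>" using LIMSEQ_D[OF e(1)] by auto
      then have p: "e p \<le> \<epsilon>" by simp
      have "weak_star_converges t (\<lambda>n. step_function (M p) (\<tau> p n) (d p n)) (G p)"
        unfolding weak_star_converges_def
      proof (intro allI impI)
        fix f :: "real \<Rightarrow> real" assume f: "continuous_on {0..t} f"
        have "(\<lambda>n. if \<tau> p n j \<le> t then d p n j * f (\<tau> p n j) else 0) \<longlonglongrightarrow>
            (if \<tau>' p j \<le> t then d' p j * f (\<tau>' p j) else 0)" for j
        \<comment> \<open>The atom either stays in [0, t] eventually or has its limit beyond
          \<open>t\<close> and leaves; the assumption on \<open>t\<close> rules out a limit exactly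
          at \<open>t < H\<close>.\<close>
        proof (cases "\<tau>' p j < t \<or> t = H")
          case True
          have ev: "\<forall>\<^sub>F n in sequentially. \<tau> p n j \<le> t"
          proof (cases "t = H")
            case False
            then have lt: "\<tau>' p j < t" using True by simp
            show ?thesis by (rule eventually_mono[OF order_tendstoD(2)[OF \<tau>_lim lt]]) (rule less_imp_le)
          qed (use \<tau>_in[of p _ j] in simp)
          have le: "\<tau>' p j \<le> t" using True \<tau>'_in[of p j] by auto
          have "(\<lambda>n. f (\<tau> p n j)) \<longlonglongrightarrow> f (\<tau>' p j)"
            by (rule continuous_on_tendsto_compose[OF f \<tau>_lim])
               (use \<tau>_in[of p _ j] \<tau>'_in[of p j] le ev in \<open>auto elim!: eventually_mono\<close>)
          then have "(\<lambda>n. d p n j * f (\<tau> p n j)) \<longlonglongrightarrow> d' p j * f (\<tau>' p j)" by (intro tendsto_mult d_lim)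
          then have "(\<lambda>n. if \<tau> p n j \<le> t then d p n j * f (\<tau> p n j) else 0) \<longlonglongrightarrow> d' p j * f (\<tau>' p j)"
            by (rule Lim_transform_eventually) (use ev in \<open>auto elim!: eventually_mono\<close>)
          then show ?thesis using le by simp
        next
          case False
          then have gt: "\<tau>' p j > t" using t(3) by (metis linorder_neqE_linordered_idom)
          have "\<forall>\<^sub>F n in sequentially. \<tau> p n j > t" by (rule order_tendstoD(1)[OF \<tau>_lim gt])
          then have "(\<lambda>n. if \<tau> p n j \<le> t then d p n j * f (\<tau> p n j) else 0) \<longlonglongrightarrow> 0"
            by (intro tendsto_eventually) (auto elim!: eventually_mono)
          then show ?thesis using gt by simp
        qed
        then have "(\<lambda>n. \<Sum>j<M p. if \<tau> p n j \<le> t then d p n j * f (\<tau> p n j) else 0) \<longlonglongrightarrow>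
            (\<Sum>j<M p. if \<tau>' p j \<le> t then d' p j * f (\<tau>' p j) else 0)" by (intro tendsto_sum)
        moreover have "Stieltjes_functional t (step_function (M p) (\<tau> p n) (d p n)) f =
            (\<Sum>j<M p. if \<tau> p n j \<le> t then d p n j * f (\<tau> p n j) else 0)" for n
          by (rule Stieltjes_step_function[OF t(1) _ f]) (use \<tau>_in[of p n] in auto)
        moreover have "Stieltjes_functional t (G p) f =
            (\<Sum>j<M p. if \<tau>' p j \<le> t then d' p j * f (\<tau>' p j) else 0)"
          unfolding G_def by (rule Stieltjes_step_function[OF t(1) _ f]) (use \<tau>'_in[of p] in auto)
        ultimately show "(\<lambda>n. Stieltjes_functional t (step_function (M p) (\<tau> p n) (d p n)) f) \<longlonglongrightarrow> Stieltjes_functional t (G p) f"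
          by simp
      qed
      moreover have "\<bar>x n s - step_function (M p) (\<tau> p n) (d p n) s\<bar> \<le> \<epsilon>" if "s \<in> {0..t}" for n s
        using approx[of s n p] that t(2) p by auto
      moreover have "\<bar>y s - G p s\<bar> \<le> \<epsilon>" if "s \<in> {0..t}" for s
        using y(2)[of s p] that t(2) p by auto
      ultimately show "\<exists>\<nu> \<nu>0.
        (\<forall>n. finite_variation t (\<nu> n)) \<and> finite_variation t \<nu>0 \<and>
        (\<forall>n. \<forall>s\<in>{0..t}. \<bar>x n s - \<nu> n s\<bar> \<le> \<epsilon>) \<and> (\<forall>s\<in>{0..t}. \<bar>y s - \<nu>0 s\<bar> \<le> \<epsilon>) \<and>
        weak_star_converges t \<nu> \<nu>0"
        using finite_variation_step_function[OF t(1)]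
        by (intro exI[of _ "\<lambda>n. step_function (M p) (\<tau> p n) (d p n)"] exI[of _ "G p"]) (auto simp: G_def)
    qed
  qed
qed

text \<open>A countable product of compact intervals is compact and metrizable, hence sequentially
  compact; this takes the place of a diagonal argument.\<close>

lemma bounded_functions_convergent_subseq:
  fixes f :: "nat \<Rightarrow> 'i::countable \<Rightarrow> real"
  assumes "\<And>n i. \<bar>f n i\<bar> \<le> B i"
  obtains r l where "strict_mono (r :: nat \<Rightarrow> nat)" "\<And>i. (\<lambda>n. f (r n) i) \<longlonglongrightarrow> l i"
proof -
  define K where "K = Pi\<^sub>E UNIV (\<lambda>i. {- B i..B i})"
  have "compactin (product_topology (\<lambda>_. euclideanreal) UNIV) K"
    unfolding K_def compactin_PiE by auto
  then have "compact K" by (simp add: euclidean_product_topology)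
  then have "seq_compact K" by (rule compact_imp_seq_compact)
  moreover have "f n \<in> K" for n using assms[of n] by (auto simp: K_def abs_le_iff minus_le_iff)
  ultimately obtain l r where r: "strict_mono r" "(f \<circ> r) \<longlonglongrightarrow> l" unfolding seq_compact_def by metis
  have "(\<lambda>n. f (r n) i) \<longlonglongrightarrow> l i" for i
    using continuous_on_tendsto_compose[OF continuous_on_product_coordinates r(2)] by (simp add: comp_def)
  then show ?thesis using that r(1) by blast
qed

section \<open>Averages of right-continuous functions\<close>

abbreviation average :: "(real \<Rightarrow> real) \<Rightarrow> real \<Rightarrow> real \<Rightarrow> real" where
  "average x p q \<equiv> (integral {0..q} x - integral {0..p} x) / (q - p)"

lemma integral_average_bounds:
  fixes x :: "real \<Rightarrow> real"
  assumes int: "x integrable_on {0..q}" and pq: "0 \<le> p" "p < q"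
    and bd: "\<And>s. s \<in> {p..q} \<Longrightarrow> a \<le> x s" "\<And>s. s \<in> {p..q} \<Longrightarrow> x s \<le> b"
  shows "average x p q \<in> {a..b}"
proof -
  have i: "x integrable_on {p..q}" by (rule integrable_subinterval_real[OF int]) (use pq in auto)
  have "integral {0..p} x + integral {p..q} x = integral {0..q} x"
    by (rule Henstock_Kurzweil_Integration.integral_combine[OF _ _ int]) (use pq in auto)
  then have eq: "integral {0..q} x - integral {0..p} x = integral {p..q} x" by simp
  have "integral {p..q} (\<lambda>_. a) \<le> integral {p..q} x" "integral {p..q} x \<le> integral {p..q} (\<lambda>_. b)"
    by (rule integral_le[OF integrable_const_ivl i bd(1)], assumption, rule integral_le[OF i integrable_const_ivl bd(2)])
  then have "a * (q - p) \<le> integral {p..q} x" "integral {p..q} x \<le> b * (q - p)" using pq by (simp_all add: mult.commute)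
  then show ?thesis unfolding eq using pq by (simp add: field_simps)
qed

lemma integral_average_tendsto:
  fixes x :: "real \<Rightarrow> real"
  assumes int: "\<And>b. 0 \<le> b \<Longrightarrow> x integrable_on {0..b}" and rc: "continuous (at_right t) x" and t: "0 \<le> t"
    and pq: "\<And>n. t < p n" "\<And>n. p n < q n" "q \<longlonglongrightarrow> t"
  shows "(\<lambda>n. average x (p n) (q n)) \<longlonglongrightarrow> x t"
proof (rule LIMSEQ_I)
  fix e :: real assume e: "0 < e"
  have "eventually (\<lambda>s. dist (x s) (x t) < e / 2) (at_right t)"
    using rc e unfolding continuous_within by (intro tendstoD) auto
  then obtain b where b: "b > t" "\<And>s. t < s \<Longrightarrow> s < b \<Longrightarrow> dist (x s) (x t) < e / 2"
    unfolding eventually_at_right_field by blast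
  obtain N where N: "\<And>n. n \<ge> N \<Longrightarrow> q n < b"
    using order_tendstoD(2)[OF pq(3) b(1)] unfolding eventually_sequentially by blast
  have "norm (average x (p n) (q n) - x t) < e" if n: "n \<ge> N" for n
  proof -
    have d: "dist (x s) (x t) < e / 2" if "s \<in> {p n..q n}" for s
      using that pq(1)[of n] N[OF n] by (intro b(2)) auto
    have "average x (p n) (q n) \<in> {x t - e / 2..x t + e / 2}"
    proof (rule integral_average_bounds)
      show "x integrable_on {0..q n}" "0 \<le> p n" "p n < q n"
        using pq(1,2)[of n] t by (auto intro!: int)
      show "x t - e / 2 \<le> x s" "x s \<le> x t + e / 2" if "s \<in> {p n..q n}" for s
        using d[OF that] unfolding dist_real_def by linarith+
    qed
    then show ?thesis using e by (auto simp: abs_less_iff)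
  qed
  then show "\<exists>N. \<forall>n\<ge>N. norm (average x (p n) (q n) - x t) < e" by blast
qed

text \<open>Rational end points make averages next to \<open>t\<close> computable from countably
  many integrals.\<close>

lemma rational_right_sequences:
  obtains p q :: "nat \<Rightarrow> rat" where "\<And>n. t < real_of_rat (p n)" "\<And>n. real_of_rat (p n) < real_of_rat (q n)"
    "(\<lambda>n. real_of_rat (q n)) \<longlonglongrightarrow> t"
proof -
  have "\<exists>p q. t < real_of_rat p \<and> real_of_rat p < real_of_rat q \<and> real_of_rat q < t + inverse (real (Suc n))" for n
  proof -
    obtain q where q: "t < real_of_rat q" "real_of_rat q < t + inverse (real (Suc n))"
      using of_rat_dense[of t "t + inverse (real (Suc n))"] by auto
    then obtain p where "t < real_of_rat p" "real_of_rat p < real_of_rat q"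
      using of_rat_dense[of t "real_of_rat q"] by auto
    then show ?thesis using q by blast
  qed
  then obtain p q where pq: "\<And>n. t < real_of_rat (p n)" "\<And>n. real_of_rat (p n) < real_of_rat (q n)"
      "\<And>n. real_of_rat (q n) < t + inverse (real (Suc n))" by metis
  have "(\<lambda>n. real_of_rat (q n)) \<longlonglongrightarrow> t"
  proof (rule tendsto_sandwich[where f = "\<lambda>_. t" and h = "\<lambda>n. t + inverse (real (Suc n))"])
    show "\<forall>\<^sub>F n in sequentially. t \<le> real_of_rat (q n)"
      using pq(1,2) by (intro always_eventually) (meson less_imp_le order_less_trans)
    show "\<forall>\<^sub>F n in sequentially. real_of_rat (q n) \<le> t + inverse (real (Suc n))"
      using pq(3) less_imp_le by (intro always_eventually) blast
    show "(\<lambda>n. t + inverse (real (Suc n))) \<longlonglongrightarrow> t"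
      using tendsto_add[OF tendsto_const LIMSEQ_inverse_real_of_nat, of t] by simp
  qed auto
  then show ?thesis using that pq by blast
qed

text \<open>Right-continuous functions that differ at \<open>t\<close> differ throughout some
  interval to its right, and such an interval is uncountable.\<close>

lemma right_cont_eq_off_countable:
  fixes x y :: "real \<Rightarrow> real"
  assumes rc: "continuous (at_right t) x" "continuous (at_right t) y" and E: "countable E" and tb: "t < b"
    and eq: "\<And>s. t < s \<Longrightarrow> s < b \<Longrightarrow> s \<notin> E \<Longrightarrow> x s = y s"
  shows "x t = y t"
proof (rule ccontr)
  assume "x t \<noteq> y t"
  then have "\<bar>x t - y t\<bar> > 0" by simp
  moreover have "((\<lambda>s. \<bar>x s - y s\<bar>) \<longlongrightarrow> \<bar>x t - y t\<bar>) (at_right t)"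
    using rc unfolding continuous_within by (intro tendsto_intros)
  ultimately have "eventually (\<lambda>s. \<bar>x s - y s\<bar> > 0) (at_right t)" by (rule order_tendstoD(1)[rotated])
  then obtain c where c: "c > t" "\<And>s. t < s \<Longrightarrow> s < c \<Longrightarrow> \<bar>x s - y s\<bar> > 0"
    unfolding eventually_at_right_field by blast
  have "uncountable {t<..<min b c}" using tb c(1) by (simp add: uncountable_open_interval)
  then have "\<not> {t<..<min b c} \<subseteq> E" using E countable_subset by metis
  then have "\<exists>s\<in>{t<..<min b c}. s \<notin> E" unfolding subset_eq by simp
  then obtain s where "s \<in> {t<..<min b c}" "s \<notin> E" by (elim bexE)
  then show False using eq[of s] c(2)[of s] by auto
qed

section \<open>Paths as functions of real time\<close>

definition time_set :: "ereal set \<Rightarrow> bool" where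
  "time_set I \<longleftrightarrow> (\<exists>T. 0 < T \<and> T \<le> \<infinity> \<and> I = {0..T}) \<or> I = {0..<\<infinity>}"

text \<open>A path on \<open>[0, T]\<close> is continued constantly beyond \<open>T\<close>, so that its integrals over \<open>[0, q]\<close> with
  \<open>q > T\<close> also determine its value at \<open>T\<close>.\<close>
definition coord_path :: "ereal set \<Rightarrow> (ereal \<Rightarrow> real^'d::finite) \<Rightarrow> 'd \<Rightarrow> real \<Rightarrow> real" where
  "coord_path I \<omega> i t = \<omega> (min (ereal t) (Sup I)) $ i"

lemma time_set_cases:
  assumes "time_set I"
  obtains (compact) T where "0 < T" "I = {0..ereal T}" "Sup I = ereal T" "I \<noteq> {0..\<infinity>}" "I \<noteq> {0..<\<infinity>}" "\<infinity> \<notin> I"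
  | (infinite) "I = {0..<\<infinity>} \<or> I = {0..\<infinity>}" "Sup I = \<infinity>"
proof -
  consider T where "0 < T" "T \<le> \<infinity>" "I = {0..T}" | "I = {0..<\<infinity>}" using assms unfolding time_set_def by blast
  then show ?thesis
  proof cases
    case (1 T)
    show ?thesis
    proof (cases T)
      case (real r)
      have "\<infinity> \<notin> I" using 1 real by auto
      moreover have "ereal (r + 1) \<notin> I" using 1 real by auto
      moreover have "ereal (r + 1) \<in> {0..<\<infinity>}" using 1 real by auto
      ultimately have "I \<noteq> {0..<\<infinity>}" "\<infinity> \<notin> I" by metis+
      moreover have "I \<noteq> {0..\<infinity>}" using \<open>\<infinity> \<notin> I\<close> by auto
      moreover have "Sup I = ereal r" unfolding 1(3) real by (rule cSup_atLeastAtMost) (use 1 real in auto)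
      ultimately show ?thesis using 1 real by (intro compact) auto
    next
      case PInf
      then show ?thesis using 1 by (intro infinite) (auto simp: cSup_atLeastAtMost)
    qed (use 1 in auto)
  next
    case 2
    have "Sup I = \<infinity>" unfolding 2 by (rule Sup_atLeastLessThan) simp
    then show ?thesis using 2 by (intro infinite) auto
  qed
qed

lemma clamp_in_time_set:
  assumes "time_set I" "0 \<le> t"
  shows "min (ereal t) (Sup I) \<in> I" "min (ereal t) (Sup I) \<noteq> \<infinity>"
  using assms(1) by (cases rule: time_set_cases; use assms(2) in \<open>auto simp: min_def\<close>)+

lemma path_eq:
  assumes "time_set I" "ereal t \<in> I"
  shows "coord_path I \<omega> i t = \<omega> (ereal t) $ i"
proof -
  have "ereal t \<le> Sup I" by (rule Sup_upper[OF assms(2)])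
  then show ?thesis unfolding coord_path_def by (simp add: min_absorb1)
qed

lemma path_right_cont:
  fixes \<omega> :: "ereal \<Rightarrow> real^'d::finite"
  assumes I: "time_set I" and \<omega>: "\<omega> \<in> skorokhod I" and t: "0 \<le> t"
  shows "continuous (at_right t) (coord_path I \<omega> i)"
proof (cases "ereal t < Sup I")
  case True
  then obtain b where b: "t < b" "ereal b < Sup I" using ereal_dense2 ereal_less_eq(3) less_ereal.simps(1) by blast
  have mem: "ereal s \<in> I" if "t \<le> s" "s < b" for s
    using I by (cases rule: time_set_cases) (use that t b in auto)
  have "(\<omega> \<longlongrightarrow> \<omega> (ereal t)) (at (ereal t) within I \<inter> {ereal t<..})"
    using \<omega> mem[of t] b unfolding skorokhod_def by auto
  moreover have "filterlim ereal (at (ereal t) within I \<inter> {ereal t<..}) (at_right t)"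
    unfolding filterlim_at
  proof
    show "\<forall>\<^sub>F s in at_right t. ereal s \<in> I \<inter> {ereal t<..} \<and> ereal s \<noteq> ereal t"
      by (rule eventually_at_rightI[OF _ b(1)]) (use mem in auto)
    show "(ereal \<longlongrightarrow> ereal t) (at_right t)" by (intro tendsto_intros)
  qed
  ultimately have "((\<lambda>s. \<omega> (ereal s)) \<longlongrightarrow> \<omega> (ereal t)) (at_right t)" by (rule filterlim_compose)
  then have "((\<lambda>s. \<omega> (ereal s) $ i) \<longlongrightarrow> \<omega> (ereal t) $ i) (at_right t)" by (rule tendsto_vec_nth)
  moreover have "\<forall>\<^sub>F s in at_right t. \<omega> (ereal s) $ i = coord_path I \<omega> i s"
    by (rule eventually_at_rightI[OF _ b(1)]) (use mem I in \<open>auto simp: path_eq\<close>)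
  ultimately have "(coord_path I \<omega> i \<longlongrightarrow> \<omega> (ereal t) $ i) (at_right t)" by (rule Lim_transform_eventually)
  moreover have "coord_path I \<omega> i t = \<omega> (ereal t) $ i" by (rule path_eq[OF I mem]) (use b in auto)
  ultimately show ?thesis unfolding continuous_within by simp
next
  case False
  have "\<forall>\<^sub>F s in at_right t. coord_path I \<omega> i s = coord_path I \<omega> i t"
  proof (rule eventually_at_rightI[of t "t+1"])
    fix s assume "s \<in> {t<..<t+1}"
    then have "Sup I \<le> ereal s" "Sup I \<le> ereal t" using False by (auto intro: order_trans[of _ "ereal t"])
    then show "coord_path I \<omega> i s = coord_path I \<omega> i t" unfolding coord_path_def by (simp add: min_absorb2)
  qed simp
  then show ?thesis unfolding continuous_within by (rule tendsto_eventually)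
qed

lemma path_left_limit:
  fixes \<omega> :: "ereal \<Rightarrow> real^'d::finite"
  assumes I: "time_set I" and \<omega>: "\<omega> \<in> skorokhod I" and t: "0 < t"
  shows "\<exists>l. (coord_path I \<omega> i \<longlongrightarrow> l) (at_left t)"
proof (cases "ereal t \<le> Sup I")
  case True
  have mem: "ereal s \<in> I" if "0 \<le> s" "s \<le> t" for s
    using I by (cases rule: time_set_cases) (use that t True in auto)
  obtain l where "(\<omega> \<longlongrightarrow> l) (at (ereal t) within I \<inter> {..<ereal t})"
    using \<omega> mem[of t] t unfolding skorokhod_def by auto
  moreover have "filterlim ereal (at (ereal t) within I \<inter> {..<ereal t}) (at_left t)"
    unfolding filterlim_at
  proof
    show "\<forall>\<^sub>F s in at_left t. ereal s \<in> I \<inter> {..<ereal t} \<and> ereal s \<noteq> ereal t"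
      by (rule eventually_at_leftI[OF _ t]) (use mem in auto)
    show "(ereal \<longlongrightarrow> ereal t) (at_left t)" by (intro tendsto_intros)
  qed
  ultimately have "((\<lambda>s. \<omega> (ereal s)) \<longlongrightarrow> l) (at_left t)" by (rule filterlim_compose)
  then have "((\<lambda>s. \<omega> (ereal s) $ i) \<longlongrightarrow> l $ i) (at_left t)" by (rule tendsto_vec_nth)
  moreover have "\<forall>\<^sub>F s in at_left t. \<omega> (ereal s) $ i = coord_path I \<omega> i s"
    by (rule eventually_at_leftI[OF _ t]) (use mem I in \<open>auto simp: path_eq\<close>)
  ultimately have "(coord_path I \<omega> i \<longlongrightarrow> l $ i) (at_left t)" by (rule Lim_transform_eventually)
  then show ?thesis by blast
next
  case False
  obtain b where b: "b < t" "Sup I \<le> ereal b" "0 \<le> b"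
    using I
  proof (cases rule: time_set_cases)
    case (compact T)
    then show ?thesis using False by (intro that[of T]) auto
  next
    case infinite
    then show ?thesis using False by simp
  qed
  have "\<forall>\<^sub>F s in at_left t. coord_path I \<omega> i s = coord_path I \<omega> i t"
  proof (rule eventually_at_leftI[OF _ b(1)])
    fix s assume "s \<in> {b<..<t}"
    then have "Sup I \<le> ereal s" "Sup I \<le> ereal t" using b by (auto intro: order_trans[of _ "ereal b"])
    then show "coord_path I \<omega> i s = coord_path I \<omega> i t" unfolding coord_path_def by (simp add: min_absorb2)
  qed
  then show ?thesis using tendsto_eventually by blast
qed

lemma path_not_oscillates:
  assumes I: "time_set I" and \<omega>: "\<omega> \<in> skorokhod I" and "0 < \<eta>" "0 \<le> H"
  shows "\<exists>m. \<not> oscillates (coord_path I \<omega> i) \<eta> m H"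
  by (rule oscillates_finite[OF path_right_cont[OF I \<omega>] path_left_limit[OF I \<omega>] assms(3,4)])

lemma path_bounded:
  assumes I: "time_set I" and \<omega>: "\<omega> \<in> skorokhod I" and H: "0 < H"
  shows "\<exists>B. \<forall>t\<in>{0..H}. \<bar>coord_path I \<omega> i t\<bar> \<le> B"
proof -
  obtain m where "\<not> oscillates (coord_path I \<omega> i) 1 m H"
    using path_not_oscillates[OF I \<omega>, of 1 H] H by auto
  then show ?thesis using bounded_if_not_oscillates[OF H path_right_cont[OF I \<omega>]] by blast
qed

lemma path_integrable:
  assumes I: "time_set I" and \<omega>: "\<omega> \<in> skorokhod I"
  shows "coord_path I \<omega> i integrable_on {0..b}"
proof (cases "0 < b")
  case True
  obtain B where B: "\<And>t. t \<in> {0..b} \<Longrightarrow> \<bar>coord_path I \<omega> i t\<bar> \<le> B" using path_bounded[OF I \<omega> True] by blast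
  show ?thesis by (rule Riemann_sums(1)[OF True path_right_cont[OF I \<omega>] B])
next
  case False
  then have "{0..b} = {} \<or> {0..b} = {0}" by auto
  then show ?thesis by (auto simp: integrable_negligible)
qed

lemma path_Riemann_sums:
  assumes I: "time_set I" and \<omega>: "\<omega> \<in> skorokhod I" and b: "0 < b"
  shows "(\<lambda>n. \<Sum>j<Suc n. b / real (Suc n) * coord_path I \<omega> i (grid b n (Suc j))) \<longlonglongrightarrow> integral {0..b} (coord_path I \<omega> i)"
proof -
  obtain B where B: "\<And>t. t \<in> {0..b} \<Longrightarrow> \<bar>coord_path I \<omega> i t\<bar> \<le> B" using path_bounded[OF I \<omega> b] by blast
  show ?thesis by (rule Riemann_sums(2)[OF b path_right_cont[OF I \<omega>] B])
qed

definition path_function :: "ereal set \<Rightarrow> ('d \<Rightarrow> real \<Rightarrow> real) \<Rightarrow> real^'d::finite \<Rightarrow> ereal \<Rightarrow> real^'d" where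
  "path_function I y v = (\<lambda>u\<in>I. if u = \<infinity> then v else (\<chi> i. y i (real_of_ereal u)))"

lemma path_function_in_skorokhod:
  fixes y :: "'d::finite \<Rightarrow> real \<Rightarrow> real"
  assumes I: "time_set I"
    and rc: "\<And>i t. 0 \<le> t \<Longrightarrow> ereal t < Sup I \<Longrightarrow> continuous (at_right t) (y i)"
    and ll: "\<And>i t. 0 < t \<Longrightarrow> ereal t \<le> Sup I \<Longrightarrow> \<exists>l. (y i \<longlongrightarrow> l) (at_left t)"
  shows "path_function I y v \<in> skorokhod I"
  unfolding skorokhod_def
proof (intro CollectI conjI ballI impI)
  show "path_function I y v \<in> extensional I" unfolding path_function_def by (rule restrict_extensional)
  fix u :: ereal assume u: "u \<in> I" "u \<noteq> \<infinity>"
  have Ipos: "\<And>w. w \<in> I \<Longrightarrow> 0 \<le> w" using I by (cases rule: time_set_cases) auto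
  then have "0 \<le> u" using u by blast
  then obtain t where t: "u = ereal t" "0 \<le> t" using u by (cases u) auto
  have tS: "ereal t \<le> Sup I" using Sup_upper[OF u(1)] t by simp
  have real_lim: "(real_of_ereal \<longlongrightarrow> t) (at (ereal t) within A)" for A
    using lim_real_of_ereal[OF tendsto_ident_at] by simp
  have fin: "\<forall>\<^sub>F w in at (ereal t) within A. w \<noteq> \<infinity> \<and> w \<noteq> -\<infinity>" for A
  proof -
    have "\<forall>\<^sub>F w in at (ereal t) within A. w < \<infinity>" by (rule order_tendstoD(2)[OF tendsto_ident_at]) simp
    moreover have "\<forall>\<^sub>F w in at (ereal t) within A. w > -\<infinity>" by (rule order_tendstoD(1)[OF tendsto_ident_at]) simp
    ultimately show ?thesis by eventually_elim auto
  qed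
  have pf: "path_function I y v w $ i = y i (real_of_ereal w)" if "w \<in> I" "w \<noteq> \<infinity>" for w i
    using that unfolding path_function_def by simp
  have in_A: "\<forall>\<^sub>F w in at (ereal t) within A. w \<in> A" for A by (simp add: eventually_at_filter)
  show "(path_function I y v \<longlongrightarrow> path_function I y v u) (at u within I \<inter> {u<..})"
  proof (cases "ereal t < Sup I")
    case True
    have fl: "filterlim real_of_ereal (at_right t) (at (ereal t) within I \<inter> {ereal t<..})"
      unfolding filterlim_at
    proof
      show "\<forall>\<^sub>F w in at (ereal t) within I \<inter> {ereal t<..}. real_of_ereal w \<in> {t<..} \<and> real_of_ereal w \<noteq> t"
        using fin in_A by eventually_elim (metis IntD2 ereal_real greaterThan_iff less_ereal.simps(1) less_irrefl abs_ereal.simps(2,3) ereal_infinity_cases)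
    qed (rule real_lim)
    show ?thesis unfolding t(1)
    proof (rule vec_tendstoI)
      fix i
      have "(y i \<longlongrightarrow> y i t) (at_right t)" using rc[OF t(2) True] by (simp add: continuous_within)
      from filterlim_compose[OF this fl]
      have "((\<lambda>w. y i (real_of_ereal w)) \<longlongrightarrow> y i t) (at (ereal t) within I \<inter> {ereal t<..})" .
      moreover have "\<forall>\<^sub>F w in at (ereal t) within I \<inter> {ereal t<..}. y i (real_of_ereal w) = path_function I y v w $ i"
        using fin in_A by eventually_elim (simp add: pf)
      ultimately have "((\<lambda>w. path_function I y v w $ i) \<longlongrightarrow> y i t) (at (ereal t) within I \<inter> {ereal t<..})"
        by (rule Lim_transform_eventually)
      then show "((\<lambda>w. path_function I y v w $ i) \<longlongrightarrow> path_function I y v (ereal t) $ i) (at (ereal t) within I \<inter> {ereal t<..})"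
        using u t(1) by (simp add: pf)
    qed
  next
    case False
    then have "I \<inter> {u<..} = {}" using Sup_upper[of _ I] t(1) by fastforce
    then show ?thesis by simp
  qed
  show "\<exists>l. (path_function I y v \<longlongrightarrow> l) (at u within I \<inter> {..<u})"
  proof (cases "t = 0")
    case True
    then have "u = 0" using t(1) by (simp add: zero_ereal_def)
    then have "I \<inter> {..<u} = {}" using Ipos by (auto dest: leD)
    then show ?thesis by simp
  next
    case False
    then have t0: "0 < t" using t by simp
    have "\<exists>l. (y i \<longlongrightarrow> l) (at_left t)" for i by (rule ll[OF t0 tS])
    then obtain L where L: "\<And>i. (y i \<longlongrightarrow> L i) (at_left t)" by metis
    have fl: "filterlim real_of_ereal (at_left t) (at (ereal t) within I \<inter> {..<ereal t})"
      unfolding filterlim_at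
    proof
      show "\<forall>\<^sub>F w in at (ereal t) within I \<inter> {..<ereal t}. real_of_ereal w \<in> {..<t} \<and> real_of_ereal w \<noteq> t"
        using fin in_A by eventually_elim (metis IntD2 ereal_real lessThan_iff less_ereal.simps(1) less_irrefl abs_ereal.simps(2,3) ereal_infinity_cases)
    qed (rule real_lim)
    have "(path_function I y v \<longlongrightarrow> (\<chi> i. L i)) (at (ereal t) within I \<inter> {..<ereal t})"
    proof (rule vec_tendstoI)
      fix i
      from filterlim_compose[OF L fl]
      have "((\<lambda>w. y i (real_of_ereal w)) \<longlongrightarrow> L i) (at (ereal t) within I \<inter> {..<ereal t})" .
      moreover have "\<forall>\<^sub>F w in at (ereal t) within I \<inter> {..<ereal t}. y i (real_of_ereal w) = path_function I y v w $ i"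
        using fin in_A by eventually_elim (simp add: pf)
      ultimately have "((\<lambda>w. path_function I y v w $ i) \<longlongrightarrow> L i) (at (ereal t) within I \<inter> {..<ereal t})"
        by (rule Lim_transform_eventually)
      then show "((\<lambda>w. path_function I y v w $ i) \<longlongrightarrow> (\<chi> i. L i) $ i) (at (ereal t) within I \<inter> {..<ereal t})" by simp
    qed
    then show ?thesis unfolding t(1) by blast
  qed
qed

section \<open>The Skorokhod space with its \<open>S\<close>-convergence\<close>

lemma time_set_infinity: "time_set I \<Longrightarrow> \<infinity> \<in> I \<Longrightarrow> I = {0..\<infinity>}"
  by (cases rule: time_set_cases) auto

text \<open>Rational upper limits keep the index set countable and the target product metrizable.
  The slot \<open>None\<close> records the value at \<infinity>, which no integral sees.\<close>

definition functionals :: "ereal set \<Rightarrow> (ereal \<Rightarrow> real^'d::finite) \<Rightarrow> 'd \<times> rat option \<Rightarrow> real" where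
  "functionals I \<omega> j = (case snd j of
      Some q \<Rightarrow> integral {0..real_of_rat q} (coord_path I \<omega> (fst j))
    | None \<Rightarrow> if \<infinity> \<in> I then \<omega> \<infinity> $ fst j else 0)"

text \<open>In the index \<open>(i, N, k)\<close> the case \<open>k = 0\<close> bounds the \<open>i\<close>-th coordinate on \<open>[0, N)\<close> and at \<open>\<infinity>\<close>, and
  \<open>k = p + 1\<close> counts its oscillations of size \<open>1 / (p + 1)\<close>. Half-open intervals are used because the
  values at the right end point are not detected by integrals over \<open>[0, N]\<close>.\<close>
definition strata :: "ereal set \<Rightarrow> 'd \<times> nat \<times> nat \<Rightarrow> nat \<Rightarrow> (ereal \<Rightarrow> real^'d::finite) set" where
  "strata I = (\<lambda>(i, N, k) m. {\<omega> \<in> skorokhod I. case k of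
      0 \<Rightarrow> (\<forall>t\<in>{0..<real N}. \<bar>coord_path I \<omega> i t\<bar> \<le> real m) \<and> (\<infinity> \<in> I \<longrightarrow> \<bar>\<omega> \<infinity> $ i\<bar> \<le> real m)
    | Suc p \<Rightarrow> (\<forall>t<real N. \<not> oscillates (coord_path I \<omega> i) (1 / real (Suc p)) m t)})"

text \<open>On [0, \<infinity>] the values at \<infinity> are required to converge as well; that
  this convergence generates the product topology is proved in
  \<open>S_topology_closed_half_line\<close>.\<close>

definition S_conv :: "ereal set \<Rightarrow> (nat \<Rightarrow> ereal \<Rightarrow> real^'d::finite) \<Rightarrow> (ereal \<Rightarrow> real^'d) \<Rightarrow> bool" where
  "S_conv I x l \<longleftrightarrow>
     (if I = {0..\<infinity>} then S_converges_infinite x l \<and> (\<lambda>n. x n \<infinity>) \<longlonglongrightarrow> l \<infinity>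
      else if I = {0..<\<infinity>} then S_converges_infinite x l
      else S_converges_compact (real_of_ereal (Sup I)) x l)"

lemma in_strata_bound:
  "\<omega> \<in> strata I (i, N, 0) m \<longleftrightarrow> \<omega> \<in> skorokhod I \<and>
     (\<forall>t\<in>{0..<real N}. \<bar>coord_path I \<omega> i t\<bar> \<le> real m) \<and> (\<infinity> \<in> I \<longrightarrow> \<bar>\<omega> \<infinity> $ i\<bar> \<le> real m)"
  and in_strata_osc:
  "\<omega> \<in> strata I (i, N, Suc p) m \<longleftrightarrow> \<omega> \<in> skorokhod I \<and>
     (\<forall>t<real N. \<not> oscillates (coord_path I \<omega> i) (1 / real (Suc p)) m t)"
  unfolding strata_def by simp_all

lemma S_converges_infinite_subseq:
  assumes "S_converges_infinite x l" "strict_mono r"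
  shows "S_converges_infinite (x \<circ> r) l"
  unfolding S_converges_infinite_def
proof
  fix i
  obtain T where T: "\<forall>r. 0 < T r" "incseq T" "filterlim T at_top sequentially"
      "\<And>k. S_converges_real (T k) (\<lambda>n t. x n (ereal t) $ i) (\<lambda>t. l (ereal t) $ i)"
    using assms(1) unfolding S_converges_infinite_def by metis
  have "S_converges_real (T k) (\<lambda>n t. (x \<circ> r) n (ereal t) $ i) (\<lambda>t. l (ereal t) $ i)" for k
    using S_converges_real_subseq[OF T(4) assms(2)] by (simp add: comp_def)
  then show "\<exists>T. (\<forall>r. 0 < T r) \<and> incseq T \<and> filterlim T at_top sequentially \<and>
        (\<forall>k. S_converges_real (T k) (\<lambda>n t. (x \<circ> r) n (ereal t) $ i) (\<lambda>t. l (ereal t) $ i))"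
    using T by blast
qed

lemma S_conv_subseq:
  assumes "S_conv I x l" "strict_mono r"
  shows "S_conv I (x \<circ> r) l"
proof -
  have 1: "(\<lambda>n. (x \<circ> r) n \<infinity>) \<longlonglongrightarrow> l \<infinity>" if "(\<lambda>n. x n \<infinity>) \<longlonglongrightarrow> l \<infinity>"
    using LIMSEQ_subseq_LIMSEQ[OF that assms(2)] by (simp add: comp_def)
  have 2: "S_converges_compact T (x \<circ> r) l" if "S_converges_compact T x l" for T
    unfolding S_converges_compact_def
  proof
    fix i
    show "S_converges_real T (\<lambda>n t. (x \<circ> r) n (ereal t) $ i) (\<lambda>t. l (ereal t) $ i)"
      using S_converges_real_subseq[OF that[unfolded S_converges_compact_def, rule_format] assms(2)]
      by (simp add: comp_def)
  qed
  show ?thesis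
    using assms(1) 1 2 S_converges_infinite_subseq[OF _ assms(2), of x l]
    unfolding S_conv_def by (auto split: if_splits)
qed

text \<open>A common form for all time sets: on a compact one the cut \<open>min u T\<close>
  reproduces the constant continuation, and on an unbounded one \<open>T\<close> is taken beyond
  \<open>H\<close>, where the cut has no effect.\<close>

lemma S_conv_horizon:
  fixes x :: "nat \<Rightarrow> ereal \<Rightarrow> real^'d::finite"
  assumes I: "time_set I" and conv: "S_conv I x l"
  obtains T where "0 < T" "S_converges_real T (\<lambda>n t. x n (ereal t) $ i) (\<lambda>t. l (ereal t) $ i)"
    "\<And>\<omega> u. 0 \<le> u \<Longrightarrow> u \<le> H \<Longrightarrow> coord_path I \<omega> i u = \<omega> (ereal (min u T)) $ i"
  using I
proof (cases rule: time_set_cases)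
  case (compact T)
  then have "S_converges_compact T x l" using conv unfolding S_conv_def by simp
  moreover have "min (ereal u) (ereal T) = ereal (min u T)" for u by (simp add: min_def)
  ultimately show ?thesis using compact that[of T] unfolding S_converges_compact_def coord_path_def by simp
next
  case infinite
  then have "S_converges_infinite x l" using conv unfolding S_conv_def by (auto split: if_splits)
  from this[unfolded S_converges_infinite_def, rule_format, of i]
  obtain T :: "nat \<Rightarrow> real" where T: "\<And>r. 0 < T r" "filterlim T at_top sequentially"
      "\<And>r. S_converges_real (T r) (\<lambda>n t. x n (ereal t) $ i) (\<lambda>t. l (ereal t) $ i)"
    by blast
  have "eventually (\<lambda>r. H \<le> T r) sequentially" using T(2) unfolding filterlim_at_top by blast
  then obtain r where "H \<le> T r" unfolding eventually_sequentially by blast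
  then show ?thesis
    using T(1,3) infinite by (intro that[of "T r"]) (auto simp: coord_path_def min_absorb1)
qed

lemma S_conv_integral:
  fixes x :: "nat \<Rightarrow> ereal \<Rightarrow> real^'d::finite"
  assumes I: "time_set I" and D: "range x \<subseteq> skorokhod I" "l \<in> skorokhod I" and conv: "S_conv I x l"
  shows "(\<lambda>n. integral {0..b} (coord_path I (x n) i)) \<longlonglongrightarrow> integral {0..b} (coord_path I l i)"
proof (cases "0 \<le> b")
  case True
  obtain T where T: "0 < T" "S_converges_real T (\<lambda>n t. x n (ereal t) $ i) (\<lambda>t. l (ereal t) $ i)"
    "\<And>\<omega> u. 0 \<le> u \<Longrightarrow> u \<le> b \<Longrightarrow> coord_path I \<omega> i u = \<omega> (ereal (min u T)) $ i"
    by (rule S_conv_horizon[OF I conv, where i = i and H = b], rule that)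
  have eq: "integral {0..b} (coord_path I \<omega> i) = integral {0..b} (\<lambda>u. \<omega> (ereal (min u T)) $ i)" for \<omega>
    by (rule integral_cong) (use T(3) in auto)
  have int: "(\<lambda>u. \<omega> (ereal (min u T)) $ i) integrable_on {0..b}" if "\<omega> \<in> skorokhod I" for \<omega>
    by (rule integrable_eq[OF path_integrable[OF I that]]) (use T(3) in auto)
  show ?thesis unfolding eq
    by (rule S_converges_real_integral[OF T(1,2) True]) (use D int in auto)
qed simp

lemma functionals_conv:
  fixes x :: "nat \<Rightarrow> ereal \<Rightarrow> real^'d::finite"
  assumes I: "time_set I" and D: "range x \<subseteq> skorokhod I" "l \<in> skorokhod I" and conv: "S_conv I x l"
  shows "(\<lambda>n. functionals I (x n) j) \<longlonglongrightarrow> functionals I l j"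
proof (cases "snd j")
  case None
  show ?thesis
  proof (cases "\<infinity> \<in> I")
    case True
    then have "I = {0..\<infinity>}" by (rule time_set_infinity[OF I])
    then have "(\<lambda>n. x n \<infinity>) \<longlonglongrightarrow> l \<infinity>" using conv unfolding S_conv_def by simp
    then show ?thesis using None True by (simp add: functionals_def tendsto_vec_nth)
  qed (use None in \<open>simp add: functionals_def\<close>)
next
  case (Some q)
  then show ?thesis using S_conv_integral[OF assms] by (simp add: functionals_def)
qed

text \<open>Averages over rational intervals shrinking to \<open>t\<close> from the right recover
  the value at \<open>t\<close>; the constant continuation extends this to a right end point of the
  time set.\<close>

lemma inj_functionals:
  assumes I: "time_set I"
  shows "inj_on (functionals I :: (ereal \<Rightarrow> real^'d::finite) \<Rightarrow> _) (skorokhod I)"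
proof (rule inj_onI)
  fix \<omega> \<omega>' :: "ereal \<Rightarrow> real^'d"
  assume w: "\<omega> \<in> skorokhod I" "\<omega>' \<in> skorokhod I" and eq: "functionals I \<omega> = functionals I \<omega>'"
  have int_eq: "integral {0..real_of_rat q} (coord_path I \<omega> i) = integral {0..real_of_rat q} (coord_path I \<omega>' i)" for q i
    using fun_cong[OF eq, of "(i, Some q)"] by (simp add: functionals_def)
  have p_eq: "coord_path I \<omega> i t = coord_path I \<omega>' i t" if t: "0 \<le> t" for i t
  proof -
    obtain p q :: "nat \<Rightarrow> rat" where pq: "\<And>n. t < real_of_rat (p n)" "\<And>n. real_of_rat (p n) < real_of_rat (q n)"
        "(\<lambda>n. real_of_rat (q n)) \<longlonglongrightarrow> t" by (rule rational_right_sequences[of t], rule that)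
    note avg = integral_average_tendsto[OF path_integrable[OF I] path_right_cont[OF I] t pq]
    show ?thesis
      using avg[OF w(1) w(1) t, of i] avg[OF w(2) w(2) t, of i] unfolding int_eq by (rule LIMSEQ_unique)
  qed
  show "\<omega> = \<omega>'"
  proof
    fix u
    show "\<omega> u = \<omega>' u"
    proof (cases "u \<in> I")
      case True
      show ?thesis
      proof (cases "u = \<infinity>")
        case inf: True
        have "\<omega> \<infinity> $ i = \<omega>' \<infinity> $ i" for i
          using fun_cong[OF eq, of "(i, None)"] True inf by (simp add: functionals_def)
        then show ?thesis using inf by (simp add: vec_eq_iff)
      next
        case False
        have "0 \<le> u" using I True by (cases rule: time_set_cases) auto
        then obtain t where t: "u = ereal t" "0 \<le> t" using False by (cases u) auto
        then have tI: "ereal t \<in> I" using True by simp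
        have "\<omega> (ereal t) $ i = \<omega>' (ereal t) $ i" for i
          unfolding path_eq[OF I tI, symmetric] by (rule p_eq[OF t(2)])
        then show ?thesis unfolding t(1) by (simp add: vec_eq_iff)
      qed
    next
      case False
      then show ?thesis using w unfolding skorokhod_def by (simp add: extensional_def)
    qed
  qed
qed

lemma strata_mono: "m \<le> m' \<Longrightarrow> strata I k m \<subseteq> strata I k m'"
proof
  fix \<omega> assume m: "m \<le> m'" and w: "\<omega> \<in> strata I k m"
  obtain i N p where k: "k = (i, N, p)" by (cases k)
  show "\<omega> \<in> strata I k m'"
  proof (cases p)
    case 0
    have "real m \<le> real m'" using m by simp
    then show ?thesis using w unfolding k 0 in_strata_bound by (meson order_trans)
  next
    case (Suc p')
    then show ?thesis using w oscillates_less[OF _ m] unfolding k Suc in_strata_osc by blast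
  qed
qed

lemma strata_cover:
  assumes I: "time_set I" and w: "\<omega> \<in> skorokhod I"
  shows "\<exists>m. \<omega> \<in> strata I k m"
proof -
  obtain i N p where k: "k = (i, N, p)" by (cases k)
  show ?thesis
  proof (cases p)
    case 0
    \<comment> \<open>Adding 1 makes the horizon positive even for \<open>N = 0\<close>.\<close>
    have "\<exists>B. \<forall>t\<in>{0..real N + 1}. \<bar>coord_path I \<omega> i t\<bar> \<le> B" by (rule path_bounded[OF I w]) simp
    then obtain B where B: "\<And>t. t \<in> {0..real N + 1} \<Longrightarrow> \<bar>coord_path I \<omega> i t\<bar> \<le> B" by blast
    obtain m :: nat where "max B \<bar>\<omega> \<infinity> $ i\<bar> \<le> real m" using real_arch_simple by blast
    then have "\<omega> \<in> strata I k m" using B w unfolding k 0 in_strata_bound by fastforce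
    then show ?thesis by blast
  next
    case (Suc p')
    obtain m where m: "\<not> oscillates (coord_path I \<omega> i) (1 / real (Suc p')) m (real N)"
      using path_not_oscillates[OF I w, of "1 / real (Suc p')" "real N"] by auto
    then have "\<omega> \<in> strata I k m" using w oscillates_later unfolding k Suc in_strata_osc by (meson less_imp_le)
    then show ?thesis by blast
  qed
qed

lemma strata_bounded:
  fixes x :: "nat \<Rightarrow> ereal \<Rightarrow> real^'d::finite"
  assumes I: "time_set I" and D: "range x \<subseteq> skorokhod I" and conv: "S_conv I x l"
  shows "\<exists>m. range x \<subseteq> strata I k m"
proof -
  obtain i N p where k: "k = (i, N, p)" by (cases k)
  obtain T where T: "0 < T" "S_converges_real T (\<lambda>n t. x n (ereal t) $ i) (\<lambda>t. l (ereal t) $ i)"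
    "\<And>\<omega> u. 0 \<le> u \<Longrightarrow> u \<le> real N \<Longrightarrow> coord_path I \<omega> i u = \<omega> (ereal (min u T)) $ i"
    by (rule S_conv_horizon[OF I conv, where i = i and H = "real N"], rule that)
  show ?thesis
  proof (cases p)
    case 0
    obtain B where B: "\<And>n u. 0 \<le> u \<Longrightarrow> \<bar>x n (ereal (min u T)) $ i\<bar> \<le> B"
      using S_converges_real_bounded[OF T(1,2)] by blast
    obtain B' where B': "\<And>n. \<infinity> \<in> I \<Longrightarrow> \<bar>x n \<infinity> $ i\<bar> \<le> B'"
    proof (cases "\<infinity> \<in> I")
      case True
      then have "I = {0..\<infinity>}" by (rule time_set_infinity[OF I])
      then have "(\<lambda>n. x n \<infinity>) \<longlonglongrightarrow> l \<infinity>" using conv unfolding S_conv_def by simp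
      then have "(\<lambda>n. x n \<infinity> $ i) \<longlonglongrightarrow> l \<infinity> $ i" by (rule tendsto_vec_nth)
      then have "Bseq (\<lambda>n. x n \<infinity> $ i)" by (intro convergent_imp_Bseq convergentI)
      then show ?thesis using that unfolding Bseq_def by auto
    qed (use that in auto)
    obtain m :: nat where "max B B' \<le> real m" using real_arch_simple by blast
    then have m: "B \<le> real m" "B' \<le> real m" by auto
    have "x n \<in> strata I k m" for n
      unfolding k 0 in_strata_bound
    proof (intro conjI ballI impI)
      show "x n \<in> skorokhod I" using D by auto
      show "\<bar>coord_path I (x n) i t\<bar> \<le> real m" if "t \<in> {0..<real N}" for t
        using T(3)[of t "x n"] B[of t n] that m by auto
      show "\<bar>x n \<infinity> $ i\<bar> \<le> real m" if "\<infinity> \<in> I" using B'[OF that, of n] m by simp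
    qed
    then show ?thesis by auto
  next
    case (Suc p')
    obtain m where m: "\<And>n t. \<not> oscillates (\<lambda>u. x n (ereal (min u T)) $ i) (1 / real (Suc p')) m t"
      using S_converges_real_oscillates[OF T(1,2), of "1 / real (Suc p')"] by auto
    have "x n \<in> strata I k m" for n
      unfolding k Suc in_strata_osc
    proof (intro conjI allI impI)
      show "x n \<in> skorokhod I" using D by auto
      fix t assume "t < real N"
      then have "oscillates (coord_path I (x n) i) (1 / real (Suc p')) m t \<longleftrightarrow>
          oscillates (\<lambda>u. x n (ereal (min u T)) $ i) (1 / real (Suc p')) m t"
        by (intro oscillates_cong) (auto simp: T(3))
      then show "\<not> oscillates (coord_path I (x n) i) (1 / real (Suc p')) m t" using m by simp
    qed
    then show ?thesis by auto
  qed
qed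

section \<open>The coarse topology\<close>

context
  fixes I :: "ereal set"
  assumes I: "time_set I"
begin

abbreviation coarse_topology :: "(ereal \<Rightarrow> real^'d::finite) topology" where
  "coarse_topology \<equiv> pullback_topology (skorokhod I) (functionals I) euclidean"

lemma openin_coarse_topology_functional:
  fixes f :: "('d::finite \<times> rat option \<Rightarrow> real) \<Rightarrow> real"
  assumes "continuous_on UNIV f" "open V"
  shows "openin coarse_topology {\<omega> \<in> skorokhod I. f (functionals I \<omega>) \<in> V}"
  unfolding openin_pullback_topology
proof (intro exI conjI)
  show "openin euclidean (f -` V)" using assms by (simp add: continuous_on_open_vimage)
qed auto

text \<open>By right continuity an average of \<open>s * coord_path I \<omega> i\<close> over a
  rational interval inside \<open>(t, t + h)\<close> exceeds \<open>a\<close>. This is an open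
  condition on two coordinates, and an average above \<open>a\<close> forces a value above
  \<open>a\<close>. The sign \<open>s\<close> covers bounds from either side.\<close>

lemma coarse_neighbourhood:
  fixes \<omega> :: "ereal \<Rightarrow> real^'d::finite" and V :: "real set"
  assumes w: "\<omega> \<in> skorokhod I" and t: "0 \<le> t" "0 < h" and s: "s = 1 \<or> s = -1" and a: "a < s * coord_path I \<omega> i t"
  obtains U where "openin coarse_topology U" "\<omega> \<in> U"
    "\<And>\<omega>'. \<omega>' \<in> U \<Longrightarrow> \<exists>u. t \<le> u \<and> u < t + h \<and> a < s * coord_path I \<omega>' i u"
proof -
  obtain p q :: "nat \<Rightarrow> rat" where pq: "\<And>n. t < real_of_rat (p n)" "\<And>n. real_of_rat (p n) < real_of_rat (q n)"
      "(\<lambda>n. real_of_rat (q n)) \<longlonglongrightarrow> t" by (rule rational_right_sequences[of t], rule that)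
  define A where "A n f = s * ((f (i, Some (q n)) - f (i, Some (p n))) / (real_of_rat (q n) - real_of_rat (p n)))"
    for n and f :: "'d \<times> rat option \<Rightarrow> real"
  have A_eq: "A n (functionals I \<omega>) = s * (average (coord_path I \<omega> i) (real_of_rat (p n)) (real_of_rat (q n)))" for n \<omega>
    unfolding A_def by (simp add: functionals_def)
  have "(\<lambda>n. A n (functionals I \<omega>)) \<longlonglongrightarrow> s * coord_path I \<omega> i t"
    unfolding A_eq
    by (intro tendsto_mult_left integral_average_tendsto[OF path_integrable[OF I w] path_right_cont[OF I w t(1)] t(1) pq])
  then have "eventually (\<lambda>n. A n (functionals I \<omega>) > a) sequentially" using a by (rule order_tendstoD(1))
  moreover have "eventually (\<lambda>n. real_of_rat (q n) < t + h) sequentially"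
    using pq(3) by (rule order_tendstoD(2)) (use t in simp)
  ultimately have "eventually (\<lambda>n. A n (functionals I \<omega>) > a \<and> real_of_rat (q n) < t + h) sequentially"
    by eventually_elim blast
  then obtain n where n: "A n (functionals I \<omega>) > a" "real_of_rat (q n) < t + h"
    unfolding eventually_sequentially by blast
  show ?thesis
  proof (rule that[of "{\<omega> \<in> skorokhod I. A n (functionals I \<omega>) \<in> {a<..}}"])
    have "q n \<noteq> p n" using pq(2)[of n] by (metis less_irrefl)
    then have "continuous_on UNIV (A n)" unfolding A_def by (intro continuous_intros) auto
    then show "openin coarse_topology {\<omega> \<in> skorokhod I. A n (functionals I \<omega>) \<in> {a<..}}"
      by (rule openin_coarse_topology_functional) simp
    show "\<omega> \<in> {\<omega> \<in> skorokhod I. A n (functionals I \<omega>) \<in> {a<..}}" using w n by simp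
    fix \<omega>' :: "ereal \<Rightarrow> real^'d" assume "\<omega>' \<in> {\<omega> \<in> skorokhod I. A n (functionals I \<omega>) \<in> {a<..}}"
    then have w': "\<omega>' \<in> skorokhod I" "A n (functionals I \<omega>') > a" by auto
    have "\<exists>u\<in>{real_of_rat (p n)..real_of_rat (q n)}. a < s * coord_path I \<omega>' i u"
    proof (rule ccontr)
      assume "\<not> (\<exists>u\<in>{real_of_rat (p n)..real_of_rat (q n)}. a < s * coord_path I \<omega>' i u)"
      then have le: "\<And>u. u \<in> {real_of_rat (p n)..real_of_rat (q n)} \<Longrightarrow> s * coord_path I \<omega>' i u \<le> a" by (meson not_less)
      have pos: "0 \<le> real_of_rat (p n)" using pq(1)[of n] t by linarith
      have "0 < real_of_rat (q n)" using pos pq(2)[of n] by linarith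
      \<comment> \<open>\<open>integral_average_bounds\<close> is two-sided; \<open>B\<close>
        supplies the side on which \<open>a\<close> says nothing.\<close>
      then have "\<exists>B. \<forall>u\<in>{0..real_of_rat (q n)}. \<bar>coord_path I \<omega>' i u\<bar> \<le> B" by (rule path_bounded[OF I w'(1)])
      then obtain B where B: "\<And>u. u \<in> {0..real_of_rat (q n)} \<Longrightarrow> \<bar>coord_path I \<omega>' i u\<bar> \<le> B" by blast
      have B': "\<bar>coord_path I \<omega>' i u\<bar> \<le> B" if "u \<in> {real_of_rat (p n)..real_of_rat (q n)}" for u
        by (rule B) (use that order_trans[OF pos] in auto)
      have "A n (functionals I \<omega>') \<le> a"
        using s
      proof
        assume s1: "s = 1"
        have "average (coord_path I \<omega>' i) (real_of_rat (p n)) (real_of_rat (q n)) \<in> {-B..a}"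
          by (rule integral_average_bounds[OF path_integrable[OF I w'(1)] pos pq(2)])
             (use le s1 B' in \<open>auto simp: abs_le_iff minus_le_iff\<close>)
        then show ?thesis unfolding A_eq s1 by simp
      next
        assume s1: "s = -1"
        have "average (coord_path I \<omega>' i) (real_of_rat (p n)) (real_of_rat (q n)) \<in> {-a..B}"
          by (rule integral_average_bounds[OF path_integrable[OF I w'(1)] pos pq(2)])
             (use le s1 B' in \<open>auto simp: abs_le_iff minus_le_iff\<close>)
        then show ?thesis unfolding A_eq s1 by (simp only: mult_minus1 atLeastAtMost_iff) linarith
      qed
      then show False using w'(2) by simp
    qed
    then show "\<exists>u. t \<le> u \<and> u < t + h \<and> a < s * coord_path I \<omega>' i u"
      using pq(1)[of n] n(2) by (metis atLeastAtMost_iff less_imp_le order_le_less_trans order_trans)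
  qed
qed

text \<open>Having \<open>j\<close> oscillations is an open condition up to a delay
  \<open>h\<close>: neighbourhoods control averages to the right of a point, so nearby paths
  reproduce a value only slightly later.\<close>

lemma oscillates_coarse_neighbourhood:
  fixes \<omega> :: "ereal \<Rightarrow> real^'d::finite"
  assumes w: "\<omega> \<in> skorokhod I"
  shows "oscillates (coord_path I \<omega> i) \<eta> j t \<Longrightarrow> 0 < h \<Longrightarrow>
    \<exists>U. openin coarse_topology U \<and> \<omega> \<in> U \<and> (\<forall>\<omega>'\<in>U. oscillates (coord_path I \<omega>' i) \<eta> j (t + h))"
proof (induction j arbitrary: t h)
  case 0
  have "openin coarse_topology (skorokhod I :: (ereal \<Rightarrow> real^'d) set)"
    using openin_topspace[of "coarse_topology :: (ereal \<Rightarrow> real^'d) topology"] by (simp only: topspace_pullback_topology) simp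
  then show ?case using w 0 by (intro exI[of _ "skorokhod I"]) auto
next
  case (Suc j)
  then obtain t' s u where *: "oscillates (coord_path I \<omega> i) \<eta> j t'" "t' < s" "s < u" "u \<le> t"
      "\<eta> < \<bar>coord_path I \<omega> i u - coord_path I \<omega> i s\<bar>" by auto
  have t': "0 \<le> t'" by (rule oscillates_nonneg[OF *(1)])
  define \<sigma> where "\<sigma> = (if coord_path I \<omega> i s \<le> coord_path I \<omega> i u then 1 else -1 :: real)"
  have \<sigma>: "\<sigma> = 1 \<or> \<sigma> = -1" "-\<sigma> = 1 \<or> -\<sigma> = -1" unfolding \<sigma>_def by auto
  have diff: "\<eta> < \<sigma> * coord_path I \<omega> i u + (-\<sigma>) * coord_path I \<omega> i s"
    using *(5) unfolding \<sigma>_def by (auto split: if_splits)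
  \<comment> \<open>Half of the excess over \<open>\<eta>\<close>, one share for each end point, so
    that the lowered thresholds \<open>a\<close> and \<open>b\<close> still add up to
    \<open>\<eta>\<close>.\<close>
  define e where "e = (\<sigma> * coord_path I \<omega> i u + (-\<sigma>) * coord_path I \<omega> i s - \<eta>) / 2"
  have e: "0 < e" using diff unfolding e_def by simp
  define a b where "a = \<sigma> * coord_path I \<omega> i u - e" and "b = (-\<sigma>) * coord_path I \<omega> i s - e"
  have ab: "a + b = \<eta>" unfolding a_def b_def e_def by (simp add: field_simps)
  \<comment> \<open>The earlier oscillations may be delayed up to the midpoint of \<open>t'\<close>
    and \<open>s\<close>, the point \<open>s\<close> within \<open>[s, u)\<close> and the point
    \<open>u\<close> within \<open>[u, u + h)\<close>; these windows preserve the order.\<close>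
  obtain U1 where U1: "openin coarse_topology U1" "\<omega> \<in> U1"
      "\<And>\<omega>'. \<omega>' \<in> U1 \<Longrightarrow> oscillates (coord_path I \<omega>' i) \<eta> j (t' + (s - t') / 2)"
    using Suc.IH[OF *(1), of "(s - t') / 2"] *(2) by auto
  obtain U2 where U2: "openin coarse_topology U2" "\<omega> \<in> U2"
    "\<And>\<omega>'. \<omega>' \<in> U2 \<Longrightarrow> \<exists>v. s \<le> v \<and> v < s + (u - s) \<and> b < (-\<sigma>) * coord_path I \<omega>' i v"
    by (rule coarse_neighbourhood[OF w _ _ \<sigma>(2), of s "u - s" b i]) (use * t' e in \<open>auto simp: b_def\<close>)
  obtain U3 where U3: "openin coarse_topology U3" "\<omega> \<in> U3"
    "\<And>\<omega>'. \<omega>' \<in> U3 \<Longrightarrow> \<exists>v. u \<le> v \<and> v < u + h \<and> a < \<sigma> * coord_path I \<omega>' i v"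
    by (rule coarse_neighbourhood[OF w _ _ \<sigma>(1), of u h a i]) (use * t' e Suc.prems in \<open>auto simp: a_def\<close>)
  have "oscillates (coord_path I \<omega>' i) \<eta> (Suc j) (t + h)" if U: "\<omega>' \<in> U1 \<inter> U2 \<inter> U3" for \<omega>'
  proof -
    obtain v where v: "s \<le> v" "v < u" "b < (-\<sigma>) * coord_path I \<omega>' i v" using U2(3)[of \<omega>'] U by auto
    obtain v' where v': "u \<le> v'" "v' < u + h" "a < \<sigma> * coord_path I \<omega>' i v'" using U3(3)[of \<omega>'] U by auto
    have "\<eta> < \<sigma> * (coord_path I \<omega>' i v' - coord_path I \<omega>' i v)" using v(3) v'(3) ab by (simp add: right_diff_distrib)
    then have big: "\<eta> < \<bar>coord_path I \<omega>' i v' - coord_path I \<omega>' i v\<bar>" using \<sigma>(1) by auto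
    have "oscillates (coord_path I \<omega>' i) \<eta> j (t' + (s - t') / 2)" using U1(3) U by blast
    moreover have "t' + (s - t') / 2 < v" using v(1) *(2) by (simp add: field_simps)
    moreover have "v < v'" "v' \<le> t + h" using v v' *(4) by auto
    ultimately show ?thesis using big by auto
  qed
  then show ?case using U1 U2 U3 by (intro exI[of _ "U1 \<inter> U2 \<inter> U3"]) (auto simp: openin_Int)
qed

text \<open>A violation on the time axis is witnessed at some \<open>t < N\<close>; the half-open
  interval leaves room for the delay, so a whole coarse neighbourhood violates the condition. A
  violation at \<infinity> is open because that value is itself a coordinate.\<close>

lemma strata_closed: "closedin coarse_topology (strata I k m :: (ereal \<Rightarrow> real^'d::finite) set)"
proof -
  have top: "topspace coarse_topology = (skorokhod I :: (ereal \<Rightarrow> real^'d) set)" by (simp add: topspace_pullback_topology)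
  obtain i N p where k: "k = (i, N, p)" by (cases k)
  have "\<exists>U. openin coarse_topology U \<and> \<omega> \<in> U \<and> U \<subseteq> skorokhod I - strata I k m"
    if w: "\<omega> \<in> skorokhod I" "\<omega> \<notin> strata I k m" for \<omega> :: "ereal \<Rightarrow> real^'d"
  proof (cases p)
    case 0
    consider t where "0 \<le> t" "t < real N" "\<bar>coord_path I \<omega> i t\<bar> > real m" | "\<infinity> \<in> I" "\<bar>\<omega> \<infinity> $ i\<bar> > real m"
      using w unfolding k 0 in_strata_bound by fastforce
    then show ?thesis
    proof cases
      case (1 t)
      then obtain s where s: "s = 1 \<or> s = -1" "real m < s * coord_path I \<omega> i t"
        by (metis abs_real_def mult_1 mult_minus1)
      obtain U where U: "openin coarse_topology U" "\<omega> \<in> U"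
          "\<And>\<omega>'. \<omega>' \<in> U \<Longrightarrow> \<exists>u. t \<le> u \<and> u < t + (real N - t) \<and> real m < s * coord_path I \<omega>' i u"
        by (rule coarse_neighbourhood[OF w(1) _ _ s, of "real N - t"]) (use 1 in auto)
      have "\<omega>' \<notin> strata I k m" if w': "\<omega>' \<in> U" for \<omega>'
      proof
        assume "\<omega>' \<in> strata I k m"
        moreover obtain u where "t \<le> u" "u < real N" "real m < s * coord_path I \<omega>' i u" using U(3)[OF w'] by auto
        ultimately have "\<bar>coord_path I \<omega>' i u\<bar> \<le> real m" "real m < s * coord_path I \<omega>' i u"
          using 1 unfolding k 0 in_strata_bound by auto
        then show False using s(1) by auto
      qed
      moreover have "U \<subseteq> skorokhod I" using openin_subset[OF U(1)] top by simp
      ultimately show ?thesis using U by blast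
    next
      case 2
      define U where "U = {\<omega> \<in> skorokhod I. functionals I \<omega> (i, None) \<in> - {- real m..real m}}"
      have "openin coarse_topology U" unfolding U_def
        by (rule openin_coarse_topology_functional) (auto intro: open_Compl)
      moreover have "\<omega> \<in> U" using 2 w unfolding U_def by (auto simp: functionals_def abs_le_iff)
      moreover have "U \<subseteq> skorokhod I - strata I k m"
        using 2(1) unfolding U_def k 0 by (auto simp: functionals_def in_strata_bound abs_le_iff)
      ultimately show ?thesis by blast
    qed
  next
    case (Suc p')
    then obtain t where t: "t < real N" "oscillates (coord_path I \<omega> i) (1 / real (Suc p')) m t"
      using w unfolding k Suc in_strata_osc by blast
    define h where "h = (real N - t) / 2"
    have h: "0 < h" "t + h < real N" using t(1) unfolding h_def by (auto simp: field_simps)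
    obtain U where U: "openin coarse_topology U" "\<omega> \<in> U"
        "\<And>\<omega>'. \<omega>' \<in> U \<Longrightarrow> oscillates (coord_path I \<omega>' i) (1 / real (Suc p')) m (t + h)"
      using oscillates_coarse_neighbourhood[OF w(1) t(2) h(1)] by blast
    have "U \<subseteq> skorokhod I" using openin_subset[OF U(1)] top by simp
    moreover have "\<omega>' \<notin> strata I k m" if w': "\<omega>' \<in> U" for \<omega>'
      using U(3)[OF w'] h(2) unfolding k Suc in_strata_osc by auto
    ultimately show ?thesis using U by blast
  qed
  then have "openin coarse_topology (skorokhod I - (strata I k m :: (ereal \<Rightarrow> real^'d) set))"
    by (subst openin_subopen) blast
  moreover have "strata I k m \<subseteq> (skorokhod I :: (ereal \<Rightarrow> real^'d) set)"
    unfolding k by (cases p) (auto simp: in_strata_bound in_strata_osc)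
  ultimately show ?thesis unfolding closedin_def top by blast
qed

text \<open>Integrals are limits of Riemann sums of evaluations, and evaluations are limits of
  averages of integrals, so each family is measurable for the sigma-algebra generated by the
  other.\<close>

lemma canonical_sets_eq_Borel: "Borel_sets coarse_topology = (canonical_sets I :: (ereal \<Rightarrow> real^'d::finite) set set)"
proof
  let ?D = "skorokhod I :: (ereal \<Rightarrow> real^'d) set"
  have top: "topspace coarse_topology = ?D" by (simp add: topspace_pullback_topology)
  define gens where "gens = {{\<omega> \<in> ?D. \<omega> u \<in> B} | u B. u \<in> I \<and> B \<in> sets borel}"
  define M where "M = sigma ?D gens"
  have sub: "gens \<subseteq> Pow ?D" unfolding gens_def by auto
  have sp: "space M = ?D" and st: "sets M = canonical_sets I"
    unfolding M_def canonical_sets_def gens_def[symmetric] using sub by simp_all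
  have eval: "(\<lambda>\<omega>. \<omega> u) \<in> borel_measurable M" if u: "u \<in> I" for u
  proof (rule measurableI)
    fix B :: "(real^'d) set" assume "B \<in> sets borel"
    then have "{\<omega> \<in> ?D. \<omega> u \<in> B} \<in> sets M"
      unfolding st canonical_sets_def using u by (intro sigma_sets.Basic) blast
    moreover have "(\<lambda>\<omega>. \<omega> u) -` B \<inter> space M = {\<omega> \<in> ?D. \<omega> u \<in> B}" unfolding sp by auto
    ultimately show "(\<lambda>\<omega>. \<omega> u) -` B \<inter> space M \<in> sets M" by simp
  qed simp
  have nth: "(\<lambda>v::real^'d. v $ i) \<in> borel_measurable borel" for i
    by (intro borel_measurable_continuous_onI continuous_intros)
  have cp: "(\<lambda>\<omega>. coord_path I \<omega> i t) \<in> borel_measurable M" if "0 \<le> t" for i t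
    unfolding coord_path_def using measurable_compose[OF eval[OF clamp_in_time_set(1)[OF I that]] nth] .
  have fm: "(\<lambda>\<omega>. functionals I \<omega> j) \<in> borel_measurable M" for j
  proof (cases "snd j")
    case None
    show ?thesis
    proof (cases "\<infinity> \<in> I")
      case True
      show ?thesis using measurable_compose[OF eval[OF True] nth] None True by (simp add: functionals_def)
    qed (use None in \<open>simp add: functionals_def\<close>)
  next
    case (Some q)
    define b where "b = real_of_rat q"
    show ?thesis
    proof (cases "0 < b")
      case True
      have "(\<lambda>\<omega>. integral {0..b} (coord_path I \<omega> (fst j))) \<in> borel_measurable M"
      proof (rule borel_measurable_LIMSEQ_metric)
        show "(\<lambda>n. \<Sum>k<Suc n. b / real (Suc n) * coord_path I \<omega> (fst j) (real (Suc k) * b / real (Suc n))) \<longlonglongrightarrow>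
            integral {0..b} (coord_path I \<omega> (fst j))" if "\<omega> \<in> space M" for \<omega>
          by (rule path_Riemann_sums[OF I _ True]) (use that sp in simp)
        show "(\<lambda>\<omega>. \<Sum>k<Suc n. b / real (Suc n) * coord_path I \<omega> (fst j) (real (Suc k) * b / real (Suc n))) \<in> borel_measurable M" for n
          by (intro borel_measurable_sum borel_measurable_times borel_measurable_const cp) (use True in auto)
      qed
      then show ?thesis using Some by (simp add: functionals_def b_def)
    next
      case False
      then have "{0..b} = {} \<or> {0..b} = {0}" by auto
      then have "integral {0..b} f = 0" for f :: "real \<Rightarrow> real" by auto
      then show ?thesis using Some by (simp add: functionals_def b_def)
    qed
  qed
  have "functionals I \<in> borel_measurable M"
    by (rule measurable_coordinatewise_then_product) (rule fm)
  then have "functionals I -` V \<inter> ?D \<in> canonical_sets I" if "open V" for V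
    using measurable_sets[of _ M borel V] that sp st by simp
  then have "{U. openin coarse_topology U} \<subseteq> (canonical_sets I :: (ereal \<Rightarrow> real^'d) set set)"
    unfolding openin_pullback_topology by auto
  then show "Borel_sets coarse_topology \<subseteq> (canonical_sets I :: (ereal \<Rightarrow> real^'d) set set)"
    unfolding Borel_sets_def top canonical_sets_def by (rule sigma_sets_mono)
  define N where "N = sigma ?D {U. openin coarse_topology U}"
  have sub': "{U. openin coarse_topology U} \<subseteq> Pow ?D" using openin_subset top by blast
  have spN: "space N = ?D" and stN: "sets N = Borel_sets coarse_topology"
    unfolding N_def Borel_sets_def top using sub' by simp_all
  have fN: "(\<lambda>\<omega>. functionals I \<omega> j) \<in> borel_measurable N" for j :: "'d \<times> rat option"
  proof (rule borel_measurableI)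
    fix V :: "real set" assume V: "open V"
    have "openin coarse_topology {\<omega> \<in> ?D. functionals I \<omega> j \<in> V}"
      by (rule openin_coarse_topology_functional[of "\<lambda>f. f j", OF _ V]) simp
    then have "{\<omega> \<in> ?D. functionals I \<omega> j \<in> V} \<in> sets N"
      unfolding stN Borel_sets_def top by (intro sigma_sets.Basic) simp
    moreover have "(\<lambda>\<omega>. functionals I \<omega> j) -` V \<inter> space N = {\<omega> \<in> ?D. functionals I \<omega> j \<in> V}" unfolding spN by auto
    ultimately show "(\<lambda>\<omega>. functionals I \<omega> j) -` V \<inter> space N \<in> sets N" by simp
  qed
  have cpN: "(\<lambda>\<omega>. coord_path I \<omega> i t) \<in> borel_measurable N" if t: "0 \<le> t" for i t
  proof -
    obtain p q :: "nat \<Rightarrow> rat" where pq: "\<And>n. t < real_of_rat (p n)" "\<And>n. real_of_rat (p n) < real_of_rat (q n)"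
      "(\<lambda>n. real_of_rat (q n)) \<longlonglongrightarrow> t" by (rule rational_right_sequences[of t], rule that)
    have int: "(\<lambda>\<omega>. integral {0..real_of_rat r} (coord_path I \<omega> i)) \<in> borel_measurable N" for r
      using fN[of "(i, Some r)"] by (simp add: functionals_def)
    show ?thesis
    proof (rule borel_measurable_LIMSEQ_metric)
      show "(\<lambda>\<omega>. average (coord_path I \<omega> i) (real_of_rat (p n)) (real_of_rat (q n))) \<in> borel_measurable N" for n
        by (intro borel_measurable_divide borel_measurable_diff int borel_measurable_const)
      show "(\<lambda>n. average (coord_path I \<omega> i) (real_of_rat (p n)) (real_of_rat (q n))) \<longlonglongrightarrow> coord_path I \<omega> i t" if "\<omega> \<in> space N" for \<omega>
        using that unfolding spN
        by (intro integral_average_tendsto[OF path_integrable[OF I] path_right_cont[OF I _ t] t pq])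
    qed
  qed
  have evalN: "(\<lambda>\<omega>. \<omega> u) \<in> borel_measurable N" if u: "u \<in> I" for u
  proof -
    have "(\<lambda>\<omega>. \<omega> u $ i) \<in> borel_measurable N" for i
    proof (cases "u = \<infinity>")
      case True
      then show ?thesis using fN[of "(i, None)"] u by (simp add: functionals_def)
    next
      case False
      have "0 \<le> u" using I u by (cases rule: time_set_cases) auto
      then obtain t where t: "u = ereal t" "0 \<le> t" using False by (cases u) auto
      then have tI: "ereal t \<in> I" using u by simp
      show ?thesis unfolding t(1) path_eq[OF I tI, symmetric] by (rule cpN[OF t(2)])
    qed
    then have "(\<lambda>\<omega>. \<omega> u \<bullet> b) \<in> borel_measurable N" if b: "b \<in> Basis" for b
    proof -
      obtain i where "b = axis i 1" using b by (auto simp: Basis_vec_def)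
      then show ?thesis using \<open>\<And>i. (\<lambda>\<omega>. \<omega> u $ i) \<in> borel_measurable N\<close>[of i] by (simp add: inner_axis)
    qed
    then show ?thesis using borel_measurable_euclidean_space[of "\<lambda>\<omega>. \<omega> u" N] by blast
  qed
  have "gens \<subseteq> sets N"
  proof
    fix G assume "G \<in> gens"
    then obtain u B where G: "G = {\<omega> \<in> ?D. \<omega> u \<in> B}" "u \<in> I" "B \<in> sets borel" unfolding gens_def by blast
    have "(\<lambda>\<omega>. \<omega> u) -` B \<inter> space N \<in> sets N" by (rule measurable_sets[OF evalN[OF G(2)] G(3)])
    moreover have "(\<lambda>\<omega>. \<omega> u) -` B \<inter> space N = G" unfolding G(1) spN by auto
    ultimately show "G \<in> sets N" by simp
  qed
  then show "canonical_sets I \<subseteq> Borel_sets (coarse_topology :: (ereal \<Rightarrow> real^'d) topology)"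
    unfolding canonical_sets_def gens_def[symmetric] stN Borel_sets_def top by (rule sigma_sets_mono)
qed

end

section \<open>Compactness of the strata\<close>

text \<open>All jump times and sizes, over every coordinate, horizon, accuracy and jump number, form
  one countable family of bounded sequences, so a single subsequence serves them all.
  \<open>E\<close> collects the limiting jump times.\<close>

lemma S_converges_real_step_limits:
  fixes X :: "'i::finite \<Rightarrow> nat \<Rightarrow> nat \<Rightarrow> real \<Rightarrow> real" and z :: "nat \<Rightarrow> 'i \<Rightarrow> real"
  assumes H: "\<And>N. 0 < H N"
    and rc: "\<And>i N n t. 0 \<le> t \<Longrightarrow> t < H N \<Longrightarrow> continuous (at_right t) (X i N n)"
    and osc: "\<And>i N p. \<exists>m. \<forall>n. \<not> oscillates (X i N n) (1 / real (Suc p)) m (H N)"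
    and bd: "\<And>i N. \<exists>B. \<forall>n. \<forall>t\<in>{0..H N}. \<bar>X i N n t\<bar> \<le> B"
    and z: "\<And>i. \<exists>B. \<forall>n. \<bar>z n i\<bar> \<le> B"
  obtains r :: "nat \<Rightarrow> nat" and E :: "real set" and y :: "'i \<Rightarrow> nat \<Rightarrow> real \<Rightarrow> real" and z0 :: "'i \<Rightarrow> real"
  where "strict_mono r" "countable E" "\<And>i. (\<lambda>n. z (r n) i) \<longlonglongrightarrow> z0 i"
    "\<And>i N t. 0 \<le> t \<Longrightarrow> t < H N \<Longrightarrow> continuous (at_right t) (y i N)"
    "\<And>i N t. 0 < t \<Longrightarrow> t \<le> H N \<Longrightarrow> \<exists>l. (y i N \<longlongrightarrow> l) (at_left t)"
    "\<And>i N t. 0 < t \<Longrightarrow> t \<le> H N \<Longrightarrow> t = H N \<or> t \<notin> E \<Longrightarrow> S_converges_real t (\<lambda>n. X i N (r n)) (y i N)"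
    "\<And>i N t. 0 \<le> t \<Longrightarrow> t < H N \<Longrightarrow> t \<notin> E \<Longrightarrow> (\<lambda>n. X i N (r n) t) \<longlonglongrightarrow> y i N t"
proof -
  obtain M where M: "\<And>i N p n. \<not> oscillates (X i N n) (1 / real (Suc p)) (M i N p) (H N)" using osc by metis
  define B where "B i N = (SOME b. \<forall>n. \<forall>t\<in>{0..H N}. \<bar>X i N n t\<bar> \<le> b)" for i N
  have B: "\<forall>n. \<forall>t\<in>{0..H N}. \<bar>X i N n t\<bar> \<le> B i N" for i N
    unfolding B_def by (rule someI_ex[OF bd])
  obtain Bz where Bz: "\<And>i n. \<bar>z n i\<bar> \<le> Bz i" using z by metis
  define Q where "Q i N p n = (\<lambda>(\<tau> :: nat \<Rightarrow> real, d :: nat \<Rightarrow> real).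
      (\<forall>j. \<tau> j \<in> {0..H N}) \<and> (\<forall>B. (\<forall>t\<in>{0..H N}. \<bar>X i N n t\<bar> \<le> B) \<longrightarrow> (\<forall>j. \<bar>d j\<bar> \<le> 2 * B)) \<and>
      (\<forall>t\<in>{0..H N}. \<bar>X i N n t - step_function (Suc (M i N p)) \<tau> d t\<bar> \<le> 1 / real (Suc p)))" for i N p n
  have Q: "\<exists>q. Q i N p n q" for i N p n
  proof -
    have "\<exists>\<tau> d. (\<forall>j. \<tau> j \<in> {0..H N}) \<and> (\<forall>B. (\<forall>t\<in>{0..H N}. \<bar>X i N n t\<bar> \<le> B) \<longrightarrow> (\<forall>j. \<bar>d j\<bar> \<le> 2 * B)) \<and>
      (\<forall>t\<in>{0..H N}. \<bar>X i N n t - step_function (Suc (M i N p)) \<tau> d t\<bar> \<le> 1 / real (Suc p))"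
      by (rule step_approximation[OF H _ M]) (auto intro: rc)
    then show ?thesis unfolding Q_def by auto
  qed
  define \<tau> where "\<tau> i N p n = fst (SOME q. Q i N p n q)" for i N p n
  define d where "d i N p n = snd (SOME q. Q i N p n q)" for i N p n
  have "Q i N p n (\<tau> i N p n, d i N p n)" for i N p n
    using someI_ex[OF Q] unfolding \<tau>_def d_def by simp
  then have sa: "(\<forall>j. \<tau> i N p n j \<in> {0..H N}) \<and>
       (\<forall>B. (\<forall>t\<in>{0..H N}. \<bar>X i N n t\<bar> \<le> B) \<longrightarrow> (\<forall>j. \<bar>d i N p n j\<bar> \<le> 2 * B)) \<and>
      (\<forall>t\<in>{0..H N}. \<bar>X i N n t - step_function (Suc (M i N p)) (\<tau> i N p n) (d i N p n) t\<bar> \<le> 1 / real (Suc p))" for N i n p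
    unfolding Q_def by simp
  have \<tau>_in: "\<tau> i N p n j \<in> {0..H N}" for i N p n j using sa by blast
  have d_le: "\<bar>d i N p n j\<bar> \<le> 2 * B i N" for i N p n j
  proof -
    have "\<forall>t\<in>{0..H N}. \<bar>X i N n t\<bar> \<le> B i N" using B by blast
    then show ?thesis using sa[of i N p n] by blast
  qed
  have approx: "\<bar>X i N n t - step_function (Suc (M i N p)) (\<tau> i N p n) (d i N p n) t\<bar> \<le> 1 / real (Suc p)"
    if "t \<in> {0..H N}" for i N p n t using sa[of i N p n] that by blast
  \<comment> \<open>The last index selects the datum: 0 a jump time, 1 a jump size, any other number
    the value \<open>z n i\<close>.\<close>
  define f :: "nat \<Rightarrow> ('i \<times> nat \<times> nat \<times> nat) \<times> nat \<Rightarrow> real" where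
    "f n = (\<lambda>((i, N, p, j), c). if c = 0 then \<tau> i N p n j else if c = 1 then d i N p n j else z n i)" for n
  define Bf where "Bf = (\<lambda>((i, N, p :: nat, j :: nat), c :: nat). if c = 0 then H N else if c = 1 then 2 * B i N else Bz i)"
  have Bf: "\<bar>f n k\<bar> \<le> Bf k" for n k
  proof -
    obtain i N p j c where k: "k = ((i, N, p, j), c)" by (metis prod.exhaust)
    show ?thesis unfolding k f_def Bf_def using \<tau>_in[of i N p n j] d_le[of i N p n j] Bz[of n i] by auto
  qed
  obtain r l where r: "strict_mono (r :: nat \<Rightarrow> nat)" and l: "\<And>k. (\<lambda>n. f (r n) k) \<longlonglongrightarrow> l k"
    by (rule bounded_functions_convergent_subseq[of f Bf, OF Bf]) (rule that)
  define \<tau>' where "\<tau>' i N p j = l ((i, N, p, j), 0)" for i N p j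
  define d' where "d' i N p j = l ((i, N, p, j), 1)" for i N p j
  define z0 where "z0 i = l ((i, 0, 0, 0), 2)" for i
  have \<tau>_lim: "(\<lambda>n. \<tau> i N p (r n) j) \<longlonglongrightarrow> \<tau>' i N p j" for i N p j
    using l[of "((i, N, p, j), 0)"] unfolding f_def \<tau>'_def by simp
  have d_lim: "(\<lambda>n. d i N p (r n) j) \<longlonglongrightarrow> d' i N p j" for i N p j
    using l[of "((i, N, p, j), 1)"] unfolding f_def d'_def by simp
  have z_lim: "(\<lambda>n. z (r n) i) \<longlonglongrightarrow> z0 i" for i
    using l[of "((i, 0, 0, 0), 2)"] unfolding f_def z0_def by simp
  define E where "E = range (\<lambda>(i, N, p, j). \<tau>' i N p j)"
  have E: "countable E" unfolding E_def by simp
  have E_in: "\<tau>' i N p j \<in> E" for i N p j unfolding E_def by (rule range_eqI[of _ _ "(i, N, p, j)"]) simp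
  have e_lim: "(\<lambda>p. 1 / real (Suc p)) \<longlonglongrightarrow> 0"
    using LIMSEQ_inverse_real_of_nat by (simp add: inverse_eq_divide)
  have e_ge: "0 \<le> 1 / real (Suc p)" for p by simp
  define P where "P i N y \<longleftrightarrow> (\<forall>t. 0 \<le> t \<longrightarrow> t < H N \<longrightarrow> continuous (at_right t) y) \<and>
      (\<forall>t. 0 < t \<longrightarrow> t \<le> H N \<longrightarrow> (\<exists>l. (y \<longlongrightarrow> l) (at_left t))) \<and>
      (\<forall>t. 0 < t \<longrightarrow> t \<le> H N \<longrightarrow> t = H N \<or> t \<notin> E \<longrightarrow> S_converges_real t (\<lambda>n. X i N (r n)) y) \<and>
      (\<forall>t. 0 \<le> t \<longrightarrow> t < H N \<longrightarrow> t \<notin> E \<longrightarrow> (\<lambda>n. X i N (r n) t) \<longlonglongrightarrow> y t)" for i N y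
  have P: "\<exists>y. P i N y" for i N
  proof -
    obtain y where y: "\<And>t. 0 \<le> t \<Longrightarrow> t < H N \<Longrightarrow> continuous (at_right t) y"
      "\<And>t. 0 < t \<Longrightarrow> t \<le> H N \<Longrightarrow> \<exists>l. (y \<longlongrightarrow> l) (at_left t)"
      "\<And>t. 0 < t \<Longrightarrow> t \<le> H N \<Longrightarrow> t = H N \<or> (\<forall>p j. \<tau>' i N p j \<noteq> t) \<Longrightarrow> S_converges_real t (\<lambda>n. X i N (r n)) y"
      "\<And>t. 0 \<le> t \<Longrightarrow> t < H N \<Longrightarrow> (\<forall>p j. \<tau>' i N p j \<noteq> t) \<Longrightarrow> (\<lambda>n. X i N (r n) t) \<longlonglongrightarrow> y t"
      by (rule S_convergence_of_step_approximations[where H = "H N" and e = "\<lambda>p. 1 / real (Suc p)"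
          and \<tau> = "\<lambda>p n. \<tau> i N p (r n)" and d = "\<lambda>p n. d i N p (r n)" and x = "\<lambda>n. X i N (r n)"
          and M = "\<lambda>p. Suc (M i N p)" and \<tau>' = "\<tau>' i N" and d' = "d' i N",
          OF H e_lim e_ge \<tau>_in approx \<tau>_lim d_lim]) (assumption, rule that)
    have nE: "\<forall>p j. \<tau>' i N p j \<noteq> t" if "t \<notin> E" for t using E_in that by blast
    have "P i N y"
      unfolding P_def
    proof (intro conjI allI impI)
      fix t assume t: "0 < t" "t \<le> H N" "t = H N \<or> t \<notin> E"
      show "S_converges_real t (\<lambda>n. X i N (r n)) y" by (rule y(3)[OF t(1,2)]) (use t(3) nE in blast)
    qed (use y(1,2) y(4)[OF _ _ nE] in blast)+
    then show ?thesis by blast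
  qed
  define y where "y i N = (SOME y. P i N y)" for i N
  have Py: "P i N (y i N)" for i N unfolding y_def by (rule someI_ex[OF P])
  show ?thesis
  proof (rule that[of r E z0 y])
    fix i N and t :: real
    show "0 \<le> t \<Longrightarrow> t < H N \<Longrightarrow> continuous (at_right t) (y i N)" using Py[of i N] unfolding P_def by blast
    show "0 < t \<Longrightarrow> t \<le> H N \<Longrightarrow> \<exists>l. (y i N \<longlongrightarrow> l) (at_left t)" using Py[of i N] unfolding P_def by blast
    show "0 < t \<Longrightarrow> t \<le> H N \<Longrightarrow> t = H N \<or> t \<notin> E \<Longrightarrow> S_converges_real t (\<lambda>n. X i N (r n)) (y i N)"
      using Py[of i N] unfolding P_def by blast
    show "0 \<le> t \<Longrightarrow> t < H N \<Longrightarrow> t \<notin> E \<Longrightarrow> (\<lambda>n. X i N (r n) t) \<longlonglongrightarrow> y i N t"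
      using Py[of i N] unfolding P_def by blast
  qed (use r E z_lim in auto)
qed

text \<open>On [0, T] a single horizon suffices. On an unbounded time set the limits for the
  horizons \<open>N + 1\<close> are glued: they are right-continuous and, off a countable set,
  pointwise limits of the same sequence, so they agree on overlaps.\<close>

lemma strata_compact:
  fixes x :: "nat \<Rightarrow> ereal \<Rightarrow> real^'d::finite"
  assumes I: "time_set I" and D: "range x \<subseteq> skorokhod I" and bd: "\<And>k. \<exists>m. range x \<subseteq> strata I k m"
  shows "\<exists>(r :: nat \<Rightarrow> nat) l. strict_mono r \<and> l \<in> skorokhod I \<and> S_conv I (x \<circ> r) l"
proof -
  have xD: "x n \<in> skorokhod I" for n using D by auto
  define X where "X i N n = coord_path I (x n) i" for i and N n :: nat
  define z where "z n i = (if \<infinity> \<in> I then x n \<infinity> $ i else 0)" for n i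
  have rc: "continuous (at_right t) (X i N n)" if "0 \<le> t" for i N n t
    unfolding X_def by (rule path_right_cont[OF I xD that])
  have osc: "\<exists>m. \<forall>n. \<not> oscillates (X i N n) (1 / real (Suc p)) m h" for i N p h
  proof -
    obtain K :: nat where K: "h < real K" using reals_Archimedean2 by blast
    obtain m where "range x \<subseteq> strata I (i, K, Suc p) m" using bd by blast
    then have "x n \<in> strata I (i, K, Suc p) m" for n by auto
    then show ?thesis using K unfolding in_strata_osc X_def by blast
  qed
  have bd': "\<exists>m :: nat. \<forall>n. (\<forall>t\<in>{0..<real K}. \<bar>coord_path I (x n) i t\<bar> \<le> real m) \<and> (\<infinity> \<in> I \<longrightarrow> \<bar>x n \<infinity> $ i\<bar> \<le> real m)" for i K
  proof -
    obtain m where "range x \<subseteq> strata I (i, K, 0) m" using bd by blast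
    then have "x n \<in> strata I (i, K, 0) m" for n by auto
    then show ?thesis unfolding in_strata_bound by blast
  qed
  have Xbd: "\<exists>B. \<forall>n. \<forall>t\<in>{0..h}. \<bar>X i N n t\<bar> \<le> B" for i N h
  proof -
    obtain K :: nat where K: "h < real K" using reals_Archimedean2 by blast
    obtain m :: nat where "\<And>n. \<forall>t\<in>{0..<real K}. \<bar>coord_path I (x n) i t\<bar> \<le> real m" using bd'[of K i] by blast
    then show ?thesis using K unfolding X_def by (intro exI[of _ "real m"]) auto
  qed
  have zbd: "\<exists>B. \<forall>n. \<bar>z n i\<bar> \<le> B" for i
    using bd'[of 0 i] unfolding z_def by (cases "\<infinity> \<in> I") auto
  show ?thesis
    using I
  proof (cases rule: time_set_cases)
    case (compact T)
    obtain r E y z0 where r: "strict_mono (r :: nat \<Rightarrow> nat)"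
      and y: "\<And>i N t. 0 \<le> t \<Longrightarrow> t < T \<Longrightarrow> continuous (at_right t) (y i (N::nat))"
        "\<And>i N t. 0 < t \<Longrightarrow> t \<le> T \<Longrightarrow> \<exists>l. (y i N \<longlongrightarrow> l) (at_left t)"
        "\<And>i N t. 0 < t \<Longrightarrow> t \<le> T \<Longrightarrow> t = T \<or> t \<notin> E \<Longrightarrow> S_converges_real t (\<lambda>n. X i N (r n)) (y i N)"
      by (rule S_converges_real_step_limits[where X = X and z = z and H = "\<lambda>_. T", OF compact(1) rc osc Xbd zbd])
        (assumption, rule that)
    define l where "l = path_function I (\<lambda>i. y i 0) 0"
    have l: "l \<in> skorokhod I"
      unfolding l_def by (rule path_function_in_skorokhod[OF I]) (use y compact in auto)
    have "S_converges_real T (\<lambda>n t. (x \<circ> r) n (ereal t) $ i) (\<lambda>t. l (ereal t) $ i)" for i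
    proof -
      have "S_converges_real T (\<lambda>n. X i 0 (r n)) (y i 0)" by (rule y(3)) (use compact in auto)
      moreover have "X i 0 (r n) t = (x \<circ> r) n (ereal t) $ i" if "t \<in> {0..T}" for n t
        unfolding X_def comp_def by (rule path_eq[OF I]) (use that compact in auto)
      moreover have "y i 0 t = l (ereal t) $ i" if "t \<in> {0..T}" for t
        unfolding l_def path_function_def using that compact by simp
      ultimately show ?thesis
        using S_converges_real_cong[of T "\<lambda>n. X i 0 (r n)" "\<lambda>n t. (x \<circ> r) n (ereal t) $ i" "y i 0" "\<lambda>t. l (ereal t) $ i"] by blast
    qed
    then have "S_conv I (x \<circ> r) l" using compact unfolding S_conv_def S_converges_compact_def by simp
    then show ?thesis using r l by blast
  next
    case infinite
    have mem: "ereal t \<in> I" if "0 \<le> t" for t using infinite that by auto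
    define H where "H N = real N + 1" for N
    have H0: "0 < H N" for N unfolding H_def by simp
    obtain r E y z0 where r: "strict_mono (r :: nat \<Rightarrow> nat)" and E: "countable E"
      and z: "\<And>i. (\<lambda>n. z (r n) i) \<longlonglongrightarrow> z0 i"
      and y: "\<And>i N t. 0 \<le> t \<Longrightarrow> t < H N \<Longrightarrow> continuous (at_right t) (y i N)"
        "\<And>i N t. 0 < t \<Longrightarrow> t \<le> H N \<Longrightarrow> \<exists>l. (y i N \<longlongrightarrow> l) (at_left t)"
        "\<And>i N t. 0 < t \<Longrightarrow> t \<le> H N \<Longrightarrow> t = H N \<or> t \<notin> E \<Longrightarrow> S_converges_real t (\<lambda>n. X i N (r n)) (y i N)"
        "\<And>i N t. 0 \<le> t \<Longrightarrow> t < H N \<Longrightarrow> t \<notin> E \<Longrightarrow> (\<lambda>n. X i N (r n) t) \<longlonglongrightarrow> y i N t"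
      by (rule S_converges_real_step_limits[where X = X and z = z and H = H, OF H0 rc osc Xbd zbd])
        (assumption, rule that)
    have y_eq: "y i N t = y i N' t" if t: "0 \<le> t" "t < H N" "t < H N'" for i N N' t
    proof (rule right_cont_eq_off_countable[OF y(1) y(1) E])
      show "t < min (H N) (H N')" using t by simp
      fix s assume s: "t < s" "s < min (H N) (H N')" "s \<notin> E"
      have "X i N = X i N'" unfolding X_def by simp
      then show "y i N s = y i N' s" using y(4)[of s N i] y(4)[of s N' i] s t LIMSEQ_unique by auto
    qed (use t in auto)
    \<comment> \<open>The horizon \<open>H (nat \<lceil>t\<rceil>)\<close> lies strictly beyond
      \<open>t\<close>, so right continuity at \<open>t\<close> is available for this limit.\<close>
    define Y where "Y i t = y i (nat \<lceil>t\<rceil>) t" for i t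
    have Y_eq: "Y i t = y i N t" if "0 \<le> t" "t < H N" for i N t
      unfolding Y_def by (rule y_eq) (use that in \<open>auto simp: H_def, linarith\<close>)
    define l where "l = path_function I Y (\<chi> i. z0 i)"
    have l: "l \<in> skorokhod I"
      unfolding l_def
    proof (rule path_function_in_skorokhod[OF I])
      fix i and t :: real assume t: "0 \<le> t"
      obtain N :: nat where N: "t < H N" unfolding H_def using reals_Archimedean2[of "t"] by (metis less_add_one order_less_trans)
      have "(y i N \<longlongrightarrow> y i N t) (at_right t)" using y(1)[OF t N] by (simp add: continuous_within)
      moreover have "\<forall>\<^sub>F s in at_right t. y i N s = Y i s"
        by (rule eventually_at_rightI[OF _ N]) (use t Y_eq in auto)
      ultimately have "(Y i \<longlongrightarrow> y i N t) (at_right t)" by (rule Lim_transform_eventually)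
      then show "continuous (at_right t) (Y i)" using Y_eq[OF t N] by (simp add: continuous_within)
    next
      fix i and t :: real assume t: "0 < t"
      obtain N :: nat where N: "t < H N" unfolding H_def using reals_Archimedean2[of "t"] by (metis less_add_one order_less_trans)
      obtain L where "(y i N \<longlongrightarrow> L) (at_left t)" using y(2)[OF t] N by (meson less_imp_le)
      moreover have "\<forall>\<^sub>F s in at_left t. y i N s = Y i s"
      proof (rule eventually_at_leftI[OF _ t])
        show "y i N s = Y i s" if "s \<in> {0<..<t}" for s using Y_eq[of s N i] N that by simp
      qed
      ultimately have "(Y i \<longlongrightarrow> L) (at_left t)" by (rule Lim_transform_eventually)
      then show "\<exists>l. (Y i \<longlongrightarrow> l) (at_left t)" by blast
    qed
    \<comment> \<open>Restriction to [0, t] preserves convergence for \<open>t\<close> outside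
      \<open>E\<close>. Such times exist in every unit interval because \<open>E\<close> is
      countable; they serve as the horizons \<open>T k\<close>.\<close>
    have "\<exists>t. real k < t \<and> t < real k + 1 \<and> t \<notin> E" for k :: nat
    proof -
      have "uncountable {real k<..<real k + 1}" by (simp add: uncountable_open_interval)
      then have "\<not> {real k<..<real k + 1} \<subseteq> E" using E countable_subset by metis
      then have "\<exists>t\<in>{real k<..<real k + 1}. t \<notin> E" unfolding subset_eq by simp
      then show ?thesis by auto
    qed
    then obtain T where T: "\<And>k :: nat. real k < T k" "\<And>k. T k < real k + 1" "\<And>k. T k \<notin> E" by metis
    have T0: "0 < T k" for k using T(1)[of k] by (meson of_nat_0_le_iff order_le_less_trans)
    have "incseq T"
    proof (rule incseq_SucI)
      show "T k \<le> T (Suc k)" for k using T(1)[of "Suc k"] T(2)[of k] by simp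
    qed
    moreover have "filterlim T at_top sequentially"
      by (rule filterlim_at_top_mono[OF filterlim_real_sequentially]) (use T(1) less_imp_le in \<open>auto intro: always_eventually\<close>)
    moreover have "S_converges_real (T k) (\<lambda>n t. (x \<circ> r) n (ereal t) $ i) (\<lambda>t. l (ereal t) $ i)" for i k
    proof -
      have "S_converges_real (T k) (\<lambda>n. X i k (r n)) (y i k)"
        by (rule y(3)) (use T[of k] T0 in \<open>auto simp: H_def\<close>)
      moreover have "X i k (r n) t = (x \<circ> r) n (ereal t) $ i" if "t \<in> {0..T k}" for n t
        unfolding X_def comp_def by (rule path_eq[OF I mem]) (use that in auto)
      moreover have "y i k t = l (ereal t) $ i" if "t \<in> {0..T k}" for t
        unfolding l_def path_function_def using that mem T(2)[of k] Y_eq[of t k i] by (auto simp: H_def)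
      ultimately show ?thesis
        using S_converges_real_cong[of "T k" "\<lambda>n. X i k (r n)" "\<lambda>n t. (x \<circ> r) n (ereal t) $ i" "y i k" "\<lambda>t. l (ereal t) $ i"] by blast
    qed
    ultimately have S: "S_converges_infinite (x \<circ> r) l" unfolding S_converges_infinite_def using T0 by blast
    have "(\<lambda>n. (x \<circ> r) n \<infinity>) \<longlonglongrightarrow> l \<infinity>" if "I = {0..\<infinity>}"
    proof (rule vec_tendstoI)
      fix i
      have "\<infinity> \<in> I" using that by simp
      then show "(\<lambda>n. (x \<circ> r) n \<infinity> $ i) \<longlonglongrightarrow> l \<infinity> $ i"
        using z[of i] unfolding z_def l_def path_function_def by (simp add: comp_def)
    qed
    then have "S_conv I (x \<circ> r) l" using S infinite unfolding S_conv_def by auto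
    then show ?thesis using r l by blast
  qed
qed

lemma compactly_stratified_skorokhod:
  assumes I: "time_set I"
  shows "compactly_stratified (skorokhod I :: (ereal \<Rightarrow> real^'d::finite) set) (S_conv I) (functionals I) (strata I)"
proof
  show "\<And>x l r. S_conv I x l \<Longrightarrow> strict_mono r \<Longrightarrow> S_conv I (x \<circ> r) (l :: ereal \<Rightarrow> real^'d)"
    by (rule S_conv_subseq)
  show "\<And>x l j. range x \<subseteq> skorokhod I \<Longrightarrow> l \<in> skorokhod I \<Longrightarrow> S_conv I x (l :: ereal \<Rightarrow> real^'d) \<Longrightarrow>
      (\<lambda>n. functionals I (x n) j) \<longlonglongrightarrow> functionals I l j" by (rule functionals_conv[OF I])
  show "inj_on (functionals I) (skorokhod I :: (ereal \<Rightarrow> real^'d) set)" by (rule inj_functionals[OF I])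
  show "\<And>k m m'. m \<le> m' \<Longrightarrow> strata I k m \<subseteq> (strata I k m' :: (ereal \<Rightarrow> real^'d) set)" by (rule strata_mono)
  show "\<And>x k. x \<in> skorokhod I \<Longrightarrow> \<exists>m. (x :: ereal \<Rightarrow> real^'d) \<in> strata I k m" by (rule strata_cover[OF I])
  show "\<And>x l k. range x \<subseteq> skorokhod I \<Longrightarrow> l \<in> skorokhod I \<Longrightarrow> S_conv I x (l :: ereal \<Rightarrow> real^'d) \<Longrightarrow>
      \<exists>m. range x \<subseteq> strata I k m" by (rule strata_bounded[OF I])
  show "\<And>x. range x \<subseteq> (skorokhod I :: (ereal \<Rightarrow> real^'d) set) \<Longrightarrow> (\<And>k. \<exists>m. range x \<subseteq> strata I k m) \<Longrightarrow>
        \<exists>(r::nat \<Rightarrow> nat) l. strict_mono r \<and> l \<in> skorokhod I \<and> S_conv I (x \<circ> r) l" by (rule strata_compact[OF I])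
  show "\<And>k m. closedin (pullback_topology (skorokhod I) (functionals I) euclidean) (strata I k m :: (ereal \<Rightarrow> real^'d) set)"
    by (rule strata_closed[OF I])
qed

section \<open>The time set \<open>[0,\<infinity>]\<close>\<close>

lemma S_converges_infinite_cong:
  assumes "\<And>n t. x n (ereal t) = y n (ereal t) \<or> t < 0" "\<And>t. l (ereal t) = k (ereal t) \<or> t < 0"
  shows "S_converges_infinite x l \<longleftrightarrow> S_converges_infinite y k"
proof -
  have "S_converges_real T (\<lambda>n t. x n (ereal t) $ i) (\<lambda>t. l (ereal t) $ i) \<longleftrightarrow>
        S_converges_real T (\<lambda>n t. y n (ereal t) $ i) (\<lambda>t. k (ereal t) $ i)" for T i
  proof (rule S_converges_real_cong)
    show "x n (ereal t) $ i = y n (ereal t) $ i" if "t \<in> {0..T}" for n t using assms(1)[of n t] that by auto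
    show "l (ereal t) $ i = k (ereal t) $ i" if "t \<in> {0..T}" for t using assms(2)[of t] that by auto
  qed
  then show ?thesis unfolding S_converges_infinite_def by simp
qed

text \<open>The product with the locally compact space \<open>\<real>\<^sup>d\<close> is again sequential: if \<open>W\<close> is sequentially open
  and contains \<open>{a\<^sub>0} \<times> K\<close> with \<open>K\<close> a compact ball, then the set of \<open>a\<close> with \<open>{a} \<times> K \<subseteq> W\<close> is
  sequentially open.\<close>
lemma S_topology_closed_half_line:
  "(S_topology {0..\<infinity>} :: (ereal \<Rightarrow> real^'d::finite) topology) = sequential_topology (skorokhod {0..\<infinity>}) (S_conv {0..\<infinity>})"
proof -
  let ?I = "{0..\<infinity>::ereal}" and ?J = "{0..<\<infinity>::ereal}"
  let ?D = "skorokhod {0..\<infinity>} :: (ereal \<Rightarrow> real^'d) set" and ?E = "skorokhod {0..<\<infinity>} :: (ereal \<Rightarrow> real^'d) set"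
  define S0 :: "(ereal \<Rightarrow> real^'d) topology" where "S0 = sequential_topology ?E S_converges_infinite"
  define F where "F \<omega> = (restrict \<omega> ?J, \<omega> \<infinity>)" for \<omega> :: "ereal \<Rightarrow> real^'d"
  \<comment> \<open>The inverse of \<open>F\<close> on pairs whose first component is a path on [0,
    \<infinity>).\<close>
  define glue where "glue a v = (\<lambda>u. if u = \<infinity> then v else a u)" for a :: "ereal \<Rightarrow> real^'d" and v
  have "\<infinity> \<in> ?I" "\<infinity> \<notin> ?J" by auto
  then have ne: "?J \<noteq> ?I" by metis
  have J: "time_set ?J" unfolding time_set_def by simp
  interpret J: compactly_stratified ?E "S_conv ?J" "functionals ?J" "strata ?J"
    by (rule compactly_stratified_skorokhod[OF J])
  have convJ: "S_conv ?J = (S_converges_infinite :: (nat \<Rightarrow> ereal \<Rightarrow> real^'d) \<Rightarrow> _)"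
    unfolding S_conv_def using ne by auto
  have convI: "S_conv ?I x l \<longleftrightarrow> S_converges_infinite x l \<and> (\<lambda>n. x n \<infinity>) \<longlonglongrightarrow> l \<infinity>" for x and l :: "ereal \<Rightarrow> real^'d"
    unfolding S_conv_def by simp
  have glue_D: "glue a v \<in> ?D" if a: "a \<in> ?E" for a v
  proof -
    have ev: "\<forall>\<^sub>F s in at t within B. a s = glue a v s" if "t \<noteq> \<infinity>" for t B
    proof -
      have "\<forall>\<^sub>F s in at t within B. s < \<infinity>"
        by (rule order_tendstoD(2)[OF tendsto_ident_at]) (use that in auto)
      then show ?thesis by eventually_elim (auto simp: glue_def)
    qed
    have set: "at t within ?I \<inter> B = at t within ?J \<inter> B" if "t \<noteq> \<infinity>" for t :: ereal and B
    proof (rule at_within_nhd[of t "{..<\<infinity>}"])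
      show "t \<in> {..<\<infinity>}" using that by auto
    qed auto
    show ?thesis
      unfolding skorokhod_def
    proof (intro CollectI conjI ballI impI)
      show "glue a v \<in> extensional ?I"
        using a unfolding skorokhod_def glue_def extensional_def by auto
      fix t :: ereal assume t: "t \<in> ?I" "t \<noteq> \<infinity>"
      then have tJ: "t \<in> ?J" by auto
      have "(a \<longlongrightarrow> a t) (at t within ?J \<inter> {t<..})" using a tJ t unfolding skorokhod_def by blast
      then show "(glue a v \<longlongrightarrow> glue a v t) (at t within ?I \<inter> {t<..})"
        unfolding set[OF t(2)] using Lim_transform_eventually[OF _ ev[OF t(2)]] t(2) by (simp add: glue_def)
      obtain L where "(a \<longlongrightarrow> L) (at t within ?J \<inter> {..<t})" using a tJ t unfolding skorokhod_def by blast
      then show "\<exists>l. (glue a v \<longlongrightarrow> l) (at t within ?I \<inter> {..<t})"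
        unfolding set[OF t(2)] using Lim_transform_eventually[OF _ ev[OF t(2)]] by blast
    qed
  qed
  have F_glue: "F (glue a v) = (a, v)" if "a \<in> ?E" for a v
  proof -
    have "restrict (glue a v) ?J = a"
      using that unfolding skorokhod_def glue_def by (intro ext) (auto simp: extensional_def)
    then show ?thesis unfolding F_def by (simp add: glue_def)
  qed
  have glue_F: "glue (restrict \<omega> ?J) (\<omega> \<infinity>) = \<omega>" if "\<omega> \<in> ?D" for \<omega>
    using that unfolding skorokhod_def glue_def by (intro ext) (auto simp: extensional_def)
  have F_D: "restrict \<omega> ?J \<in> ?E" if "\<omega> \<in> ?D" for \<omega> by (rule restrict_skorokhod_infinite[OF that])
  have conv_restrict: "S_converges_infinite (\<lambda>n. restrict (x n) ?J) (restrict l ?J) \<longleftrightarrow> S_converges_infinite x l"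
    for x and l :: "ereal \<Rightarrow> real^'d"
    by (rule S_converges_infinite_cong) auto
  have conv_glue: "S_conv ?I (\<lambda>n. glue (x n) (v n)) (glue l w) \<longleftrightarrow> S_converges_infinite x l \<and> v \<longlonglongrightarrow> w"
    for x v w and l :: "ereal \<Rightarrow> real^'d"
  proof -
    have "S_converges_infinite (\<lambda>n. glue (x n) (v n)) (glue l w) \<longleftrightarrow> S_converges_infinite x l"
      by (rule S_converges_infinite_cong) (auto simp: glue_def)
    then show ?thesis unfolding convI by (simp add: glue_def)
  qed
  \<comment> \<open>Convergence of constant sequences is extracted from compactness:
    \<open>a\<close> lies in some stratum for each index, and the limit of a constant subsequence
    has the same functionals as \<open>a\<close>.\<close>
  have const: "subseq_converges S_converges_infinite (\<lambda>n. a) a" if a: "a \<in> ?E" for a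
  proof -
    have "\<exists>m. range (\<lambda>n::nat. a) \<subseteq> strata ?J k m" for k using J.C_cover[OF a, of k] by auto
    then obtain r l where rl: "strict_mono (r :: nat \<Rightarrow> nat)" "l \<in> ?E" "S_conv ?J ((\<lambda>n. a) \<circ> r) l"
      using J.C_compact[of "\<lambda>n. a"] a by auto
    then have ca: "S_converges_infinite (\<lambda>n. a) l" unfolding convJ by (simp add: comp_def)
    have "(\<lambda>n::nat. functionals ?J a j) \<longlonglongrightarrow> functionals ?J l j" for j
      using J.conv_coordinate[of "\<lambda>n. a" l j] a rl(2) ca unfolding convJ by auto
    then have "functionals ?J a j = functionals ?J l j" for j using LIMSEQ_unique[OF tendsto_const] by blast
    then have "a = l" using inj_onD[OF J.inj _ a rl(2)] by blast
    then have "S_converges_infinite (\<lambda>n. a) a" using ca by simp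
    then show ?thesis unfolding subseq_converges_def
      by (intro allI impI exI[of _ id]) (auto simp: comp_def strict_mono_id)
  qed
  have "openin (pullback_topology ?D F (prod_topology S0 euclidean)) U \<longleftrightarrow>
      openin (sequential_topology ?D (S_conv ?I)) U" for U
  proof
    assume "openin (pullback_topology ?D F (prod_topology S0 euclidean)) U"
    then obtain W where W: "openin (prod_topology S0 euclidean) W" "U = F -` W \<inter> ?D"
      unfolding openin_pullback_topology by blast
    show "openin (sequential_topology ?D (S_conv ?I)) U"
      unfolding openin_sequential_topology seq_closed_def
    proof (intro conjI allI impI)
      show "U \<subseteq> ?D" using W(2) by blast
      fix x l assume x: "range x \<subseteq> ?D - U \<and> l \<in> ?D \<and> subseq_converges (S_conv ?I) x l"
      have "l \<notin> U"
      proof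
        assume "l \<in> U"
        then have "(restrict l ?J, l \<infinity>) \<in> W" using W(2) unfolding F_def by blast
        then obtain V1 V2 where V: "openin S0 V1" "open V2" "restrict l ?J \<in> V1" "l \<infinity> \<in> V2" "V1 \<times> V2 \<subseteq> W"
          using W(1) unfolding openin_prod_topology_alt by (metis open_openin)
        obtain q :: "nat \<Rightarrow> nat" where "S_conv ?I (x \<circ> id \<circ> q) l"
          using x strict_mono_id unfolding subseq_converges_def by blast
        then have c: "S_converges_infinite (x \<circ> q) l" "(\<lambda>n. x (q n) \<infinity>) \<longlonglongrightarrow> l \<infinity>"
          unfolding convI by (simp_all add: comp_def)
        have xq: "x (q n) \<in> ?D" for n using x by auto
        have "limitin S0 (\<lambda>n. restrict ((x \<circ> q) n) ?J) (restrict l ?J) sequentially"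
          unfolding S0_def
        proof (rule limitin_sequential_topology)
          show "S_converges_infinite (\<lambda>n. restrict ((x \<circ> q) n) ?J) (restrict l ?J)"
            using c(1) conv_restrict[of "x \<circ> q" l] by blast
          show "restrict l ?J \<in> ?E" using x F_D by blast
          show "range (\<lambda>n. restrict ((x \<circ> q) n) ?J) \<subseteq> ?E" using F_D[OF xq] by auto
        qed (rule S_converges_infinite_subseq)
        then have "\<forall>\<^sub>F n in sequentially. restrict ((x \<circ> q) n) ?J \<in> V1" using V(1,3) unfolding limitin_def by blast
        moreover have "\<forall>\<^sub>F n in sequentially. x (q n) \<infinity> \<in> V2" using topological_tendstoD[OF c(2) V(2,4)] .
        ultimately have "\<forall>\<^sub>F n in sequentially. x (q n) \<in> U"
        proof eventually_elim
          case (elim n)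
          then have "F (x (q n)) \<in> W" using V(5) unfolding F_def by auto
          then show ?case using W(2) xq by blast
        qed
        then obtain n where "x (q n) \<in> U" unfolding eventually_sequentially by blast
        then show False using x by auto
      qed
      then show "l \<in> ?D - U" using x by blast
    qed blast
  next
    assume U: "openin (sequential_topology ?D (S_conv ?I)) U"
    then have UD: "U \<subseteq> ?D" and Uc: "seq_closed ?D (S_conv ?I) (?D - U)"
      unfolding openin_sequential_topology by auto
    \<comment> \<open>The complement of \<open>U\<close> is closed under joint limits, subsequential
      in the path and ordinary in the value at \<infinity>. Openness of the slices and of
      \<open>V1\<close> below both rest on this.\<close>
    have limU: "glue a w \<notin> U"
      if "\<And>n. x n \<in> ?E" "\<And>n. glue (x n) (v n) \<notin> U" "a \<in> ?E" "subseq_converges S_converges_infinite x a" "v \<longlonglongrightarrow> w"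
      for x v a w
    proof -
      have "subseq_converges (S_conv ?I) (\<lambda>n. glue (x n) (v n)) (glue a w)"
        unfolding subseq_converges_def
      proof (intro allI impI)
        fix r :: "nat \<Rightarrow> nat" assume r: "strict_mono r"
        then obtain q :: "nat \<Rightarrow> nat" where q: "strict_mono q" "S_converges_infinite (x \<circ> r \<circ> q) a"
          using \<open>subseq_converges S_converges_infinite x a\<close> unfolding subseq_converges_def by blast
        have "(\<lambda>n. v (r (q n))) \<longlonglongrightarrow> w"
          using LIMSEQ_subseq_LIMSEQ[OF \<open>v \<longlonglongrightarrow> w\<close> strict_mono_o[OF r q(1)]] by (simp add: comp_def)
        then have "S_conv ?I (\<lambda>n. glue (x (r (q n))) (v (r (q n)))) (glue a w)"
          unfolding conv_glue using q(2) by (simp add: comp_def)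
        then show "\<exists>q. strict_mono q \<and> S_conv ?I ((\<lambda>n. glue (x n) (v n)) \<circ> r \<circ> q) (glue a w)"
          using q(1) by (intro exI[of _ q]) (simp add: comp_def)
      qed
      moreover have "range (\<lambda>n. glue (x n) (v n)) \<subseteq> ?D - U" using that(1,2) glue_D by blast
      ultimately have "glue a w \<in> ?D - U" using Uc glue_D[OF that(3)] unfolding seq_closed_def by blast
      then show ?thesis by blast
    qed
    define W where "W = F ` U"
    have W_iff: "(a, v) \<in> W \<longleftrightarrow> glue a v \<in> U" if "a \<in> ?E" for a v
    proof
      assume "(a, v) \<in> W"
      then obtain \<omega> where "\<omega> \<in> U" "restrict \<omega> ?J = a" "\<omega> \<infinity> = v" unfolding W_def F_def by auto
      then show "glue a v \<in> U" using glue_F[of \<omega>] UD by auto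
    next
      assume "glue a v \<in> U"
      then show "(a, v) \<in> W" unfolding W_def using F_glue[OF that] by (metis imageI)
    qed
    have W_sub: "a \<in> ?E" if "(a, v) \<in> W" for a v using that UD F_D unfolding W_def F_def by auto
    have "openin (prod_topology S0 euclidean) W"
      unfolding openin_prod_topology_alt
    proof (intro allI impI)
      fix a v assume av: "(a, v) \<in> W"
      have a: "a \<in> ?E" by (rule W_sub[OF av])
      have "open {w. glue a w \<in> U}"
      proof -
        have "closed {w. glue a w \<notin> U}"
          unfolding closed_sequential_limits
        proof (intro allI impI)
          fix s w assume "(\<forall>n. s n \<in> {w. glue a w \<notin> U}) \<and> s \<longlonglongrightarrow> w"
          then show "w \<in> {w. glue a w \<notin> U}" using limU[of "\<lambda>n. a" s a w] a const[OF a] by auto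
        qed
        then have "open (- {w. glue a w \<notin> U})" by (rule open_Compl)
        moreover have "- {w. glue a w \<notin> U} = {w. glue a w \<in> U}" by auto
        ultimately show ?thesis by simp
      qed
      moreover have "v \<in> {w. glue a w \<in> U}" using W_iff[OF a] av by simp
      ultimately obtain e where e: "e > 0" "cball v e \<subseteq> {w. glue a w \<in> U}" unfolding open_contains_cball by blast
      define V1 where "V1 = {b \<in> ?E. \<forall>w\<in>cball v e. glue b w \<in> U}"
      have "openin S0 V1"
        unfolding S0_def openin_sequential_topology seq_closed_def
      proof (intro conjI allI impI)
        fix x l assume x: "range x \<subseteq> ?E - V1 \<and> l \<in> ?E \<and> subseq_converges S_converges_infinite x l"
        have "\<exists>w. w \<in> cball v e \<and> glue (x n) w \<notin> U" for n
        proof -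
          have "x n \<in> range x" by simp
          then have "x n \<in> ?E" "x n \<notin> V1" using x by blast+
          then show ?thesis unfolding V1_def by blast
        qed
        then obtain w where w: "\<And>n. w n \<in> cball v e" "\<And>n. glue (x n) (w n) \<notin> U" by metis
        have xE: "x n \<in> ?E" for n
        proof -
          have "x n \<in> range x" by simp
          then show ?thesis using x by blast
        qed
        \<comment> \<open>The offending values \<open>w n\<close> accumulate inside the ball; this
          is where local compactness of the second factor enters.\<close>
        have "compact (cball v e)" by (rule compact_cball)
        then obtain w0 r where r: "w0 \<in> cball v e" "strict_mono r" "(w \<circ> r) \<longlonglongrightarrow> w0"
          using w(1) unfolding compact_def by metis
        have "glue l w0 \<notin> U"
        proof (rule limU[of "x \<circ> r" "w \<circ> r"])
          show "subseq_converges S_converges_infinite (x \<circ> r) l" using x r(2) by (intro subseq_converges_subseq) auto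
        qed (use x xE w r in auto)
        then show "l \<in> ?E - V1" using x r(1) unfolding V1_def by blast
      qed (auto simp: V1_def)
      moreover have "a \<in> V1" using a e(2) unfolding V1_def by blast
      moreover have "V1 \<times> ball v e \<subseteq> W"
      proof
        fix p assume "p \<in> V1 \<times> ball v e"
        then obtain b w where "p = (b, w)" "b \<in> V1" "w \<in> ball v e" by blast
        then show "p \<in> W" using W_iff[of b w] unfolding V1_def by auto
      qed
      ultimately show "\<exists>U V. openin S0 U \<and> openin euclidean V \<and> a \<in> U \<and> v \<in> V \<and> U \<times> V \<subseteq> W"
        using e(1) by (intro exI[of _ V1] exI[of _ "ball v e"]) auto
    qed
    moreover have "U = F -` W \<inter> ?D"
    proof
      show "U \<subseteq> F -` W \<inter> ?D" using UD unfolding W_def by blast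
      show "F -` W \<inter> ?D \<subseteq> U"
      proof
        fix \<omega> assume "\<omega> \<in> F -` W \<inter> ?D"
        then show "\<omega> \<in> U" using W_iff[OF F_D[of \<omega>], of "\<omega> \<infinity>"] glue_F[of \<omega>] unfolding F_def by auto
      qed
    qed
    ultimately show "openin (pullback_topology ?D F (prod_topology S0 euclidean)) U"
      unfolding openin_pullback_topology by blast
  qed
  moreover have "S_topology ?I = pullback_topology ?D F (prod_topology S0 euclidean)"
    unfolding S_topology_def S0_def F_def by simp
  ultimately show ?thesis unfolding topology_eq by simp
qed

lemma S_topology_eq_sequential_topology:
  "(S_topology I :: (ereal \<Rightarrow> real^'d::finite) topology) = sequential_topology (skorokhod I) (S_conv I)"
proof -
  consider "I = {0..\<infinity>}" | "I \<noteq> {0..\<infinity>}" "I = {0..<\<infinity>}" | "I \<noteq> {0..\<infinity>}" "I \<noteq> {0..<\<infinity>}" by blast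
  then show ?thesis
  proof cases
    case 1
    show ?thesis unfolding 1 by (rule S_topology_closed_half_line)
  next
    case 2
    then have "(S_conv I :: _ \<Rightarrow> (ereal \<Rightarrow> real^'d) \<Rightarrow> bool) = S_converges_infinite" unfolding S_conv_def by (intro ext) simp
    then show ?thesis using 2(1) unfolding 2(2) S_topology_def by simp
  next
    case 3
    then have "(S_conv I :: _ \<Rightarrow> (ereal \<Rightarrow> real^'d) \<Rightarrow> bool) = S_converges_compact (real_of_ereal (Sup I))" unfolding S_conv_def by (intro ext) simp
    then show ?thesis using 3 unfolding S_topology_def by (simp only: if_False)
  qed
qed

theorem proposition5p7:
  fixes I :: "ereal set" and S Sstar :: "(ereal \<Rightarrow> real^'d::finite) topology"
  assumes "(\<exists>T. 0 < T \<and> T \<le> \<infinity> \<and> I = {0..T}) \<or> I = {0..<\<infinity>}"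
    and "S = S_topology I"
    and "Sstar = weak_topology S"
  shows "(\<forall>\<tau>\<in>{S, Sstar}.
           Hausdorff_space \<tau> \<and>
           (\<forall>K. compactin \<tau> K \<longrightarrow> metrizable_space (subtopology \<tau> K)) \<and>
           (\<forall>K. compactin \<tau> K \<longleftrightarrow> sequentially_compactin \<tau> K) \<and>
           Borel_sets \<tau> = canonical_sets I \<and>
           Lusin_space \<tau>) \<and>
         perfectly_normal_space Sstar \<and> paracompact_space Sstar \<and>
         Borel_sets Sstar = Baire_sets Sstar \<and>
         {f. continuous_map S euclideanreal f} = {f. continuous_map Sstar euclideanreal f} \<and>
         {K. compactin S K} = {K. compactin Sstar K}"
proof -
  have I: "time_set I" using assms(1) unfolding time_set_def .
  show ?thesis
    unfolding assms(2,3) S_topology_eq_sequential_topology canonical_sets_eq_Borel[OF I, symmetric]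
    by (rule compactly_stratified.sequential_topology_properties[OF compactly_stratified_skorokhod[OF I]])
qed

end
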